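(* Let $(M,g)$ be a pseudo Riemannian manifold of dimension $m$ and signature $(p,q)$. Then the integrable $(\lambda,\ell)$-structures on $(M,g)$ (the integrable $(1,1;n)$-structures, $0\le n\le m$, when $\lambda=\ell=1$) are smooth sections of a fiber bundle over $M$, namely the $(\lambda,\ell)$-twistor bundle (whose fiber over $x\in M$ is the set $\sigma_x(\lambda,\ell)$, respectively $\sigma_x(1,1;n)$), with typical fiber $G/H$ as follows: (1) $\lambda=1,\ \ell=1$, $\mathrm{sig}=n$: $G=O(m,\mathbb{C})$, $H=O(n,m-n)$; (2) $\lambda=1,\ \ell=-1$: $G=O(p,q)\times O(p,q)$, $H=O(p,q)$; (3) $\lambda=-1,\ \ell=1$: $G=O(p,p)\times O(p,p)$, $H=O(p,p)$ (here $p=q$, since the existence of an integrable $(-1,1)$-structure forces $g$ to have split signature); (4) $\lambda=-1,\ \ell=-1$: $G=O(m,\mathbb{C})$, $H=SO^{*}(m)$ (here $m$ is even).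
   Context: All objects are smooth. For a bilinear form $c$, $c^{\flat}(u)(v)=c(u,v)$. Signature $(p,q)$ means $p$ positive and $q$ negative directions. Extended tangent bundle: $\mathbb{T}M=TM\oplus TM^{*}$ with $b(u+\sigma,v+\tau)=\tau(u)+\sigma(v)$ and the Courant bracket $[u+\sigma,v+\tau]=[u,v]+\mathcal{L}_u\tau-\mathcal{L}_v\sigma-\tfrac12 d(\tau(u)-\sigma(v))$. A real linear isomorphism $S$ with $S^2=\lambda\,\mathrm{id}$ ($\lambda=\pm1$) is split if $\operatorname{tr}S=0$. A generalized complex ($\lambda=-1$), respectively generalized paracomplex ($\lambda=1$), structure on $M$ is a smooth section $S$ of $\mathrm{End}(\mathbb{T}M)$ such that $S^2=\lambda\,\mathrm{id}$, $S$ is split, $S$ is skew-symmetric for $b$, and the sections of each $\pm\sqrt\lambda$-eigenbundle are closed under the Courant bracket (complexified if $\lambda=-1$). For $k=\pm1$, $I_k=\begin{pmatrix}0 & k(g^{\flat})^{-1}\\ g^{\flat} & 0\end{pmatrix}$. An integrable $(\lambda,\ell)$-structure on $(M,g)$ is such an $S$ with $SI_k=-I_kS$, $k=-\lambda\ell$. For an integrable $(1,1)$-structure $S$, the form $\beta_S(x,y)=b(SI_{-1}x,y)$ on $\mathbb{T}M$ is symmetric of signature $(2n,2m-2n)$ for some integer $0\le n\le m$; then $S$ is called an integrable $(1,1;n)$-structure and one writes $\mathrm{sig}(S)=n$. For $x\in M$, $\sigma_x(\lambda,\ell)$ is the set of all $S\in\mathrm{End}_{\mathbb{R}}(\mathbb{T}_xM)$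 with $S^2=\lambda\,\mathrm{id}$, $S$ split and skew-symmetric for $b_x$, and $S(I_k)_x=-(I_k)_xS$ with $k=-\lambda\ell$; $\sigma_x(1,1;n)$ is the set of $S\in\sigma_x(1,1)$ for which $\beta_S(u,v)=b_x(S(I_{-1})_xu,v)$ has signature $(2n,2m-2n)$. Groups: $O(a,c)$ is the automorphism group of the standard symmetric form of signature $(a,c)$ on $\mathbb{R}^{a+c}$; $O(m,\mathbb{C})$ is the complex orthogonal group of the form $Z^tW$ on $\mathbb{C}^m$; for $m$ even, $SO^{*}(m)$ is the group of automorphisms of a nondegenerate anti-Hermitian form on $\mathbb{H}^{m/2}$ ($\mathbb{H}$ the quaternions, right vector spaces), i.e. the usual real form of $SO(m,\mathbb{C})$. The inclusions $H\subset G$ are: in (1) and (4) the standard ones as real forms; in (2) the diagonal; in (3) $A\mapsto(A,rAr)$ with $r(x_1,x_2)=(x_2,x_1)$ for $x_1,x_2\in\mathbb{R}^p$, where $\mathbb{R}^{2p}$ carries the form $\langle x_1,x_1'\rangle-\langle x_2,x_2'\rangle$. *)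

theory Defs
  imports "HOL-Analysis.Analysis" "HOL-Library.Countable_Set" "HOL-Algebra.Left_Coset"
begin

section \<open>Smooth maps\<close>

text \<open>\<open>Ck_on k S f\<close> and \<open>smooth_on S f\<close> are meant for open subsets \<open>S\<close> of finite-dimensional spaces.\<close>

primrec Ck_on :: "nat \<Rightarrow> 'v::real_normed_vector set \<Rightarrow> ('v \<Rightarrow> 'w::real_normed_vector) \<Rightarrow> bool" where
  "Ck_on 0 S f \<longleftrightarrow> continuous_on S f"
| "Ck_on (Suc k) S f \<longleftrightarrow> (\<forall>x\<in>S. f differentiable (at x)) \<and>
     (\<forall>v. Ck_on k S (\<lambda>x. frechet_derivative f (at x) v))"

definition smooth_on :: "'v::real_normed_vector set \<Rightarrow> ('v \<Rightarrow> 'w::real_normed_vector) \<Rightarrow> bool" where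
  "smooth_on S f \<longleftrightarrow> (\<forall>k. Ck_on k S f)"

text \<open>Smoothness of a map on an arbitrary (typically embedded) subset \<open>X\<close>:
  local extendability to a smooth map on an open set.\<close>

definition smooth_rel :: "'v::real_normed_vector set \<Rightarrow> ('v \<Rightarrow> 'w::real_normed_vector) \<Rightarrow> bool" where
  "smooth_rel X f \<longleftrightarrow>
     (\<forall>x\<in>X. \<exists>W F. open W \<and> x \<in> W \<and> smooth_on W F \<and> (\<forall>y\<in>X \<inter> W. F y = f y))"

section \<open>Manifolds, bundles and sections in charts\<close>

text \<open>The manifold is the whole type \<open>'a\<close>, whose sort supplies the Hausdorff and second countability
  axioms; its dimension is \<open>CARD('m)\<close>.  The atlas need not be maximal.\<close>

type_synonym ('a, 'm) chart = "'a set \<times> ('a \<Rightarrow> real^'m)"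

abbreviation cdom :: "('a, 'm::finite) chart \<Rightarrow> 'a set" where "cdom c \<equiv> fst c"
abbreviation cmap :: "('a, 'm::finite) chart \<Rightarrow> 'a \<Rightarrow> real^'m" where "cmap c \<equiv> snd c"

definition cinv :: "('a, 'm::finite) chart \<Rightarrow> real^'m \<Rightarrow> 'a" where
  "cinv c = inv_into (cdom c) (cmap c)"

definition smooth_atlas ::
  "('a::{t2_space, second_countable_topology}, 'm::finite) chart set \<Rightarrow> bool" where
  "smooth_atlas A \<longleftrightarrow>
     (\<Union>c\<in>A. cdom c) = UNIV \<and>
     (\<forall>c\<in>A. open (cdom c) \<and> open (cmap c ` cdom c) \<and>
        homeomorphism (cdom c) (cmap c ` cdom c) (cmap c) (cinv c)) \<and>
     (\<forall>c\<in>A. \<forall>d\<in>A. smooth_on (cmap c ` (cdom c \<inter> cdom d)) (cmap d \<circ> cinv c))"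

definition charts_at :: "('a, 'm::finite) chart set \<Rightarrow> 'a \<Rightarrow> ('a, 'm) chart set" where
  "charts_at A x = {c\<in>A. x \<in> cdom c}"

definition jacobian :: "('a, 'm::finite) chart \<Rightarrow> ('a, 'm) chart \<Rightarrow> 'a \<Rightarrow> real^'m^'m" where
  "jacobian c d x = matrix (frechet_derivative (cmap d \<circ> cinv c) (at (cmap c x)))"

text \<open>A geometric object at a point \<open>x\<close> is the family of its components in the charts around \<open>x\<close>,
  subject to the usual transformation law (and \<open>0\<close> at all other charts, so that equality
  of families is equality of objects).  An element of the extended tangent space has
  components in \<open>real^('m + 'm)\<close>: the \<open>Inl\<close> components are those of the vector, the \<open>Inr\<close>
  components those of the covector.\<close>

definition gtrans :: "('a, 'm::finite) chart \<Rightarrow> ('a, 'm) chart \<Rightarrow> 'a \<Rightarrow> real^('m + 'm)^('m + 'm)" where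
  "gtrans c d x = (\<chi> r s. case (r, s) of
      (Inl i, Inl j) \<Rightarrow> jacobian c d x $ i $ j
    | (Inr i, Inr j) \<Rightarrow> transpose (jacobian d c x) $ i $ j
    | _ \<Rightarrow> 0)"

definition of_real_mat :: "real^'n^'k \<Rightarrow> ('f::real_algebra_1)^'n^'k" where
  "of_real_mat T = (\<chi> i j. of_real (T $ i $ j))"

text \<open>The fiber of the extended tangent bundle (\<open>'f = real\<close>) or of its complexification
  (\<open>'f = complex\<close>).\<close>

definition gtangent :: "('a, 'm::finite) chart set \<Rightarrow> 'a \<Rightarrow> (('a, 'm) chart \<Rightarrow> ('f::real_normed_field)^('m + 'm)) set" where
  "gtangent A x = {X.
     (\<forall>c\<in>charts_at A x. \<forall>d\<in>charts_at A x. X d = of_real_mat (gtrans c d x) *v X c) \<and>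
     (\<forall>c. c \<notin> charts_at A x \<longrightarrow> X c = 0)}"

text \<open>Endomorphisms of the extended tangent space at \<open>x\<close>: the family \<open>S\<close> acts by
  \<open>(S X) c = S c *v X c\<close>.\<close>

type_synonym ('a, 'm) gend = "('a, 'm) chart \<Rightarrow> real^('m + 'm)^('m + 'm)"

definition gEnd :: "('a, 'm::finite) chart set \<Rightarrow> 'a \<Rightarrow> ('a, 'm) gend set" where
  "gEnd A x = {S.
     (\<forall>c\<in>charts_at A x. \<forall>d\<in>charts_at A x. S d = gtrans c d x ** S c ** gtrans d c x) \<and>
     (\<forall>c. c \<notin> charts_at A x \<longrightarrow> S c = 0)}"

definition bilinear_forms :: "('a, 'm::finite) chart set \<Rightarrow> 'a \<Rightarrow> (('a, 'm) chart \<Rightarrow> real^'m^'m) set" where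
  "bilinear_forms A x = {h.
     (\<forall>c\<in>charts_at A x. \<forall>d\<in>charts_at A x.
        h c = transpose (jacobian c d x) ** h d ** jacobian c d x) \<and>
     (\<forall>c. c \<notin> charts_at A x \<longrightarrow> h c = 0)}"

definition smooth_section ::
  "('a, 'm::finite) chart set \<Rightarrow> ('a \<Rightarrow> (('a, 'm) chart \<Rightarrow> 'v::real_normed_vector) set) \<Rightarrow>
   ('a \<Rightarrow> ('a, 'm) chart \<Rightarrow> 'v) \<Rightarrow> bool" where
  "smooth_section A E X \<longleftrightarrow> (\<forall>x. X x \<in> E x) \<and>
     (\<forall>c\<in>A. smooth_on (cmap c ` cdom c) (\<lambda>y. X (cinv c y) c))"

section \<open>Signature and pseudo Riemannian metrics\<close>

definition has_signature :: "('v::euclidean_space \<Rightarrow> 'v \<Rightarrow> real) \<Rightarrow> nat \<Rightarrow> nat \<Rightarrow> bool" where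
  "has_signature B p q \<longleftrightarrow> bilinear B \<and> (\<forall>u v. B u v = B v u) \<and> p + q = DIM('v) \<and>
     (\<exists>P N. subspace P \<and> subspace N \<and> dim P = p \<and> dim N = q \<and>
        (\<forall>u\<in>P. u \<noteq> 0 \<longrightarrow> B u u > 0) \<and> (\<forall>u\<in>N. u \<noteq> 0 \<longrightarrow> B u u < 0) \<and>
        (\<forall>u\<in>P. \<forall>v\<in>N. B u v = 0))"

definition pseudo_riemannian ::
  "('a, 'm::finite) chart set \<Rightarrow> ('a \<Rightarrow> ('a, 'm) chart \<Rightarrow> real^'m^'m) \<Rightarrow> nat \<Rightarrow> nat \<Rightarrow> bool" where
  "pseudo_riemannian A g p q \<longleftrightarrow> smooth_section A (bilinear_forms A) g \<and>
     (\<forall>x. \<forall>c\<in>charts_at A x. has_signature (\<lambda>u v. u \<bullet> (g x c *v v)) p q)"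

section \<open>The Courant bracket\<close>

text \<open>Local formulas on an open subset of \<open>real^'m\<close>; the coefficient field \<open>'f\<close> is \<open>real\<close> or
  \<open>complex\<close>.\<close>

definition partial :: "'m::finite \<Rightarrow> (real^'m \<Rightarrow> 'f::real_normed_vector) \<Rightarrow> real^'m \<Rightarrow> 'f" where
  "partial i f y = frechet_derivative f (at y) (axis i 1)"

definition lie_bracket ::
  "(real^'m \<Rightarrow> 'f^'m::finite) \<Rightarrow> (real^'m \<Rightarrow> 'f^'m) \<Rightarrow> real^'m \<Rightarrow> ('f::real_normed_field)^'m" where
  "lie_bracket u v y = (\<chi> i. \<Sum>j\<in>UNIV.
      u y $ j * partial j (\<lambda>z. v z $ i) y - v y $ j * partial j (\<lambda>z. u z $ i) y)"

definition lie_deriv_form ::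
  "(real^'m \<Rightarrow> 'f^'m::finite) \<Rightarrow> (real^'m \<Rightarrow> 'f^'m) \<Rightarrow> real^'m \<Rightarrow> ('f::real_normed_field)^'m" where
  "lie_deriv_form u \<tau> y = (\<chi> i. \<Sum>j\<in>UNIV.
      u y $ j * partial j (\<lambda>z. \<tau> z $ i) y + \<tau> y $ j * partial i (\<lambda>z. u z $ j) y)"

definition ext_deriv :: "(real^'m::finite \<Rightarrow> 'f::real_normed_field) \<Rightarrow> real^'m \<Rightarrow> 'f^'m" where
  "ext_deriv f y = (\<chi> i. partial i f y)"

definition vpart :: "'f^('m::finite + 'm) \<Rightarrow> 'f^'m" where "vpart X = (\<chi> i. X $ Inl i)"
definition fpart :: "'f^('m::finite + 'm) \<Rightarrow> 'f^'m" where "fpart X = (\<chi> i. X $ Inr i)"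
definition gjoin :: "'f^'m::finite \<Rightarrow> 'f^'m \<Rightarrow> 'f^('m + 'm)" where
  "gjoin u \<sigma> = (\<chi> s. case s of Inl i \<Rightarrow> u $ i | Inr i \<Rightarrow> \<sigma> $ i)"

definition pairing :: "('f::semiring_1)^'m::finite \<Rightarrow> 'f^'m \<Rightarrow> 'f" where
  "pairing \<sigma> u = (\<Sum>i\<in>UNIV. \<sigma> $ i * u $ i)"

definition courant_local ::
  "(real^'m \<Rightarrow> 'f^('m::finite + 'm)) \<Rightarrow> (real^'m \<Rightarrow> 'f^('m + 'm)) \<Rightarrow> real^'m \<Rightarrow> ('f::real_normed_field)^('m + 'm)" where
  "courant_local X Y y =
    (let u = \<lambda>z. vpart (X z); \<sigma> = \<lambda>z. fpart (X z); v = \<lambda>z. vpart (Y z); \<tau> = \<lambda>z. fpart (Y z) in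
     gjoin (lie_bracket u v y)
       (lie_deriv_form u \<tau> y - lie_deriv_form v \<sigma> y
        - (1/2) *s ext_deriv (\<lambda>z. pairing (\<tau> z) (u z) - pairing (\<sigma> z) (v z)) y))"

definition courant ::
  "('a, 'm::finite) chart set \<Rightarrow> ('a \<Rightarrow> ('a, 'm) chart \<Rightarrow> 'f^('m + 'm)) \<Rightarrow>
   ('a \<Rightarrow> ('a, 'm) chart \<Rightarrow> 'f^('m + 'm)) \<Rightarrow> 'a \<Rightarrow> ('a, 'm) chart \<Rightarrow> ('f::real_normed_field)^('m + 'm)" where
  "courant A X Y x c =
    (if c \<in> charts_at A x
     then courant_local (\<lambda>y. X (cinv c y) c) (\<lambda>y. Y (cinv c y) c) (cmap c x) else 0)"

definition eigen_section ::
  "('a, 'm::finite) chart set \<Rightarrow> ('f::real_normed_field) \<Rightarrow> ('a \<Rightarrow> ('a, 'm) gend) \<Rightarrow>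
   ('a \<Rightarrow> ('a, 'm) chart \<Rightarrow> 'f^('m + 'm)) \<Rightarrow> bool" where
  "eigen_section A \<mu> S X \<longleftrightarrow> smooth_section A (gtangent A) X \<and>
     (\<forall>x. \<forall>c\<in>charts_at A x. of_real_mat (S x c) *v X x c = \<mu> *s X x c)"

definition eigen_involutive ::
  "('a, 'm::finite) chart set \<Rightarrow> ('f::real_normed_field) \<Rightarrow> ('a \<Rightarrow> ('a, 'm) gend) \<Rightarrow> bool" where
  "eigen_involutive A \<mu> S \<longleftrightarrow>
     (\<forall>X Y. eigen_section A \<mu> S X \<and> eigen_section A \<mu> S Y \<longrightarrow> eigen_section A \<mu> S (courant A X Y))"

section \<open>Integrable structures and the fibers of the twistor bundles\<close>

text \<open>The form \<open>b\<close> and the endomorphisms \<open>I k\<close> in components; \<open>b\<close> has the same expression in all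
  charts.\<close>

definition bform :: "real^('m::finite + 'm) \<Rightarrow> real^('m + 'm) \<Rightarrow> real" where
  "bform X Y = pairing (fpart Y) (vpart X) + pairing (fpart X) (vpart Y)"

definition Ik :: "real \<Rightarrow> real^'m^'m \<Rightarrow> real^('m::finite + 'm)^('m + 'm)" where
  "Ik k h = (\<chi> r s. case (r, s) of
      (Inl i, Inr j) \<Rightarrow> k * matrix_inv h $ i $ j
    | (Inr i, Inl j) \<Rightarrow> h $ i $ j
    | _ \<Rightarrow> 0)"

definition lin_structure :: "real \<Rightarrow> real^('m::finite + 'm)^('m + 'm) \<Rightarrow> bool" where
  "lin_structure lam T \<longleftrightarrow> T ** T = mat lam \<and> trace T = 0 \<and>
     (\<forall>u v. bform (T *v u) v = - bform u (T *v v))"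

text \<open>Generalized paracomplex (\<open>lam = 1\<close>) and generalized complex (\<open>lam = -1\<close>) structures.\<close>

definition generalized_structure :: "('a, 'm::finite) chart set \<Rightarrow> real \<Rightarrow> ('a \<Rightarrow> ('a, 'm) gend) \<Rightarrow> bool" where
  "generalized_structure A lam S \<longleftrightarrow> smooth_section A (gEnd A) S \<and>
     (\<forall>x. \<forall>c\<in>charts_at A x. lin_structure lam (S x c)) \<and>
     (lam = 1 \<longrightarrow> eigen_involutive A (1::real) S \<and> eigen_involutive A (-1::real) S) \<and>
     (lam = -1 \<longrightarrow> eigen_involutive A \<i> S \<and> eigen_involutive A (-\<i>) S)"

definition integrable_structure ::
  "('a, 'm::finite) chart set \<Rightarrow> ('a \<Rightarrow> ('a, 'm) chart \<Rightarrow> real^'m^'m) \<Rightarrow> real \<Rightarrow> real \<Rightarrow>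
   ('a \<Rightarrow> ('a, 'm) gend) \<Rightarrow> bool" where
  "integrable_structure A g lam ell S \<longleftrightarrow> generalized_structure A lam S \<and>
     (\<forall>x. \<forall>c\<in>charts_at A x.
        S x c ** Ik (- lam * ell) (g x c) = - (Ik (- lam * ell) (g x c) ** S x c))"

definition beta_form :: "real^'m^'m \<Rightarrow> real^('m + 'm)^('m + 'm) \<Rightarrow> real^('m::finite + 'm) \<Rightarrow> real^('m + 'm) \<Rightarrow> real" where
  "beta_form h T u v = bform ((T ** Ik (-1) h) *v u) v"

definition integrable_structure_sig ::
  "('a, 'm::finite) chart set \<Rightarrow> ('a \<Rightarrow> ('a, 'm) chart \<Rightarrow> real^'m^'m) \<Rightarrow> nat \<Rightarrow>
   ('a \<Rightarrow> ('a, 'm) gend) \<Rightarrow> bool" where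
  "integrable_structure_sig A g n S \<longleftrightarrow> integrable_structure A g 1 1 S \<and>
     (\<forall>x. \<forall>c\<in>charts_at A x. has_signature (beta_form (g x c) (S x c)) (2*n) (2*CARD('m) - 2*n))"

definition twistor_fiber ::
  "('a, 'm::finite) chart set \<Rightarrow> ('a \<Rightarrow> ('a, 'm) chart \<Rightarrow> real^'m^'m) \<Rightarrow> real \<Rightarrow> real \<Rightarrow> 'a \<Rightarrow>
   ('a, 'm) gend set" where
  "twistor_fiber A g lam ell x = {S\<in>gEnd A x. \<forall>c\<in>charts_at A x. lin_structure lam (S c) \<and>
     S c ** Ik (- lam * ell) (g x c) = - (Ik (- lam * ell) (g x c) ** S c)}"

definition twistor_fiber_sig ::
  "('a, 'm::finite) chart set \<Rightarrow> ('a \<Rightarrow> ('a, 'm) chart \<Rightarrow> real^'m^'m) \<Rightarrow> nat \<Rightarrow> 'a \<Rightarrow>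
   ('a, 'm) gend set" where
  "twistor_fiber_sig A g n x = {S\<in>twistor_fiber A g 1 1 x. \<forall>c\<in>charts_at A x.
     has_signature (beta_form (g x c) (S c)) (2*n) (2*CARD('m) - 2*n)}"

section \<open>Fiber bundles with a homogeneous typical fiber\<close>

text \<open>\<open>G\<close> is a closed group of matrices (or pairs of matrices) and \<open>H\<close> a closed subgroup, so that
  \<open>G/H\<close> is a manifold and \<open>G \<rightarrow> G/H\<close> a submersion.  The total space \<open>Sigma UNIV Z\<close> carries the
  smooth structure induced from the total space of the bundle of endomorphisms, whose charts are
  \<open>end_coords c\<close>.\<close>

definition end_coords :: "('a, 'm::finite) chart \<Rightarrow> 'a \<times> ('a, 'm) gend \<Rightarrow> (real^'m) \<times> (real^('m + 'm)^('m + 'm))" where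
  "end_coords c z = (cmap c (fst z), snd z c)"

text \<open>\<open>\<Psi>\<close> is the inverse of a local trivialization over \<open>U\<close>: a fiber preserving bijection
  \<open>U \<times> G/H \<rightarrow> Z|U\<close> that is smooth in both directions.  Since \<open>G \<rightarrow> G/H\<close> is a surjective submersion,
  a map out of \<open>U \<times> G/H\<close> is smooth iff its composition with \<open>U \<times> G \<rightarrow> U \<times> G/H\<close> is, and
  a map into \<open>G/H\<close> is smooth iff it lifts locally to a smooth map into \<open>G\<close>.\<close>

definition local_trivialization ::
  "('a::topological_space, 'm::finite) chart set \<Rightarrow> ('a \<Rightarrow> ('a, 'm) gend set) \<Rightarrow>
   ('g::real_normed_vector) monoid \<Rightarrow> 'g set \<Rightarrow> 'a set \<Rightarrow>
   ('a \<times> 'g set \<Rightarrow> 'a \<times> ('a, 'm) gend) \<Rightarrow> bool" where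
  "local_trivialization A Z G H U \<Psi> \<longleftrightarrow>
     bij_betw \<Psi> (U \<times> (lcosets\<^bsub>G\<^esub> H)) (Sigma U Z) \<and>
     (\<forall>x\<in>U. \<forall>F\<in>lcosets\<^bsub>G\<^esub> H. fst (\<Psi> (x, F)) = x) \<and>
     (\<forall>c\<in>A. smooth_rel (cmap c ` (U \<inter> cdom c) \<times> carrier G)
        (\<lambda>(y, a). end_coords c (\<Psi> (cinv c y, a <#\<^bsub>G\<^esub> H)))) \<and>
     (\<forall>c\<in>A. \<forall>z\<in>Sigma (U \<inter> cdom c) Z. \<exists>W a. open W \<and> end_coords c z \<in> W \<and> smooth_on W a \<and>
        (\<forall>z'\<in>Sigma (U \<inter> cdom c) Z. end_coords c z' \<in> W \<longrightarrow>
           a (end_coords c z') \<in> carrier G \<and>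
           \<Psi> (fst z', a (end_coords c z') <#\<^bsub>G\<^esub> H) = z'))"

definition fiber_bundle ::
  "('a::topological_space, 'm::finite) chart set \<Rightarrow> ('a \<Rightarrow> ('a, 'm) gend set) \<Rightarrow>
   ('g::real_normed_vector) monoid \<Rightarrow> 'g set \<Rightarrow> bool" where
  "fiber_bundle A Z G H \<longleftrightarrow>
     group G \<and> closed (carrier G) \<and> subgroup H G \<and> closed H \<and>
     (\<forall>x. Z x \<subseteq> gEnd A x) \<and>
     (\<forall>x. \<exists>U \<Psi>. open U \<and> x \<in> U \<and> local_trivialization A Z G H U \<Psi>)"

section \<open>The groups\<close>

text \<open>Coordinates of \<open>real^'m\<close> and \<open>complex^'m\<close> are numbered \<open>0, \<dots>, CARD('m) - 1\<close> by a fixed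
  enumeration of \<open>'m\<close>.\<close>

definition pos :: "'m::finite \<Rightarrow> nat" where "pos = to_nat_on UNIV"
definition idx :: "nat \<Rightarrow> 'm::finite" where "idx = from_nat_into UNIV"

text \<open>The standard form of signature \<open>(a, CARD('m) - a)\<close> and its automorphism group.\<close>

definition std_form :: "nat \<Rightarrow> real^'m::finite \<Rightarrow> real^'m \<Rightarrow> real" where
  "std_form a u v = (\<Sum>i\<in>UNIV. (if pos i < a then 1 else -1) * u $ i * v $ i)"

definition O_real :: "nat \<Rightarrow> (real^'m::finite^'m) monoid" where
  "O_real a = \<lparr>carrier = {T. invertible T \<and> (\<forall>u v. std_form a (T *v u) (T *v v) = std_form a u v)},
     mult = (**), one = mat 1\<rparr>"

definition O_complex :: "(complex^'m::finite^'m) monoid" where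
  "O_complex = \<lparr>carrier = {T. invertible T \<and> (\<forall>Z W. pairing (T *v Z) (T *v W) = pairing Z W)},
     mult = (**), one = mat 1\<rparr>"

text \<open>\<open>O(a, CARD('m) - a)\<close> as a real form of \<open>O(m, \<complex>)\<close>: \<open>T \<mapsto> D T D\<^sup>-\<^sup>1\<close>, where \<open>D\<close> is diagonal with
  entries \<open>1\<close> (\<open>a\<close> times) and \<open>\<i>\<close>, hence \<open>D\<^sup>2\<close> is the matrix of the standard form.\<close>

definition O_real_form :: "nat \<Rightarrow> (complex^'m::finite^'m) set" where
  "O_real_form a =
     (let D = (\<lambda>i. if pos i < a then 1 else \<i>) in
      (\<lambda>T. \<chi> i j. D i * of_real (T $ i $ j) / D j) ` carrier (O_real a :: (real^'m^'m) monoid))"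

text \<open>The swap \<open>r (x1, x2) = (x2, x1)\<close> for even \<open>CARD('m)\<close>.\<close>

definition swap_mat :: "real^'m::finite^'m" where
  "swap_mat = (\<chi> i j. if pos j = (pos i + CARD('m) div 2) mod CARD('m) then 1 else 0)"

text \<open>The quaternion \<open>x + j y\<close> with complex \<open>x\<close>, \<open>y\<close> is the pair \<open>(x, y)\<close>; note \<open>x j = j (cnj x)\<close>.\<close>

type_synonym quat = "complex \<times> complex"

definition qmult :: "quat \<Rightarrow> quat \<Rightarrow> quat" where
  "qmult s t = (fst s * fst t - cnj (snd s) * snd t, cnj (fst s) * snd t + snd s * fst t)"

definition qcnj :: "quat \<Rightarrow> quat" where "qcnj s = (cnj (fst s), - snd s)"

text \<open>For \<open>CARD('m) = 2 k\<close>, \<open>complex^'m\<close> is the right quaternionic vector space of dimension \<open>k\<close>: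
  \<open>(z, w)\<close> corresponds to \<open>z + j w\<close>.  The form \<open>\<Sum>i. qcnj (v i) j (v' i)\<close> is anti-Hermitian
  and equals \<open>(cnj w \<bullet> z' - cnj z \<bullet> w') + j (z \<bullet> z' + w \<bullet> w')\<close>, so its automorphisms
  preserve the standard complex symmetric form: \<open>SO_star\<close> lies in \<open>O(m, \<complex>)\<close>.\<close>

definition to_qvec :: "complex^'m::finite \<Rightarrow> nat \<Rightarrow> quat" where
  "to_qvec Z i = (Z $ idx i, Z $ idx (i + CARD('m) div 2))"

definition of_qvec :: "(nat \<Rightarrow> quat) \<Rightarrow> complex^'m::finite" where
  "of_qvec v = (\<chi> s. if pos s < CARD('m) div 2 then fst (v (pos s))
                     else snd (v (pos s - CARD('m) div 2)))"

definition qscale :: "complex^'m::finite \<Rightarrow> quat \<Rightarrow> complex^'m" where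
  "qscale Z t = of_qvec (\<lambda>i. qmult (to_qvec Z i) t)"

definition q_antiherm :: "complex^'m::finite \<Rightarrow> complex^'m \<Rightarrow> quat" where
  "q_antiherm Z W = (\<Sum>i<CARD('m) div 2. qmult (qmult (qcnj (to_qvec Z i)) (0, 1)) (to_qvec W i))"

definition SO_star :: "(complex^'m::finite^'m) set" where
  "SO_star = {T. invertible T \<and> (\<forall>Z t. T *v qscale Z t = qscale (T *v Z) t) \<and>
     (\<forall>Z W. q_antiherm (T *v Z) (T *v W) = q_antiherm Z W)}"

end

theory Submission
  imports Defs
begin

text \<open>
  Pointwise, \<open>b\<close> and \<open>I\<^sub>k\<close> turn the extended tangent space into a complex vector space with a complex
  symmetric form (\<open>k = -1\<close>), or split it into the graphs of \<open>g\<close> and \<open>-g\<close> (\<open>k = 1\<close>).  In the first case \<open>S\<close>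
  is a real or quaternionic structure compatible with the form; all of these (of a given signature) are
  conjugate under the complex orthogonal group.  In the second case \<open>S\<close> is the same as an isometry or
  anti-isometry \<open>R\<close> of \<open>g\<close>, and a pair \<open>(a, b)\<close> of isometries acts by \<open>R \<mapsto> a R b\<^sup>-\<^sup>1\<close>.  Smooth local
  orthonormal frames of \<open>g\<close> trivialize the bundle.  These frames, as well as smooth local sections of
  \<open>G \<rightarrow> G/H\<close>, come from the inverse square root of a matrix near the identity, which is smooth and inherits
  all symmetries of the matrix.
\<close>

section \<open>Calculus of smooth maps\<close>

text \<open>G/H is never given charts: a trivialization has to be smooth after composition with G ->
  G/H, and its inverse has to lift locally to G. So three things are asked of the model fiber over
  \<open>eta p\<close>: a map \<open>phi\<close>, smooth on all matrices, that sends G into the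
  fiber; the agreement of its level sets on G with the cosets of H; smooth local lifts. Transitivity
  is algebra with adapted bases; analysis enters only near a point already reached.

  The inverse square root inherits symmetries because it is unique, and uniqueness is injectivity of
  the Sylvester operator D \<mapsto> P D + D Q near P = Q = 1. The same injectivity yields the
  higher derivatives of the root.

  For k = -1 a common treatment of both signs of \<lambda> requires c(Su, Sv) = cnj (c(u, v)) for
  the complex form c. With Re c = b this is skewness of S if \<lambda> = -1; if \<lambda> = 1 it
  holds only after c is changed by a factor i. With that change \<open>std_pred\<close> covers real
  and quaternionic structures at once.\<close>

lemma Ck_on_cong:
  assumes "open S" "\<And>x. x \<in> S \<Longrightarrow> f x = g x" "Ck_on k S f"
  shows "Ck_on k S g"
  using assms(2,3)
proof (induction k arbitrary: f g)
  case 0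
  then show ?case by (simp cong: continuous_on_cong)
next
  case (Suc k)
  have "g differentiable (at x)" "frechet_derivative f (at x) = frechet_derivative g (at x)"
    if "x \<in> S" for x
  proof -
    have f: "f differentiable (at x)" using Suc.prems that by simp
    show "g differentiable (at x)"
      using f has_derivative_transform_within_open[OF _ assms(1) that, of f] Suc.prems(1)
      unfolding differentiable_def by metis
    show "frechet_derivative f (at x) = frechet_derivative g (at x)"
      using frechet_derivative_transform_within_open[OF f assms(1) that] Suc.prems(1) by metis
  qed
  then show ?case
    using Suc.prems(2) Suc.IH[of "\<lambda>x. frechet_derivative f (at x) _" "\<lambda>x. frechet_derivative g (at x) _"]
    by auto
qed

lemma Ck_on_SucI:
  assumes "open S" "\<And>x. x \<in> S \<Longrightarrow> (f has_derivative f' x) (at x)"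
    and "\<And>v. Ck_on k S (\<lambda>x. f' x v)"
  shows "Ck_on (Suc k) S f"
proof -
  have "frechet_derivative f (at x) = f' x" if "x \<in> S" for x
    using assms(2)[OF that] frechet_derivative_at by metis
  then show ?thesis
    using assms(2) Ck_on_cong[OF assms(1) _ assms(3)] by (auto simp: differentiable_def)
qed

lemma Ck_on_has_derivative:
  "Ck_on (Suc k) S f \<Longrightarrow> x \<in> S \<Longrightarrow> (f has_derivative frechet_derivative f (at x)) (at x)"
  by (simp add: frechet_derivative_works[symmetric])

lemma Ck_on_SucD: "Ck_on (Suc k) S f \<Longrightarrow> Ck_on k S f"
proof (induction k arbitrary: f)
  case 0
  then show ?case
    by (auto intro!: continuous_at_imp_continuous_on differentiable_imp_continuous_within)
next
  case (Suc k)
  then show ?case by simp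
qed

lemma Ck_on_subset: "Ck_on k S f \<Longrightarrow> T \<subseteq> S \<Longrightarrow> Ck_on k T f"
  by (induction k arbitrary: f) (auto intro: continuous_on_subset)

lemma Ck_on_bounded_linear_comp:
  assumes "bounded_linear L" "open S" "Ck_on k S f"
  shows "Ck_on k S (\<lambda>x. L (f x))"
  using assms(3)
proof (induction k arbitrary: f)
  case 0
  then show ?case using assms(1) by (simp add: bounded_linear.continuous_on)
next
  case (Suc k)
  show ?case
    by (rule Ck_on_SucI[OF assms(2) bounded_linear.has_derivative[OF assms(1) Ck_on_has_derivative[OF Suc.prems]]])
      (use Suc in auto)
qed

lemma Ck_on_const: "open S \<Longrightarrow> Ck_on k S (\<lambda>x. c)"
proof (induction k arbitrary: c)
  case (Suc k)
  show ?case by (rule Ck_on_SucI[OF Suc.prems has_derivative_const]) (use Suc in auto)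
qed simp

lemma Ck_on_bounded_linear:
  assumes "bounded_linear L" "open S"
  shows "Ck_on k S L"
proof (cases k)
  case 0
  then show ?thesis using assms(1) by (simp add: linear_continuous_on)
next
  case (Suc l)
  show ?thesis unfolding Suc
    by (rule Ck_on_SucI[OF assms(2) bounded_linear_imp_has_derivative[OF assms(1)]])
      (rule Ck_on_const[OF assms(2)])
qed

lemma Ck_on_add:
  assumes "open S" "Ck_on k S f" "Ck_on k S g"
  shows "Ck_on k S (\<lambda>x. f x + g x)"
  using assms(2,3)
proof (induction k arbitrary: f g)
  case 0
  then show ?case by (simp add: continuous_on_add)
next
  case (Suc k)
  show ?case
    by (rule Ck_on_SucI[OF assms(1) has_derivative_add[OF Ck_on_has_derivative[OF Suc.prems(1)]
      Ck_on_has_derivative[OF Suc.prems(2)]]]) (use Suc in auto)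
qed

lemma Ck_on_sum:
  assumes "open S" "\<And>i. i \<in> I \<Longrightarrow> Ck_on k S (f i)"
  shows "Ck_on k S (\<lambda>x. \<Sum>i\<in>I. f i x)"
  using assms(2)
proof (induction I rule: infinite_finite_induct)
  case (insert i I)
  then show ?case using Ck_on_add[OF assms(1), of k "f i" "\<lambda>x. \<Sum>i\<in>I. f i x"] by simp
qed (auto intro: Ck_on_const[OF assms(1)])

lemma Ck_on_bilinear:
  assumes "bounded_bilinear bop" "open S" "Ck_on k S f" "Ck_on k S g"
  shows "Ck_on k S (\<lambda>x. bop (f x) (g x))"
  using assms(3,4)
proof (induction k arbitrary: f g)
  case 0
  then show ?case using bounded_bilinear.continuous_on[OF assms(1)] by simp
next
  case (Suc k)
  note f = Suc.prems(1) and g = Suc.prems(2)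
  show ?case
  proof (rule Ck_on_SucI[OF assms(2) bounded_bilinear.FDERIV[OF assms(1) Ck_on_has_derivative[OF f]
      Ck_on_has_derivative[OF g]]])
    fix v
    show "Ck_on k S (\<lambda>x. bop (f x) (frechet_derivative g (at x) v) + bop (frechet_derivative f (at x) v) (g x))"
      using f g Suc.IH[OF Ck_on_SucD[OF f]] Suc.IH[OF _ Ck_on_SucD[OF g]] by (simp add: Ck_on_add[OF assms(2)])
  qed
qed

lemma Ck_on_Pair:
  assumes "open S" "Ck_on k S f" "Ck_on k S g"
  shows "Ck_on k S (\<lambda>x. (f x, g x))"
  using assms(2,3)
proof (induction k arbitrary: f g)
  case 0
  then show ?case by (simp add: continuous_on_Pair)
next
  case (Suc k)
  show ?case
    by (rule Ck_on_SucI[OF assms(1) has_derivative_Pair[OF Ck_on_has_derivative[OF Suc.prems(1)]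
      Ck_on_has_derivative[OF Suc.prems(2)]]]) (use Suc in auto)
qed

text \<open>Expansion of \<open>g x\<close> in \<open>Basis\<close> turns the evaluation into
  finitely many products of a scalar map with a known map, so regularity of \<open>A\<close> is only
  asked vector by vector. The chain rule applies this with \<open>A x\<close> the derivative of the
  outer map at the moving point.\<close>

lemma Ck_on_linear_family:
  fixes A :: "'u::real_normed_vector \<Rightarrow> 'v::euclidean_space \<Rightarrow> 'w::real_normed_vector"
  assumes "open S" "\<And>x. x \<in> S \<Longrightarrow> linear (A x)" "\<And>v. Ck_on k S (\<lambda>x. A x v)" "Ck_on k S g"
  shows "Ck_on k S (\<lambda>x. A x (g x))"
proof (rule Ck_on_cong[OF assms(1)])
  show "Ck_on k S (\<lambda>x. \<Sum>b\<in>Basis. (g x \<bullet> b) *\<^sub>R A x b)"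
    by (intro Ck_on_sum Ck_on_bilinear[OF bounded_bilinear_scaleR] assms
        Ck_on_bounded_linear_comp[OF bounded_linear_inner_left])
  fix x assume "x \<in> S"
  then have lin: "linear (A x)" by (rule assms(2))
  have "(\<Sum>b\<in>Basis. (g x \<bullet> b) *\<^sub>R A x b) = A x (\<Sum>b\<in>Basis. (g x \<bullet> b) *\<^sub>R b)"
    by (simp only: linear_sum[OF lin] linear_scale[OF lin])
  then show "(\<Sum>b\<in>Basis. (g x \<bullet> b) *\<^sub>R A x b) = A x (g x)"
    by (simp only: euclidean_representation)
qed

lemma Ck_on_compose:
  fixes f :: "'v::euclidean_space \<Rightarrow> 'w::real_normed_vector"
  assumes "open S" "open T" "Ck_on k T f" "Ck_on k S g" "g ` S \<subseteq> T"
  shows "Ck_on k S (\<lambda>x. f (g x))"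
  using assms(3,4)
proof (induction k arbitrary: f)
  case 0
  then show ?case using continuous_on_compose2[of T f S g] assms(5) by simp
next
  case (Suc k)
  have f: "(f has_derivative frechet_derivative f (at (g x))) (at (g x))" if "x \<in> S" for x
    by (rule Ck_on_has_derivative[OF Suc.prems(1)]) (use that assms(5) in blast)
  show ?case
  proof (rule Ck_on_SucI[OF assms(1)])
    fix x assume "x \<in> S"
    show "((\<lambda>x. f (g x)) has_derivative (\<lambda>v. frechet_derivative f (at (g x)) (frechet_derivative g (at x) v))) (at x)"
      by (rule has_derivative_compose[where f=g and g=f,
            OF Ck_on_has_derivative[OF Suc.prems(2) \<open>x \<in> S\<close>] f[OF \<open>x \<in> S\<close>]])
  next
    fix v
    have "Ck_on k S (\<lambda>x. frechet_derivative f (at (g x)) w)" for w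
      by (rule Suc.IH[of "\<lambda>y. frechet_derivative f (at y) w", OF _ Ck_on_SucD[OF Suc.prems(2)]])
        (use Suc.prems(1) in simp)
    moreover have "Ck_on k S (\<lambda>x. frechet_derivative g (at x) v)"
      using Suc.prems(2) by simp
    ultimately show "Ck_on k S (\<lambda>x. frechet_derivative f (at (g x)) (frechet_derivative g (at x) v))"
      using Ck_on_linear_family[OF assms(1), of "\<lambda>x. frechet_derivative f (at (g x))" k "\<lambda>x. frechet_derivative g (at x) v"]
        has_derivative_linear[OF f] by blast
  qed
qed

lemma smooth_on_cong: "open S \<Longrightarrow> (\<And>x. x \<in> S \<Longrightarrow> f x = g x) \<Longrightarrow> smooth_on S f \<Longrightarrow> smooth_on S g"
  unfolding smooth_on_def using Ck_on_cong[of S f g] by simp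

lemma smooth_on_subset: "smooth_on S f \<Longrightarrow> T \<subseteq> S \<Longrightarrow> smooth_on T f"
  unfolding smooth_on_def by (auto intro: Ck_on_subset)

lemma smooth_on_const: "open S \<Longrightarrow> smooth_on S (\<lambda>x. c)"
  unfolding smooth_on_def by (simp add: Ck_on_const)

lemma smooth_on_bounded_linear: "bounded_linear L \<Longrightarrow> open S \<Longrightarrow> smooth_on S L"
  unfolding smooth_on_def by (simp add: Ck_on_bounded_linear)

lemma smooth_on_bounded_linear_comp:
  "bounded_linear L \<Longrightarrow> open S \<Longrightarrow> smooth_on S f \<Longrightarrow> smooth_on S (\<lambda>x. L (f x))"
  unfolding smooth_on_def by (simp add: Ck_on_bounded_linear_comp)

lemma smooth_on_add: "open S \<Longrightarrow> smooth_on S f \<Longrightarrow> smooth_on S g \<Longrightarrow> smooth_on S (\<lambda>x. f x + g x)"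
  unfolding smooth_on_def by (simp add: Ck_on_add)

lemma smooth_on_sum:
  "open S \<Longrightarrow> (\<And>i. i \<in> I \<Longrightarrow> smooth_on S (f i)) \<Longrightarrow> smooth_on S (\<lambda>x. \<Sum>i\<in>I. f i x)"
  unfolding smooth_on_def by (simp add: Ck_on_sum)

lemma smooth_on_scaleR_const: "open S \<Longrightarrow> smooth_on S f \<Longrightarrow> smooth_on S (\<lambda>x. c *\<^sub>R f x)"
  by (rule smooth_on_bounded_linear_comp[OF bounded_linear_scaleR_right])

lemma smooth_on_minus: "open S \<Longrightarrow> smooth_on S f \<Longrightarrow> smooth_on S (\<lambda>x. - f x)"
  using smooth_on_scaleR_const[of S f "-1"] by simp

lemma smooth_on_diff:
  "open S \<Longrightarrow> smooth_on S f \<Longrightarrow> smooth_on S g \<Longrightarrow> smooth_on S (\<lambda>x. f x - g x)"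
  using smooth_on_add[of S f "\<lambda>x. - g x"] smooth_on_minus[of S g] by simp

lemma smooth_on_bilinear:
  "bounded_bilinear bop \<Longrightarrow> open S \<Longrightarrow> smooth_on S f \<Longrightarrow> smooth_on S g \<Longrightarrow>
    smooth_on S (\<lambda>x. bop (f x) (g x))"
  unfolding smooth_on_def by (simp add: Ck_on_bilinear[where bop=bop])

lemma smooth_on_Pair:
  "open S \<Longrightarrow> smooth_on S f \<Longrightarrow> smooth_on S g \<Longrightarrow> smooth_on S (\<lambda>x. (f x, g x))"
  unfolding smooth_on_def by (simp add: Ck_on_Pair)

lemma smooth_on_compose:
  fixes f :: "'v::euclidean_space \<Rightarrow> 'w::real_normed_vector"
  shows "open S \<Longrightarrow> open T \<Longrightarrow> smooth_on T f \<Longrightarrow> smooth_on S g \<Longrightarrow> g ` S \<subseteq> T \<Longrightarrow>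
    smooth_on S (\<lambda>x. f (g x))"
  unfolding smooth_on_def by (simp add: Ck_on_compose[where T=T and f=f and g=g])

lemma smooth_on_frechet_derivative: "smooth_on S f \<Longrightarrow> smooth_on S (\<lambda>x. frechet_derivative f (at x) v)"
  unfolding smooth_on_def by (metis Ck_on.simps(2))

lemma smooth_on_has_derivative:
  "smooth_on S f \<Longrightarrow> x \<in> S \<Longrightarrow> (f has_derivative frechet_derivative f (at x)) (at x)"
  unfolding smooth_on_def using Ck_on_has_derivative[of 0 S f x] by (metis Ck_on_has_derivative)

lemma smooth_on_continuous_on: "smooth_on S f \<Longrightarrow> continuous_on S f"
  unfolding smooth_on_def by (metis Ck_on.simps(1))

text \<open>The sum over \<open>Basis\<close> plays the role of an operator norm of
  \<open>A y - A z\<close>: continuity on the finitely many basis vectors makes it tend to 0. Once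
  it is below half of the lower bound of the injective map \<open>A z\<close>, the other half
  remains as a lower bound for \<open>A y\<close>.\<close>

lemma linear_family_bounded_below:
  fixes A :: "'u::real_normed_vector \<Rightarrow> 'v::euclidean_space \<Rightarrow> 'v"
  assumes "open S" "\<And>y. y \<in> S \<Longrightarrow> linear (A y)" "\<And>v. continuous_on S (\<lambda>y. A y v)"
    and "z \<in> S" "inj (A z)"
  obtains c where "c > 0" "eventually (\<lambda>y. \<forall>v. c * norm v \<le> norm (A y v)) (at z)"
    "((\<lambda>y. \<Sum>i\<in>Basis. norm (A y i - A z i)) \<longlongrightarrow> 0) (at z)"
    "\<And>y v. y \<in> S \<Longrightarrow> norm (A y v - A z v) \<le> norm v * (\<Sum>i\<in>Basis. norm (A y i - A z i))"
proof -
  obtain B where B: "B > 0" "\<And>v. B * norm v \<le> norm (A z v)"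
    using linear_inj_bounded_below_pos[OF assms(2)[OF assms(4)] assms(5)] by blast
  have diff: "norm (A y v - A z v) \<le> norm v * (\<Sum>i\<in>Basis. norm (A y i - A z i))" if "y \<in> S" for y v
  proof -
    have lin: "linear (\<lambda>v. A y v - A z v)"
      by (intro linear_compose_sub assms(2) that assms(4))
    have "A y v - A z v = (\<Sum>i\<in>Basis. (v \<bullet> i) *\<^sub>R (A y i - A z i))"
      using linear_sum[OF lin, of "\<lambda>i. (v \<bullet> i) *\<^sub>R i" Basis] linear_scale[OF lin]
      by (simp add: euclidean_representation)
    also have "norm \<dots> \<le> (\<Sum>i\<in>Basis. norm v * norm (A y i - A z i))"
      by (intro sum_norm_le) (simp add: mult_right_mono Basis_le_norm)
    finally show ?thesis by (simp add: sum_distrib_left)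
  qed
  have cont: "((\<lambda>y. A y i) \<longlongrightarrow> A z i) (at z)" for i
    using assms(3)[of i] assms(4) by (simp add: continuous_on_eq_continuous_at[OF assms(1)] isCont_def)
  have lim: "((\<lambda>y. \<Sum>i\<in>Basis. norm (A y i - A z i)) \<longlongrightarrow> 0) (at z)"
    by (rule tendsto_null_sum, rule tendsto_norm_zero) (simp add: LIM_zero[OF cont])
  have ev: "eventually (\<lambda>y. \<forall>v. (B / 2) * norm v \<le> norm (A y v)) (at z)"
  proof (rule eventually_elim2[OF order_tendstoD(2)[OF lim, of "B / 2"]
        eventually_at_in_open'[OF assms(1,4)]])
    fix y assume y: "(\<Sum>i\<in>Basis. norm (A y i - A z i)) < B / 2" "y \<in> S"
    show "\<forall>v. (B / 2) * norm v \<le> norm (A y v)"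
    proof
      fix v
      have "norm (A y v - A z v) \<le> norm v * (B / 2)"
        using diff[OF y(2), of v] mult_left_mono[OF less_imp_le[OF y(1)], of "norm v"] by simp
      moreover have "norm (A z v) \<le> norm (A y v) + norm (A y v - A z v)"
        using norm_triangle_sub[of "A z v" "A y v"] by (simp add: norm_minus_commute)
      ultimately show "(B / 2) * norm v \<le> norm (A y v)"
        using B(2)[of v] by (simp add: field_simps)
    qed
  qed (use B in simp)
  show ?thesis by (rule that[OF _ ev lim diff]) (use B in auto)
qed

text \<open>With the unknown frozen at \<open>X z\<close>, the equation reads
  \<open>A y (X y - X z) = b y - A y (X z)\<close>. The right side vanishes at \<open>z\<close> and
  has derivative \<open>L\<close> there, so the lower bound of \<open>A y\<close> forces
  \<open>X y - X z\<close> to agree to first order with the solution \<open>d\<close> of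
  \<open>A z d = L (y - z)\<close>.\<close>

lemma has_derivative_linear_solve:
  fixes A :: "'u::real_normed_vector \<Rightarrow> 'v::euclidean_space \<Rightarrow> 'v"
  assumes "open S" "z \<in> S" "\<And>y. y \<in> S \<Longrightarrow> linear (A y)" "\<And>v. continuous_on S (\<lambda>y. A y v)"
    and inj: "inj (A z)" and eq: "\<And>y. y \<in> S \<Longrightarrow> A y (X y) = b y"
    and h: "((\<lambda>y. b y - A y (X z)) has_derivative L) (at z)"
  shows "(X has_derivative inv_into UNIV (A z) \<circ> L) (at z)"
proof -
  obtain c where c: "c > 0" and low: "eventually (\<lambda>y. \<forall>v. c * norm v \<le> norm (A y v)) (at z)"
    and lim: "((\<lambda>y. \<Sum>i\<in>Basis. norm (A y i - A z i)) \<longlongrightarrow> 0) (at z)"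
    and diff: "\<And>y v. y \<in> S \<Longrightarrow> norm (A y v - A z v) \<le> norm v * (\<Sum>i\<in>Basis. norm (A y i - A z i))"
    using linear_family_bounded_below[OF assms(1,3,4,2) inj] by blast
  have bij: "bij (A z)"
    using inj linear_injective_imp_surjective[OF assms(3)[OF assms(2)] inj] by (simp add: bij_def)
  then have inv: "A z (inv_into UNIV (A z) w) = w" for w by (simp add: bij_is_surj surj_f_inv_f)
  have "linear (inv_into UNIV (A z))"
  proof (rule linearI)
    show "inv_into UNIV (A z) (x + y) = inv_into UNIV (A z) x + inv_into UNIV (A z) y" for x y
      by (rule injD[OF inj]) (simp add: inv linear_add[OF assms(3)[OF assms(2)]])
    show "inv_into UNIV (A z) (r *\<^sub>R x) = r *\<^sub>R inv_into UNIV (A z) x" for r x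
      by (rule injD[OF inj]) (simp add: inv linear_scale[OF assms(3)[OF assms(2)]])
  qed
  then have bl: "bounded_linear (inv_into UNIV (A z) \<circ> L)"
    using bounded_linear_compose[of "inv_into UNIV (A z)" L] has_derivative_bounded_linear[OF h]
    by (simp add: linear_conv_bounded_linear o_def)
  obtain K where K: "K > 0" "\<And>v. norm ((inv_into UNIV (A z) \<circ> L) v) \<le> norm v * K"
    using bounded_linear.pos_bounded[OF bl] by blast
  have rem: "((\<lambda>y. norm (b y - A y (X z) - (b z - A z (X z)) - L (y - z)) / norm (y - z)) \<longlongrightarrow> 0) (at z)"
    using h unfolding has_derivative_iff_norm by simp
  have lim2: "((\<lambda>y. (norm (b y - A y (X z) - (b z - A z (X z)) - L (y - z)) / norm (y - z)
      + K * (\<Sum>i\<in>Basis. norm (A y i - A z i))) / c) \<longlongrightarrow> 0) (at z)"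
    using tendsto_divide[OF tendsto_add[OF rem tendsto_mult_left[OF lim, of K]] tendsto_const[of c]] c
    by simp
  have "((\<lambda>y. norm (X y - X z - (inv_into UNIV (A z) \<circ> L) (y - z)) / norm (y - z)) \<longlongrightarrow> 0) (at z)"
  proof (rule tendsto_sandwich[OF _ _ tendsto_const lim2])
    show "eventually (\<lambda>y. norm (X y - X z - (inv_into UNIV (A z) \<circ> L) (y - z)) / norm (y - z)
        \<le> (norm (b y - A y (X z) - (b z - A z (X z)) - L (y - z)) / norm (y - z)
        + K * (\<Sum>i\<in>Basis. norm (A y i - A z i))) / c) (at z)"
    proof (rule eventually_elim2[OF low eventually_at_in_open[OF assms(1,2)]])
      fix y assume low: "\<forall>v. c * norm v \<le> norm (A y v)" and "y \<in> S - {z}"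
      then have y: "y \<in> S" "y \<noteq> z" by auto
      define d where "d = (inv_into UNIV (A z) \<circ> L) (y - z)"
      define e where "e = (\<Sum>i\<in>Basis. norm (A y i - A z i))"
      have e: "e \<ge> 0" unfolding e_def by (simp add: sum_nonneg)
      have Ad: "A z d = L (y - z)" by (simp add: d_def inv)
      have "c * norm (X y - X z - d) \<le> norm (A y (X y - X z - d))" using low by blast
      also have "A y (X y - X z - d) = (b y - A y (X z) - (b z - A z (X z)) - L (y - z)) - (A y d - A z d)"
        using eq[OF y(1)] eq[OF assms(2)] Ad by (simp add: linear_diff[OF assms(3)[OF y(1)]])
      also have "norm \<dots> \<le> norm (b y - A y (X z) - (b z - A z (X z)) - L (y - z)) + norm (A y d - A z d)"
        by (rule norm_triangle_ineq4)
      also have "norm (A y d - A z d) \<le> norm d * e" using diff[OF y(1)] by (simp add: e_def)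
      also have "norm d * e \<le> norm (y - z) * K * e"
        using K(2)[of "y - z"] e by (simp add: d_def mult_right_mono)
      finally show "norm (X y - X z - (inv_into UNIV (A z) \<circ> L) (y - z)) / norm (y - z)
        \<le> (norm (b y - A y (X z) - (b z - A z (X z)) - L (y - z)) / norm (y - z)
        + K * (\<Sum>i\<in>Basis. norm (A y i - A z i))) / c"
        using c y(2) unfolding d_def[symmetric] e_def[symmetric] by (simp add: field_simps)
    qed
  qed simp
  then show ?thesis using bl by (simp add: has_derivative_iff_norm)
qed

lemma continuous_on_linear_solve:
  fixes A :: "'u::real_normed_vector \<Rightarrow> 'v::euclidean_space \<Rightarrow> 'v"
  assumes "open S" "\<And>y. y \<in> S \<Longrightarrow> linear (A y)" "\<And>v. continuous_on S (\<lambda>y. A y v)"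
    and inj: "\<And>y. y \<in> S \<Longrightarrow> inj (A y)" and eq: "\<And>y. y \<in> S \<Longrightarrow> A y (X y) = b y"
    and b: "continuous_on S b"
  shows "continuous_on S X"
proof (rule continuous_at_imp_continuous_on, rule ballI)
  fix z assume z: "z \<in> S"
  obtain c where c: "c > 0" and low: "eventually (\<lambda>y. \<forall>v. c * norm v \<le> norm (A y v)) (at z)"
    by (rule linear_family_bounded_below[OF assms(1-3) z inj[OF z]]) (simp_all only:)
  have "isCont (\<lambda>y. b y - A y (X z)) z"
    using continuous_on_diff[OF b assms(3)[of "X z"]] z by (simp add: continuous_on_eq_continuous_at[OF assms(1)])
  then have "((\<lambda>y. b y - A y (X z)) \<longlongrightarrow> 0) (at z)"
    using eq[OF z] unfolding isCont_def by simp
  then have lim: "((\<lambda>y. norm (b y - A y (X z)) / c) \<longlongrightarrow> 0) (at z)"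
    using tendsto_divide[OF tendsto_norm_zero tendsto_const[of c], of "\<lambda>y. b y - A y (X z)" "at z"] c by simp
  have "((\<lambda>y. X y - X z) \<longlongrightarrow> 0) (at z)"
  proof (rule Lim_null_comparison[OF _ lim])
    show "eventually (\<lambda>y. norm (X y - X z) \<le> norm (b y - A y (X z)) / c) (at z)"
    proof (rule eventually_elim2[OF low eventually_at_in_open'[OF assms(1) z]])
      fix y assume "\<forall>v. c * norm v \<le> norm (A y v)" and y: "y \<in> S"
      then have "c * norm (X y - X z) \<le> norm (A y (X y - X z))" by blast
      then show "norm (X y - X z) \<le> norm (b y - A y (X z)) / c"
        using c eq[OF y] by (simp add: linear_diff[OF assms(2)[OF y]] field_simps)
    qed
  qed
  then show "isCont X z" by (simp add: isCont_def LIM_zero_iff)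
qed

text \<open>Differentiating the equation shows that the derivative of \<open>X\<close> solves a
  system with the same operator and the right side \<open>b'\<close>, the derivative of
  \<open>b\<close> minus that of \<open>A\<close> applied to \<open>X\<close>. This right side
  contains \<open>X\<close> itself, so the induction hypothesis is used twice: first for
  \<open>X\<close>, then for its derivative.\<close>

lemma Ck_on_linear_solve:
  fixes A :: "'u::real_normed_vector \<Rightarrow> 'v::euclidean_space \<Rightarrow> 'v"
  assumes "open S" "\<And>y. y \<in> S \<Longrightarrow> linear (A y)" and inj: "\<And>y. y \<in> S \<Longrightarrow> inj (A y)"
    and "\<And>v. Ck_on k S (\<lambda>y. A y v)" "\<And>y. y \<in> S \<Longrightarrow> A y (X y) = b y" "Ck_on k S b"
  shows "Ck_on k S X"
  using assms(4-6)
proof (induction k arbitrary: b X)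
  case 0
  have "continuous_on S X"
    by (rule continuous_on_linear_solve[where A=A and b=b, OF assms(1,2) _ inj]) (use 0 in simp_all)
  then show ?case by simp
next
  case (Suc k)
  note A = Suc.prems(1)
  have A0: "Ck_on k S (\<lambda>y. A y v)" for v by (rule Ck_on_SucD[OF A])
  have contA: "continuous_on S (\<lambda>y. A y v)" for v
    using A[of v] by (auto intro!: continuous_at_imp_continuous_on differentiable_imp_continuous_within)
  define A' where "A' y v i = frechet_derivative (\<lambda>y. A y i) (at y) v" for y v i
  define b' where "b' y v = frechet_derivative b (at y) v - (\<Sum>i\<in>Basis. (X y \<bullet> i) *\<^sub>R A' y v i)" for y v
  have X: "Ck_on k S X" using Suc.IH[OF A0 Suc.prems(2) Ck_on_SucD[OF Suc.prems(3)]] by simp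
  have b': "Ck_on k S (\<lambda>y. b' y v)" for v
  proof -
    have A': "Ck_on k S (\<lambda>y. A' y v i)" for i
      using A[of i] by (simp add: A'_def)
    have "Ck_on k S (\<lambda>y. (- 1) *\<^sub>R (\<Sum>i\<in>Basis. (X y \<bullet> i) *\<^sub>R A' y v i))"
      by (intro Ck_on_bounded_linear_comp[OF bounded_linear_scaleR_right assms(1)] Ck_on_sum[OF assms(1)]
          Ck_on_bilinear[OF bounded_bilinear_scaleR assms(1)] A' Ck_on_bounded_linear_comp[OF bounded_linear_inner_left assms(1) X])
    then have "Ck_on k S (\<lambda>y. frechet_derivative b (at y) v + (- 1) *\<^sub>R (\<Sum>i\<in>Basis. (X y \<bullet> i) *\<^sub>R A' y v i))"
      using Suc.prems(3) by (intro Ck_on_add[OF assms(1)]) simp_all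
    then show ?thesis by (simp add: b'_def)
  qed
  have der: "(X has_derivative inv_into UNIV (A z) \<circ> b' z) (at z)" if z: "z \<in> S" for z
  proof (rule has_derivative_linear_solve[OF assms(1) z assms(2) contA inj[OF z] Suc.prems(2)])
    have "((\<lambda>y. b y - (\<Sum>i\<in>Basis. (X z \<bullet> i) *\<^sub>R A y i)) has_derivative b' z) (at z)"
      unfolding b'_def[abs_def] A'_def
      by (intro has_derivative_diff has_derivative_sum has_derivative_scaleR_right
          Ck_on_has_derivative[OF Suc.prems(3) z] Ck_on_has_derivative[OF A z])
    then show "((\<lambda>y. b y - A y (X z)) has_derivative b' z) (at z)"
    proof (rule has_derivative_transform_within_open[OF _ assms(1) z])
      fix y assume "y \<in> S"
      then have lin: "linear (A y)" by (rule assms(2))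
      have "(\<Sum>i\<in>Basis. (X z \<bullet> i) *\<^sub>R A y i) = A y (\<Sum>i\<in>Basis. (X z \<bullet> i) *\<^sub>R i)"
        by (simp only: linear_sum[OF lin] linear_scale[OF lin])
      then show "b y - (\<Sum>i\<in>Basis. (X z \<bullet> i) *\<^sub>R A y i) = b y - A y (X z)"
        by (simp only: euclidean_representation)
    qed
  qed
  have "Ck_on k S (\<lambda>y. (inv_into UNIV (A y) \<circ> b' y) v)" for v
  proof (rule Suc.IH[OF A0 _ b'])
    fix y assume y: "y \<in> S"
    show "A y ((inv_into UNIV (A y) \<circ> b' y) v) = b' y v"
      using linear_injective_imp_surjective[OF assms(2)[OF y] inj[OF y]] by (simp add: surj_f_inv_f)
  qed
  then show ?case by (intro Ck_on_SucI[OF assms(1) der])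
qed

lemma smooth_on_linear_solve:
  fixes A :: "'u::real_normed_vector \<Rightarrow> 'v::euclidean_space \<Rightarrow> 'v"
  assumes "open S" "\<And>y. y \<in> S \<Longrightarrow> linear (A y)" "\<And>y. y \<in> S \<Longrightarrow> inj (A y)"
    and "\<And>v. smooth_on S (\<lambda>y. A y v)" "\<And>y. y \<in> S \<Longrightarrow> A y (X y) = b y" "smooth_on S b"
  shows "smooth_on S X"
  unfolding smooth_on_def
proof
  fix k
  show "Ck_on k S X"
    by (rule Ck_on_linear_solve[OF assms(1-3) _ assms(5)]) (use assms(4,6) in \<open>simp_all add: smooth_on_def\<close>)
qed

section \<open>Square roots of matrices near the identity\<close>

lemma bounded_bilinear_matrix_mult:
  "bounded_bilinear ((**) :: 'f::{real_normed_field, euclidean_space}^'n^'k \<Rightarrow> 'f^'l^'n \<Rightarrow> 'f^'l^'k)"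
  unfolding bilinear_conv_bounded_bilinear[symmetric] bilinear_def
  by (intro conjI allI linearI)
    (simp_all add: matrix_matrix_mult_def vec_eq_iff algebra_simps sum.distrib scaleR_sum_right)

lemma bounded_linear_transpose:
  "bounded_linear (transpose :: 'f::euclidean_space^'n^'k \<Rightarrow> 'f^'k^'n)"
  by (rule bounded_linearI') (simp_all add: transpose_def vec_eq_iff)

lemma norm_transpose: "norm (transpose A) = norm (A :: real^'n^'k)"
  unfolding norm_eq_sqrt_inner inner_vec_def transpose_def by (simp, rule sum.swap)

lemma matrix_diff_mult_left: "((A :: real^'n^'m) - B) ** C = A ** C - B ** C"
  using bounded_bilinear.diff_left[OF bounded_bilinear_matrix_mult] .

lemma matrix_diff_mult_right: "(C :: real^'n^'m) ** (A - B) = C ** A - C ** B"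
  using bounded_bilinear.diff_right[OF bounded_bilinear_matrix_mult] .

text \<open>At P = Q = 1 the operator D \<mapsto> P D + D Q is multiplication by 2. With
  \<open>K\<close> a bound for matrix multiplication, the radius \<open>1 / (4 * K)\<close> keeps
  each one-sided perturbation within half of \<open>norm D\<close>, too little to cancel the main
  term.\<close>

lemma sylvester_near_identity:
  obtains d where "d > 0"
    "\<And>P Q D :: real^'n^'n. norm (P - mat 1) < d \<Longrightarrow> norm (Q - mat 1) < d \<Longrightarrow> P ** D + D ** Q = 0 \<Longrightarrow> D = 0"
    "\<And>P D :: real^'n^'n. norm (P - mat 1) < d \<Longrightarrow> P ** D = 0 \<Longrightarrow> D = 0"
proof -
  obtain K where K: "K > 0" "\<And>(A :: real^'n^'n) (B :: real^'n^'n). norm (A ** B) \<le> norm A * norm B * K"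
    using bounded_bilinear.pos_bounded[OF bounded_bilinear_matrix_mult[where 'f=real and 'n='n and 'k='n and 'l='n]] by auto
  have small: "norm ((P - mat 1) ** D) \<le> norm D / 2" "norm (D ** (P - mat 1)) \<le> norm D / 2"
    if "norm (P - mat 1) < 1 / (2 * K)" for P D :: "real^'n^'n"
  proof -
    have "norm (P - mat 1) * K \<le> 1 / 2" using that K(1) by (simp add: field_simps)
    then have "norm (P - mat 1) * K * norm D \<le> 1 / 2 * norm D" by (rule mult_right_mono) simp
    then show "norm ((P - mat 1) ** D) \<le> norm D / 2" "norm (D ** (P - mat 1)) \<le> norm D / 2"
      using K(2)[of "P - mat 1" D] K(2)[of D "P - mat 1"] by (simp_all add: mult.commute mult.left_commute)
  qed
  show ?thesis
  proof
    show "1 / (4 * K) > 0" using K by simp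
    have le: "1 / (4 * K) < 1 / (2 * K)" using K by (simp add: field_simps)
    {
      fix P D :: "real^'n^'n"
      assume P: "norm (P - mat 1) < 1 / (4 * K)" and eq: "P ** D = 0"
      have "(P - mat 1) ** D = - D" using eq by (simp add: matrix_diff_mult_left matrix_mul_lid)
      moreover have "norm ((P - mat 1) ** D) \<le> norm D / 2" using P le by (intro small(1)) simp
      ultimately have "norm D \<le> norm D / 2" by simp
      then show "D = 0" by simp
    }
    {
      fix P Q D :: "real^'n^'n"
      assume P: "norm (P - mat 1) < 1 / (4 * K)" and Q: "norm (Q - mat 1) < 1 / (4 * K)"
        and eq: "P ** D + D ** Q = 0"
      have small': "norm ((P - mat 1) ** D) \<le> norm D / 2" "norm (D ** (Q - mat 1)) \<le> norm D / 2"
        using P Q le by (intro small; simp)+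
      have "(P - mat 1) ** D + D ** (Q - mat 1) = (P ** D + D ** Q) - 2 *\<^sub>R D"
        by (simp add: matrix_diff_mult_left matrix_diff_mult_right scaleR_2)
      then have "2 * norm D = norm ((P - mat 1) ** D + D ** (Q - mat 1))"
        by (simp add: eq)
      also have "\<dots> \<le> norm D / 2 + norm D / 2"
        using norm_triangle_mono[OF small'] .
      finally show "D = 0" by simp
    }
  qed
qed

lemma bounded_bilinear_matrix_mult_real:
  "bounded_bilinear ((**) :: real^'n^'k \<Rightarrow> real^'l^'n \<Rightarrow> real^'l^'k)"
  by (rule bounded_bilinear_matrix_mult)

lemma smooth_on_matrix_mult:
  fixes f :: "'u::real_normed_vector \<Rightarrow> 'f::{real_normed_field, euclidean_space}^'n^'k"
  shows "open S \<Longrightarrow> smooth_on S f \<Longrightarrow> smooth_on S g \<Longrightarrow> smooth_on S (\<lambda>x. f x ** g x)"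
  by (rule smooth_on_bilinear[OF bounded_bilinear_matrix_mult])

lemma smooth_on_transpose:
  fixes f :: "'u::real_normed_vector \<Rightarrow> 'f::euclidean_space^'n^'k"
  shows "open S \<Longrightarrow> smooth_on S f \<Longrightarrow> smooth_on S (\<lambda>x. transpose (f x))"
  by (rule smooth_on_bounded_linear_comp[OF bounded_linear_transpose])

lemma matrix_inv_invertible:
  assumes "invertible A"
  shows "A ** matrix_inv A = mat 1" "matrix_inv A ** A = mat 1"
  using assms unfolding invertible_def matrix_inv_def by (metis (mono_tags, lifting) someI_ex)+

lemma matrix_inv_unique:
  fixes A :: "'f::field^'n^'n"
  assumes "A ** B = mat 1"
  shows "matrix_inv A = B" "invertible A"
proof -
  show A: "invertible A" using assms by (auto simp: invertible_right_inverse)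
  have "matrix_inv A = matrix_inv A ** (A ** B)" by (simp add: assms matrix_mul_rid)
  also have "\<dots> = B" by (simp only: matrix_mul_assoc matrix_inv_invertible(2)[OF A] matrix_mul_lid)
  finally show "matrix_inv A = B" .
qed

text \<open>The inverse function theorem for squaring at the identity supplies one derivative. The
  higher ones follow because \<open>g'\<close> solves the Sylvester equation with coefficient
  \<open>g\<close>, which makes it as regular as \<open>g\<close>. The radius \<open>d\<close> and
  the two injectivity facts are handed on since they also express uniqueness of the root and its
  invertibility.\<close>

lemma matrix_sqrt_near_identity:
  obtains V and g :: "real^'n^'n \<Rightarrow> real^'n^'n" and d
  where "open V" "mat 1 \<in> V" "smooth_on V g"
    "\<And>w. w \<in> V \<Longrightarrow> g w ** g w = w" "\<And>w. w \<in> V \<Longrightarrow> norm (g w - mat 1) < d"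
    "\<And>P Q D :: real^'n^'n. norm (P - mat 1) < d \<Longrightarrow> norm (Q - mat 1) < d \<Longrightarrow> P ** D + D ** Q = 0 \<Longrightarrow> D = 0"
    "\<And>P D :: real^'n^'n. norm (P - mat 1) < d \<Longrightarrow> P ** D = 0 \<Longrightarrow> D = 0"
proof -
  obtain d where d: "d > 0" and
    syl: "\<And>P Q D :: real^'n^'n. norm (P - mat 1) < d \<Longrightarrow> norm (Q - mat 1) < d \<Longrightarrow> P ** D + D ** Q = 0 \<Longrightarrow> D = 0" and
    inj: "\<And>P D :: real^'n^'n. norm (P - mat 1) < d \<Longrightarrow> P ** D = 0 \<Longrightarrow> D = 0"
  proof (rule sylvester_near_identity[where 'n='n], goal_cases)
    case 1
    show ?thesis using 1(2-) by (rule that)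
  qed
  note bb = bounded_bilinear_matrix_mult_real[where 'n='n and 'k='n and 'l='n]
  define N where "N = ball (mat 1 :: real^'n^'n) d"
  have N: "s \<in> N \<longleftrightarrow> norm (s - mat 1) < d" for s
    by (simp add: N_def dist_norm norm_minus_commute)
  define f' where "f' s = Blinfun (\<lambda>v. s ** v + v ** s)" for s :: "real^'n^'n"
  have bl: "bounded_linear (\<lambda>v :: real^'n^'n. s ** v + v ** s)" for s
    by (intro bounded_linear_add bounded_bilinear.bounded_linear_left[OF bb] bounded_bilinear.bounded_linear_right[OF bb])
  have f': "blinfun_apply (f' s) = (\<lambda>v. s ** v + v ** s)" for s
    unfolding f'_def using bl by (rule bounded_linear_Blinfun_apply)
  have der: "((\<lambda>s. s ** s) has_derivative blinfun_apply (f' s)) (at s)" for s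
    unfolding f' using bounded_bilinear.FDERIV[OF bb has_derivative_ident has_derivative_ident] .
  have cont: "continuous_on N f'"
  proof (rule continuous_on_blinfun_componentwise)
    fix i :: "real^'n^'n"
    have "continuous_on N (\<lambda>s. s ** i + i ** s)"
      by (rule continuous_on_add; rule bounded_bilinear.continuous_on[OF bb]; rule continuous_on_id continuous_on_const)
    then show "continuous_on N (\<lambda>s. blinfun_apply (f' s) i)" by (simp only: f')
  qed
  \<comment> \<open>Squaring has derivative 2 at the identity, so half the identity inverts
    it.\<close>
  have invf: "(1/2) *\<^sub>R id_blinfun o\<^sub>L f' (mat 1) = id_blinfun"
    by (rule blinfun_eqI) (simp add: f' blinfun.scaleR_left scaleR_add_right[symmetric] scaleR_2[symmetric])
  have "open N" "mat 1 \<in> N" using d by (simp_all add: N_def)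
  then obtain U V g g' where U: "open U" "U \<subseteq> N" "mat 1 \<in> U" and V: "open V" "mat 1 ** mat 1 \<in> V"
    and hom: "homeomorphism U V (\<lambda>s. s ** s) g"
    and der_g: "\<And>y. y \<in> V \<Longrightarrow> (g has_derivative (g' y)) (at y)"
    and "\<And>y. y \<in> V \<Longrightarrow> g' y = inv_into UNIV (blinfun_apply (f' (g y)))"
    and "\<And>y. y \<in> V \<Longrightarrow> bij (blinfun_apply (f' (g y)))"
  proof (rule inverse_function_theorem[OF _ der cont _ invf], goal_cases)
    case 1
    show ?thesis using 1(2-) by (rule that)
  qed
  have sq: "g w ** g w = w" if "w \<in> V" for w using hom that by (simp add: homeomorphism_def)
  have gN: "norm (g w - mat 1) < d" if "w \<in> V" for w
  proof -
    have "g w \<in> U" using hom that by (auto simp: homeomorphism_def)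
    then show ?thesis using U(2) N by auto
  qed
  have "Ck_on k V g" for k
  proof (induction k)
    case 0
    then show ?case using hom by (simp add: homeomorphism_def)
  next
    case (Suc k)
    have der_k: "Ck_on k V (\<lambda>y. g' y v)" for v
    proof (rule Ck_on_linear_solve[OF V(1), where A="\<lambda>y D. g y ** D + D ** g y" and b="\<lambda>y. v"])
      fix y assume y: "y \<in> V"
      show lin: "linear (\<lambda>D. g y ** D + D ** g y)"
        using bl by (rule bounded_linear.linear)
      show "inj (\<lambda>D. g y ** D + D ** g y)"
        unfolding linear_injective_0[OF lin] using syl[OF gN[OF y] gN[OF y]] by blast
      have "((\<lambda>y. g y ** g y) has_derivative (\<lambda>h. g y ** g' y h + g' y h ** g y)) (at y)"
        by (rule bounded_bilinear.FDERIV[OF bb der_g[OF y] der_g[OF y]])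
      moreover have "((\<lambda>y. g y ** g y) has_derivative (\<lambda>h. h)) (at y)"
        by (rule has_derivative_transform_within_open[OF has_derivative_ident V(1) y]) (simp add: sq)
      ultimately show "g y ** g' y v + g' y v ** g y = v"
        using has_derivative_unique[THEN fun_cong, of "\<lambda>y. g y ** g y" "\<lambda>h. g y ** g' y h + g' y h ** g y" y "\<lambda>h. h" v]
        by blast
    next
      fix v
      show "Ck_on k V (\<lambda>y. g y ** v + v ** g y)"
        by (rule Ck_on_add[OF V(1)]; rule Ck_on_bilinear[OF bb V(1)]; rule Ck_on_const[OF V(1)] Suc)
    qed (rule Ck_on_const[OF V(1)])
    show ?case by (rule Ck_on_SucI[where f'=g', OF V(1) der_g]) (simp_all add: der_k)
  qed
  then have "smooth_on V g" by (simp add: smooth_on_def)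
  moreover have "mat 1 \<in> V" using V(2) by (simp add: matrix_mul_lid)
  ultimately show ?thesis using V(1) sq gN syl inj by (intro that[of V g d])
qed

text \<open>If \<open>w ** C = C ** w'\<close>, the defect \<open>D = g w ** C - C ** g w'\<close>
  of the square roots satisfies \<open>g w ** D + D ** g w' = 0\<close>, so it vanishes by the
  Sylvester injectivity; comparing \<open>g (transpose w)\<close> with
  \<open>transpose (g w)\<close> works in the same way. Two different matrices are allowed in the
  intertwining relation because \<open>C\<close> will be a form that relates
  \<open>transpose w\<close> to \<open>w\<close>.\<close>

lemma matrix_inverse_sqrt_near_identity:
  obtains W and r :: "real^'n^'n \<Rightarrow> real^'n^'n"
  where "open W" "mat 1 \<in> W" "smooth_on W r"
    "\<And>w. w \<in> W \<Longrightarrow> transpose w \<in> W"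
    "\<And>w. w \<in> W \<Longrightarrow> r w ** w ** r w = mat 1"
    "\<And>w. w \<in> W \<Longrightarrow> r (transpose w) = transpose (r w)"
    "\<And>w w' C. w \<in> W \<Longrightarrow> w' \<in> W \<Longrightarrow> w ** C = C ** w' \<Longrightarrow> r w ** C = C ** r w'"
proof -
  obtain V and g :: "real^'n^'n \<Rightarrow> real^'n^'n" and d where V: "open V" "mat 1 \<in> V" and g: "smooth_on V g"
    "\<And>w. w \<in> V \<Longrightarrow> g w ** g w = w" "\<And>w. w \<in> V \<Longrightarrow> norm (g w - mat 1) < d"
    and syl: "\<And>P Q D :: real^'n^'n. norm (P - mat 1) < d \<Longrightarrow> norm (Q - mat 1) < d \<Longrightarrow> P ** D + D ** Q = 0 \<Longrightarrow> D = 0"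
    and inj: "\<And>P D :: real^'n^'n. norm (P - mat 1) < d \<Longrightarrow> P ** D = 0 \<Longrightarrow> D = 0"
  proof (rule matrix_sqrt_near_identity[where 'n='n], goal_cases)
    case 1
    show ?thesis using 1(2-) by (rule that)
  qed
  \<comment> \<open>The intersection makes the domain stable under transposition; the identity,
    being symmetric, stays inside.\<close>
  define W where "W = V \<inter> transpose -` V"
  note bb = bounded_bilinear_matrix_mult_real[where 'n='n and 'k='n and 'l='n]
  have tr: "transpose w \<in> W" if "w \<in> W" for w using that by (simp add: W_def)
  have WV: "W \<subseteq> V" by (auto simp: W_def)
  have W: "open W"
    unfolding W_def using V(1)
    by (intro open_Int open_vimage linear_continuous_on bounded_linear_transpose) auto
  have W1: "mat 1 \<in> W" using V(2) by (simp add: W_def transpose_mat)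
  define r where "r w = matrix_inv (g w)" for w
  have invg: "invertible (g w)" if "w \<in> V" for w
  proof -
    have lin: "linear (\<lambda>X :: real^'n^'n. g w ** X)"
      by (rule bounded_linear.linear[OF bounded_bilinear.bounded_linear_right[OF bb]])
    have "inj (\<lambda>X :: real^'n^'n. g w ** X)"
      unfolding linear_injective_0[OF lin] using inj[OF g(3)[OF that]] by blast
    then have "surj (\<lambda>X :: real^'n^'n. g w ** X)" by (intro linear_injective_imp_surjective[OF lin]) simp_all
    from surjD[OF this, of "mat 1"] obtain X where "mat 1 = g w ** X" ..
    then show ?thesis by (auto simp: invertible_right_inverse)
  qed
  have r: "g w ** r w = mat 1" "r w ** g w = mat 1" if "w \<in> V" for w
    using matrix_inv_invertible[OF invg[OF that]] by (simp_all add: r_def)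
  have "smooth_on V r"
  proof (rule smooth_on_linear_solve[OF V(1), where A="\<lambda>w (X :: real^'n^'n). g w ** X" and b="\<lambda>w. mat 1"])
    fix w assume w: "w \<in> V"
    show lin: "linear (\<lambda>X :: real^'n^'n. g w ** X)"
      by (rule bounded_linear.linear[OF bounded_bilinear.bounded_linear_right[OF bb]])
    show "inj (\<lambda>X :: real^'n^'n. g w ** X)"
      unfolding linear_injective_0[OF lin] using inj[OF g(3)[OF w]] by blast
    show "g w ** r w = mat 1" by (rule r(1)[OF w])
  next
    show "smooth_on V (\<lambda>w. g w ** v)" for v
      by (intro smooth_on_matrix_mult V(1) g(1) smooth_on_const)
  qed (rule smooth_on_const[OF V(1)])
  then have "smooth_on W r" by (rule smooth_on_subset[OF _ WV])
  moreover have "r w ** w ** r w = mat 1" if "w \<in> W" for w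
  proof -
    have w: "w \<in> V" using that WV by blast
    have "r w ** w ** r w = r w ** (g w ** g w) ** r w" by (simp only: g(2)[OF w])
    also have "\<dots> = (r w ** g w) ** (g w ** r w)" by (simp only: matrix_mul_assoc)
    finally show ?thesis by (simp add: r[OF w] matrix_mul_lid)
  qed
  moreover have "r (transpose w) = transpose (r w)" if "w \<in> W" for w
  proof -
    have w: "w \<in> V" "transpose w \<in> V" using that by (auto simp: W_def)
    have "norm (transpose (g w) - mat 1) < d"
      using g(3)[OF w(1)] norm_transpose[of "g w - mat 1"]
      by (simp add: linear_diff[OF bounded_linear.linear[OF bounded_linear_transpose]] transpose_mat)
    moreover have "transpose (g w) ** transpose (g w) = transpose w"
      using g(2)[OF w(1)] by (simp add: matrix_transpose_mul[symmetric])
    moreover have "g (transpose w) ** (g (transpose w) - transpose (g w))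
        + (g (transpose w) - transpose (g w)) ** transpose (g w) = 0"
      using g(2)[OF w(2)] calculation(2) by (simp add: matrix_diff_mult_left matrix_diff_mult_right)
    ultimately have "g (transpose w) - transpose (g w) = 0"
      using syl[OF g(3)[OF w(2)]] by blast
    then have gt: "g (transpose w) = transpose (g w)" by simp
    have "transpose (r w) ** transpose (g w) = mat 1"
      using r(1)[OF w(1)] by (simp add: matrix_transpose_mul[symmetric] transpose_mat)
    then have "transpose (r w) = transpose (r w) ** (g (transpose w) ** r (transpose w))"
      by (simp add: r(1)[OF w(2)] matrix_mul_rid)
    also have "\<dots> = (transpose (r w) ** transpose (g w)) ** r (transpose w)"
      by (simp only: gt matrix_mul_assoc)
    finally show ?thesis
      using \<open>transpose (r w) ** transpose (g w) = mat 1\<close> by (simp add: matrix_mul_lid)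
  qed
  moreover have "r w ** C = C ** r w'" if w: "w \<in> W" "w' \<in> W" and C: "w ** C = C ** w'" for w w' C
  proof -
    have w: "w \<in> V" "w' \<in> V" using w WV by auto
    have "g w ** (g w ** C) = (C ** g w') ** g w'"
      by (simp only: matrix_mul_assoc g(2)[OF w(1)]) (simp only: matrix_mul_assoc[symmetric] g(2)[OF w(2)] C)
    then have "g w ** (g w ** C - C ** g w') + (g w ** C - C ** g w') ** g w' = 0"
      by (simp add: matrix_diff_mult_left matrix_diff_mult_right matrix_mul_assoc)
    then have "g w ** C - C ** g w' = 0"
      by (rule syl[OF g(3)[OF w(1)] g(3)[OF w(2)]])
    then have gC: "g w ** C = C ** g w'" by simp
    have "r w ** C = r w ** (C ** g w') ** r w'"
      by (simp only: matrix_mul_assoc[symmetric] r(1)[OF w(2)] matrix_mul_rid)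
    also have "\<dots> = (r w ** g w) ** (C ** r w')"
      unfolding gC[symmetric] by (simp only: matrix_mul_assoc)
    also have "\<dots> = C ** r w'" by (simp only: r(2)[OF w(1)] matrix_mul_lid)
    finally show ?thesis .
  qed
  ultimately show ?thesis using W W1 tr by (intro that[of W r])
qed

section \<open>Symmetric bilinear forms\<close>

lemma has_signatureI:
  fixes B :: "'v::euclidean_space \<Rightarrow> 'v \<Rightarrow> real"
  assumes "bilinear B" "\<And>u v. B u v = B v u" "p + q = DIM('v)"
    and "subspace P" "subspace N" "dim P = p" "dim N = q"
    and "\<And>u. u \<in> P \<Longrightarrow> u \<noteq> 0 \<Longrightarrow> B u u > 0" "\<And>u. u \<in> N \<Longrightarrow> u \<noteq> 0 \<Longrightarrow> B u u < 0"
    and "\<And>u v. u \<in> P \<Longrightarrow> v \<in> N \<Longrightarrow> B u v = 0"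
  shows "has_signature B p q"
  unfolding has_signature_def
proof (intro conjI exI)
  show "subspace P" "subspace N" by fact+
qed (use assms in auto)

lemma has_signature_definite_dims:
  fixes B :: "'v::euclidean_space \<Rightarrow> 'v \<Rightarrow> real"
  assumes "subspace P" "subspace N" "\<And>u. u \<in> P \<Longrightarrow> u \<noteq> 0 \<Longrightarrow> B u u > 0" "\<And>u. u \<in> N \<Longrightarrow> u \<noteq> 0 \<Longrightarrow> B u u < 0"
  shows "dim P + dim N \<le> DIM('v)"
proof -
  have "u = 0" if "u \<in> P \<inter> N" for u
    using assms(3)[of u] assms(4)[of u] that by (cases "u = 0") auto
  then have "P \<inter> N = {0}" using assms(1,2) subspace_0 by blast
  then have "dim (P \<inter> N) = 0" by simp
  then show ?thesis
    using dim_sums_Int[OF assms(1,2)] dim_subset_UNIV[of "{x + y |x y. x \<in> P \<and> y \<in> N}"] by linarith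
qed

text \<open>Sylvester's law of inertia: a positive subspace of one decomposition meets a negative
  subspace of the other only in 0, which bounds \<open>p + q'\<close> and \<open>p' + q\<close> by
  the dimension.\<close>

lemma has_signature_unique:
  fixes B :: "'v::euclidean_space \<Rightarrow> 'v \<Rightarrow> real"
  assumes "has_signature B p q" "has_signature B p' q'"
  shows "p = p'" "q = q'"
proof -
  obtain P N where 1: "subspace P" "subspace N" "dim P = p" "dim N = q"
    "\<forall>u\<in>P. u \<noteq> 0 \<longrightarrow> B u u > 0" "\<forall>u\<in>N. u \<noteq> 0 \<longrightarrow> B u u < 0"
    using assms(1) unfolding has_signature_def by metis
  obtain P' N' where 2: "subspace P'" "subspace N'" "dim P' = p'" "dim N' = q'"
    "\<forall>u\<in>P'. u \<noteq> 0 \<longrightarrow> B u u > 0" "\<forall>u\<in>N'. u \<noteq> 0 \<longrightarrow> B u u < 0"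
    using assms(2) unfolding has_signature_def by metis
  have "p + q' \<le> DIM('v)" "p' + q \<le> DIM('v)"
    using has_signature_definite_dims[of P N' B] has_signature_definite_dims[of P' N B] 1 2 by auto
  moreover have "p + q = DIM('v)" "p' + q' = DIM('v)" using assms by (auto simp: has_signature_def)
  ultimately show "p = p'" "q = q'" by auto
qed

lemma has_signature_neg:
  assumes "has_signature B p q"
  shows "has_signature (\<lambda>u v. - B u v) q p"
proof -
  obtain P N where PN: "subspace P" "subspace N" "dim P = p" "dim N = q"
    "\<forall>u\<in>P. u \<noteq> 0 \<longrightarrow> B u u > 0" "\<forall>u\<in>N. u \<noteq> 0 \<longrightarrow> B u u < 0" "\<forall>u\<in>P. \<forall>v\<in>N. B u v = 0"
    using assms unfolding has_signature_def by metis
  have bil: "bilinear (\<lambda>u v. - B u v)" and sym: "\<forall>u v. B u v = B v u"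
    using assms unfolding has_signature_def bilinear_def linear_iff by simp_all
  have "- B u v = 0" if "u \<in> N" "v \<in> P" for u v
    using PN(7) that sym[rule_format, of u v] by simp
  then have "\<exists>P N. subspace P \<and> subspace N \<and> dim P = q \<and> dim N = p \<and>
        (\<forall>u\<in>P. u \<noteq> 0 \<longrightarrow> - B u u > 0) \<and> (\<forall>u\<in>N. u \<noteq> 0 \<longrightarrow> - B u u < 0) \<and>
        (\<forall>u\<in>P. \<forall>v\<in>N. - B u v = 0)"
    using PN by (intro exI[of _ N] exI[of _ P]) simp
  then show ?thesis using assms bil unfolding has_signature_def by simp
qed

lemma has_signature_transport:
  fixes B :: "'v::euclidean_space \<Rightarrow> 'v \<Rightarrow> real" and L :: "'v \<Rightarrow> 'v"
  assumes "has_signature B p q" "linear L" "linear L'" "\<And>u. L (L' u) = u" "\<And>u. L' (L u) = u"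
  shows "has_signature (\<lambda>u v. B (L u) (L v)) p q"
proof -
  obtain P N where PN: "subspace P" "subspace N" "dim P = p" "dim N = q"
    "\<forall>u\<in>P. u \<noteq> 0 \<longrightarrow> B u u > 0" "\<forall>u\<in>N. u \<noteq> 0 \<longrightarrow> B u u < 0" "\<forall>u\<in>P. \<forall>v\<in>N. B u v = 0"
    using assms(1) unfolding has_signature_def by metis
  have inj: "inj_on L' S" for S using assms(4) by (metis inj_on_inverseI)
  have bil: "bilinear (\<lambda>u v. B (L u) (L v))"
    using assms(1,2) unfolding has_signature_def bilinear_def linear_iff by simp
  have 0: "L' u = 0 \<longleftrightarrow> u = 0" for u
    using assms(4)[of u] linear_0[OF assms(2)] linear_0[OF assms(3)] by metis
  have "\<exists>P N. subspace P \<and> subspace N \<and> dim P = p \<and> dim N = q \<and>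
        (\<forall>u\<in>P. u \<noteq> 0 \<longrightarrow> B (L u) (L u) > 0) \<and> (\<forall>u\<in>N. u \<noteq> 0 \<longrightarrow> B (L u) (L u) < 0) \<and>
        (\<forall>u\<in>P. \<forall>v\<in>N. B (L u) (L v) = 0)"
  proof (intro exI conjI)
    show "subspace (L' ` P)" "subspace (L' ` N)" using PN assms(3) by (simp_all add: linear_subspace_image)
    show "dim (L' ` P) = p" "dim (L' ` N) = q"
      using PN dim_image_eq[OF assms(3) inj] by simp_all
  qed (use PN assms(4) 0 in auto)
  then show ?thesis using assms(1) bil unfolding has_signature_def by simp
qed

lemma bilinear_sum_expand:
  assumes "bilinear B" "finite I" "\<And>i j. i \<in> I \<Longrightarrow> j \<in> I \<Longrightarrow> B (e i) (e j) = (if i = j then s i else 0)" "j \<in> I"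
  shows "B (\<Sum>i\<in>I. c i *\<^sub>R e i) (e j) = c j * (s j :: real)"
proof -
  have "B (\<Sum>i\<in>I. c i *\<^sub>R e i) (e j) = (\<Sum>i\<in>I. c i * B (e i) (e j))"
    using linear_sum[of "\<lambda>x. B x (e j)" "\<lambda>i. c i *\<^sub>R e i" I] linear_scale[of "\<lambda>x. B x (e j)"] assms(1)
    by (simp add: bilinear_def)
  also have "\<dots> = (\<Sum>i\<in>I. if i = j then c j * s j else 0)"
    using assms(3,4) by (intro sum.cong) auto
  finally show ?thesis using assms(2,4) by simp
qed

lemma orthogonal_family:
  fixes B :: "'v::euclidean_space \<Rightarrow> 'v \<Rightarrow> real"
  assumes "bilinear B" "finite I" "\<And>i j. i \<in> I \<Longrightarrow> j \<in> I \<Longrightarrow> B (e i) (e j) = (if i = j then s i else 0)"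
    and "\<And>i. i \<in> I \<Longrightarrow> s i \<noteq> 0"
  shows "inj_on e I" "independent (e ` I)" "dim (span (e ` I)) = card I"
    and "u \<in> span (e ` I) \<longleftrightarrow> (\<exists>c. u = (\<Sum>i\<in>I. c i *\<^sub>R e i))"
proof -
  show inj: "inj_on e I"
    using assms(3,4) by (intro inj_onI) metis
  show span: "u \<in> span (e ` I) \<longleftrightarrow> (\<exists>c. u = (\<Sum>i\<in>I. c i *\<^sub>R e i))" for u
  proof
    assume "u \<in> span (e ` I)"
    then obtain c where "u = (\<Sum>v\<in>e ` I. c v *\<^sub>R v)"
      using assms(2) by (auto simp: span_finite)
    then show "\<exists>c. u = (\<Sum>i\<in>I. c i *\<^sub>R e i)"
      by (intro exI[of _ "c \<circ> e"]) (simp add: sum.reindex[OF inj])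
  qed (auto intro!: span_sum span_scale intro: span_base)
  show ind: "independent (e ` I)"
  proof (rule independent_if_scalars_zero)
    show "finite (e ` I)" using assms(2) by simp
    fix f x assume f: "(\<Sum>x\<in>e ` I. f x *\<^sub>R x) = 0" and "x \<in> e ` I"
    then obtain j where j: "j \<in> I" "x = e j" by auto
    have "(\<Sum>i\<in>I. f (e i) *\<^sub>R e i) = 0" using f by (simp add: sum.reindex[OF inj])
    then have "f (e j) * s j = B 0 (e j)"
      using bilinear_sum_expand[OF assms(1-3) j(1), of "\<lambda>i. f (e i)"] by simp
    also have "\<dots> = 0" using bilinear_lzero[OF assms(1)] .
    finally show "f x = 0" using assms(4) j by auto
  qed
  show "dim (span (e ` I)) = card I"
    using ind inj by (simp add: dim_eq_card_independent card_image)
qed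

lemma has_signature_orthogonal_basis:
  fixes B :: "'v::euclidean_space \<Rightarrow> 'v \<Rightarrow> real"
  assumes "bilinear B" "\<And>u v. B u v = B v u" "finite I" "card I = DIM('v)"
    and B: "\<And>i j. i \<in> I \<Longrightarrow> j \<in> I \<Longrightarrow> B (e i) (e j) = (if i = j then s i else 0)"
    and s: "\<And>i. i \<in> I \<Longrightarrow> s i \<noteq> 0"
  shows "has_signature B (card {i\<in>I. s i > 0}) (card {i\<in>I. s i < 0})"
proof -
  have expand: "B u u = (\<Sum>i\<in>J. (c i)\<^sup>2 * s i)" "\<And>j. j \<in> I - J \<Longrightarrow> B u (e j) = 0"
    if "u = (\<Sum>i\<in>J. c i *\<^sub>R e i)" "J \<subseteq> I" for u J c
  proof -
    have fin: "finite J" using that(2) assms(3) finite_subset by blast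
    have ue: "B u (e j) = (if j \<in> J then c j * s j else 0)" if "j \<in> I" for j
    proof -
      have "u = (\<Sum>i\<in>I. (if i \<in> J then c i else 0) *\<^sub>R e i)"
        unfolding \<open>u = _\<close> using \<open>J \<subseteq> I\<close> assms(3) by (intro sum.mono_neutral_cong_left) auto
      then show ?thesis using bilinear_sum_expand[OF assms(1,3) B that] by simp
    qed
    have "B u u = B (\<Sum>i\<in>J. c i *\<^sub>R e i) u" by (simp add: that(1))
    also have "\<dots> = (\<Sum>i\<in>J. c i * B (e i) u)"
      using linear_sum[of "\<lambda>x. B x u" "\<lambda>i. c i *\<^sub>R e i" J] linear_scale[of "\<lambda>x. B x u"] assms(1)
      by (simp add: bilinear_def)
    also have "\<dots> = (\<Sum>i\<in>J. (c i)\<^sup>2 * s i)"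
      using ue that(2) assms(2)[of _ u] by (intro sum.cong) (auto simp: power2_eq_square)
    finally show "B u u = (\<Sum>i\<in>J. (c i)\<^sup>2 * s i)" .
    show "\<And>j. j \<in> I - J \<Longrightarrow> B u (e j) = 0" using ue by simp
  qed
  define P where "P = {i\<in>I. s i > 0}"
  define N where "N = {i\<in>I. s i < 0}"
  have PN: "finite P" "finite N" "P \<subseteq> I" "N \<subseteq> I" "P \<inter> N = {}" "P \<union> N = I"
    using assms(3) s by (auto simp: P_def N_def linorder_neq_iff)
  note spanP = orthogonal_family[where e=e and s=s, OF assms(1) PN(1)]
  note spanN = orthogonal_family[where e=e and s=s, OF assms(1) PN(2)]
  have BP: "B (e i) (e j) = (if i = j then s i else 0)" "s i \<noteq> 0" if "i \<in> P" "j \<in> P" for i j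
    using B[of i j] s[of i] that PN(3) by (auto simp: subset_iff)
  have BN: "B (e i) (e j) = (if i = j then s i else 0)" "s i \<noteq> 0" if "i \<in> N" "j \<in> N" for i j
    using B[of i j] s[of i] that PN(4) by (auto simp: subset_iff)
  have total: "card P + card N = DIM('v)"
    using PN assms(4) card_Un_disjoint[of P N] by simp
  have pos: "B u u > 0" if u: "u \<in> span (e ` P)" "u \<noteq> 0" for u
  proof -
    obtain c where c: "u = (\<Sum>i\<in>P. c i *\<^sub>R e i)" using spanP(4) BP u(1) by blast
    obtain i where i: "i \<in> P" "c i \<noteq> 0" using c u(2) by (metis (no_types, lifting) scaleR_eq_0_iff sum.neutral)
    have "0 < (\<Sum>i\<in>P. (c i)\<^sup>2 * s i)"
      using i by (intro sum_pos2[OF PN(1) i(1)]) (auto simp: P_def)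
    then show ?thesis using expand(1)[OF c PN(3)] by simp
  qed
  have neg: "B u u < 0" if u: "u \<in> span (e ` N)" "u \<noteq> 0" for u
  proof -
    obtain c where c: "u = (\<Sum>i\<in>N. c i *\<^sub>R e i)" using spanN(4) BN u(1) by blast
    obtain i where i: "i \<in> N" "c i \<noteq> 0" using c u(2) by (metis (no_types, lifting) scaleR_eq_0_iff sum.neutral)
    have "0 < (\<Sum>i\<in>N. - ((c i)\<^sup>2 * s i))"
      using i by (intro sum_pos2[OF PN(2) i(1)]) (auto simp: N_def mult_pos_neg mult_nonneg_nonpos)
    then show ?thesis using expand(1)[OF c PN(4)] by (simp add: sum_negf)
  qed
  have orth: "B u v = 0" if uv: "u \<in> span (e ` P)" "v \<in> span (e ` N)" for u v
  proof -
    obtain c where c: "u = (\<Sum>i\<in>P. c i *\<^sub>R e i)" using spanP(4) BP uv(1) by blast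
    have "subspace {v. B u v = 0}"
      using assms(1) by (simp add: subspace_def bilinear_radd bilinear_rmul bilinear_rzero)
    moreover have "e ` N \<subseteq> {v. B u v = 0}" using expand(2)[OF c PN(3)] PN by auto
    ultimately show ?thesis using uv(2) span_minimal by blast
  qed
  have dims: "dim (span (e ` P)) = card P" "dim (span (e ` N)) = card N"
    using spanP(3) BP spanN(3) BN by blast+
  show ?thesis
    unfolding P_def[symmetric] N_def[symmetric]
    by (rule has_signatureI[OF assms(1,2) total subspace_span subspace_span dims pos neg orth])
qed

lemma has_signature_nondegenerate:
  fixes B :: "'v::euclidean_space \<Rightarrow> 'v \<Rightarrow> real"
  assumes "has_signature B p q" "\<And>v. B u v = 0"
  shows "u = 0"
proof -
  obtain P N where PN: "subspace P" "subspace N" "dim P = p" "dim N = q" "p + q = DIM('v)"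
    "\<forall>u\<in>P. u \<noteq> 0 \<longrightarrow> B u u > 0" "\<forall>u\<in>N. u \<noteq> 0 \<longrightarrow> B u u < 0" "\<forall>u\<in>P. \<forall>v\<in>N. B u v = 0"
    and bil: "bilinear B" and sym: "\<And>u v. B u v = B v u"
    using assms(1) unfolding has_signature_def by metis
  have "x = 0" if "x \<in> P \<inter> N" for x
    using PN(6,7) that by (cases "x = 0") force+
  then have "P \<inter> N = {0}" using PN(1,2) subspace_0 by blast
  then have "dim {x + y |x y. x \<in> P \<and> y \<in> N} = DIM('v)"
    using dim_sums_Int[OF PN(1,2)] PN(3-5) by simp
  then have "span {x + y |x y. x \<in> P \<and> y \<in> N} = UNIV"
    by (simp add: dim_eq_full)
  then have "{x + y |x y. x \<in> P \<and> y \<in> N} = UNIV"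
    by (simp only: span_eq_iff[THEN iffD2, OF subspace_sums[OF PN(1,2)]])
  then obtain x y where xy: "u = x + y" "x \<in> P" "y \<in> N" by blast
  have "B x x = B u x" "B y y = B u y"
    using xy PN(8) sym[of y x] by (simp_all add: bilinear_ladd[OF bil])
  then have "x = 0" "y = 0" using assms(2) PN(6,7) xy by force+
  then show ?thesis using xy by simp
qed

text \<open>Gram--Schmidt for frames that are invariant under the operators \<open>Op a\<close>: \<open>r = 1, 2, 4\<close> yields real,
  complex and quaternionic orthonormal bases.\<close>

lemma adapted_frame:
  fixes B :: "'v::euclidean_space \<Rightarrow> 'v \<Rightarrow> real" and Op :: "nat \<Rightarrow> 'v \<Rightarrow> 'v"
  assumes bil: "bilinear B" and sym: "\<And>u v. B u v = B v u"
    and nondeg: "\<And>u. (\<And>v. B u v = 0) \<Longrightarrow> u = 0"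
    and r: "r > 0" and Op: "\<And>a. a < r \<Longrightarrow> Op a \<in> Cl" and eps: "\<And>a. a < r \<Longrightarrow> eps a \<noteq> 0"
    and good: "\<And>z a b. good z \<Longrightarrow> a < r \<Longrightarrow> b < r \<Longrightarrow> B (Op a z) (Op b z) = (if a = b then eps a * s z else 0)"
    and s: "\<And>z. good z \<Longrightarrow> s z \<noteq> 0"
    and Cl: "\<And>T z v a. T \<in> Cl \<Longrightarrow> good z \<Longrightarrow> (\<And>b. b < r \<Longrightarrow> B v (Op b z) = 0) \<Longrightarrow> a < r \<Longrightarrow> B (T v) (Op a z) = 0"
    and ex: "\<And>V. subspace V \<Longrightarrow> V \<noteq> {0} \<Longrightarrow> (\<And>T v. T \<in> Cl \<Longrightarrow> v \<in> V \<Longrightarrow> T v \<in> V) \<Longrightarrow>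
      (\<And>u. u \<in> V \<Longrightarrow> (\<And>v. v \<in> V \<Longrightarrow> B u v = 0) \<Longrightarrow> u = 0) \<Longrightarrow> \<exists>z\<in>V. good z"
  shows "\<exists>n z. r * n = DIM('v) \<and> (\<forall>i<n. good (z i)) \<and> (\<forall>i<n. \<forall>j<n. \<forall>a<r. \<forall>b<r.
      B (Op a (z i)) (Op b (z j)) = (if i = j \<and> a = b then eps a * s (z i) else 0))"
proof -
  define Q where "Q n z \<longleftrightarrow> (\<forall>i<n. good (z i)) \<and>
    (\<forall>i<n. \<forall>j<n. i \<noteq> j \<longrightarrow> (\<forall>a<r. \<forall>b<r. B (Op a (z i)) (Op b (z j)) = 0))" for n :: nat and z
  have orth: "B (Op a (z i)) (Op b (z j)) = (if i = j \<and> a = b then eps a * s (z i) else 0)"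
    if "Q n z" "i < n" "j < n" "a < r" "b < r" for n z i j a b
    using that good[of "z i" a b] unfolding Q_def by (cases "i = j") auto
  define I where "I n = {..<n} \<times> {..<r}" for n :: nat
  have fin: "finite (I n)" and card: "card (I n) = r * n" for n by (simp_all add: I_def)
  define e where "e z = (\<lambda>(i, a). Op a (z i))" for z :: "nat \<Rightarrow> 'v"
  define t where "t z = (\<lambda>(i, a). eps a * s (z i))" for z :: "nat \<Rightarrow> 'v"
  have Be: "B (e z x) (e z y) = (if x = y then t z x else 0)" if "Q n z" "x \<in> I n" "y \<in> I n" for n z x y
    using that orth[OF that(1), of "fst x" "fst y" "snd x" "snd y"]
    by (cases x; cases y) (simp add: e_def t_def I_def)
  have t0: "t z x \<noteq> 0" if "Q n z" "x \<in> I n" for n z x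
    using that eps s by (auto simp: t_def I_def Q_def)
  have bound: "r * n \<le> DIM('v)" if "Q n z" for n z
    using orthogonal_family(3)[where e="e z" and s="t z", OF bil fin[of n] Be[OF that] t0[OF that]] card
      dim_subset_UNIV[of "span (e z ` I n)"] by simp
  have ex0: "\<exists>z. Q 0 z" by (simp add: Q_def)
  have le: "n \<le> DIM('v)" if ex_z: "\<exists>z. Q n z" for n
  proof -
    obtain z where "Q n z" using ex_z by blast
    from bound[OF this] have "r * n \<le> DIM('v)" .
    moreover have "1 * n \<le> r * n" using r by (intro mult_le_mono1) simp
    ultimately show ?thesis by linarith
  qed
  \<comment> \<open>A family of maximal length. The maximum exists because the images of the
    \<open>z i\<close> under the \<open>Op a\<close> are independent, so their number
    \<open>r * n\<close> is at most the dimension.\<close>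
  define n where "n = (GREATEST k. \<exists>z. Q k z)"
  have "\<exists>z. Q n z" unfolding n_def by (rule GreatestI_nat[where P="\<lambda>k. \<exists>z. Q k z", OF ex0 le])
  have n: "k \<le> n" if "\<exists>z. Q k z" for k unfolding n_def by (rule Greatest_le_nat[where P="\<lambda>k. \<exists>z. Q k z", OF that le])
  from \<open>\<exists>z. Q n z\<close> obtain z where Q: "Q n z" by blast
  \<comment> \<open>The orthogonal complement of all vectors \<open>Op a (z i)\<close>;
    \<open>pr\<close> is the orthogonal projection onto their span.\<close>
  define V where "V = {v. \<forall>i<n. \<forall>a<r. B v (Op a (z i)) = 0}"
  define pr where "pr u = (\<Sum>x\<in>I n. (B u (e z x) / t z x) *\<^sub>R e z x)" for u
  have pr: "B (u - pr u) (Op a (z i)) = 0" if "i < n" "a < r" for u i a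
  proof -
    have "(i, a) \<in> I n" using that by (simp add: I_def)
    from bilinear_sum_expand[where e="e z" and s="t z", OF bil fin[of n] Be[OF Q] this,
        of "\<lambda>x. B u (e z x) / t z x"]
    have "B (pr u) (e z (i, a)) = B u (e z (i, a))"
      using t0[OF Q \<open>(i, a) \<in> I n\<close>] by (simp add: pr_def)
    then show ?thesis by (simp add: e_def bilinear_lsub[OF bil])
  qed
  have sub: "subspace V"
    unfolding V_def subspace_def by (simp add: bilinear_lzero[OF bil] bilinear_ladd[OF bil] bilinear_lmul[OF bil])
  have ClV: "T v \<in> V" if "T \<in> Cl" "v \<in> V" for T v
  proof -
    have "B (T v) (Op a (z i)) = 0" if "i < n" "a < r" for i a
      by (rule Cl[OF \<open>T \<in> Cl\<close>]) (use Q \<open>v \<in> V\<close> that in \<open>simp_all add: Q_def V_def\<close>)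
    then show ?thesis by (simp add: V_def)
  qed
  \<comment> \<open>The complement inherits nondegeneracy: a vector of \<open>V\<close> orthogonal
    to \<open>V\<close> is orthogonal both to \<open>w - pr w\<close> and to \<open>pr w\<close>,
    hence to every \<open>w\<close>.\<close>
  have nd: "u = 0" if u: "u \<in> V" "\<And>v. v \<in> V \<Longrightarrow> B u v = 0" for u
  proof (rule nondeg)
    fix w
    have "w - pr w \<in> V" using pr by (simp add: V_def)
    then have "B u (w - pr w) = 0" by (rule u(2))
    moreover have "B u (pr w) = 0"
    proof -
      have "B u (pr w) = (\<Sum>x\<in>I n. (B w (e z x) / t z x) * B u (e z x))"
        using linear_sum[of "B u" "\<lambda>x. (B w (e z x) / t z x) *\<^sub>R e z x" "I n"] linear_scale[of "B u"] bil
        by (simp add: bilinear_def pr_def)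
      also have "\<dots> = 0"
        using u(1) by (intro sum.neutral) (auto simp: V_def I_def e_def)
      finally show ?thesis .
    qed
    ultimately show "B u w = 0" by (simp add: bilinear_rsub[OF bil])
  qed
  \<comment> \<open>A nonzero complement would contain another good vector, and appending it would
    contradict maximality.\<close>
  have "V = {0}"
  proof (rule ccontr)
    assume "V \<noteq> {0}"
    then have "\<exists>z\<in>V. good z"
    proof (rule ex[OF sub])
      show "\<And>T v. T \<in> Cl \<Longrightarrow> v \<in> V \<Longrightarrow> T v \<in> V" by (rule ClV)
      show "\<And>u. u \<in> V \<Longrightarrow> (\<And>v. v \<in> V \<Longrightarrow> B u v = 0) \<Longrightarrow> u = 0" by (rule nd)
    qed
    then obtain w where w: "w \<in> V" "good w" by blast
    define z' where "z' = z(n := w)"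
    have wV: "Op a w \<in> V" if "a < r" for a using ClV[OF Op[OF that] w(1)] .
    have "Q (Suc n) z'"
      unfolding Q_def
    proof (intro conjI allI impI)
      show "good (z' i)" if "i < Suc n" for i
        using that Q w(2) by (auto simp: z'_def Q_def less_Suc_eq)
      show "B (Op a (z' i)) (Op b (z' j)) = 0" if "i < Suc n" "j < Suc n" "i \<noteq> j" "a < r" "b < r" for i j a b
        using that orth[OF Q, of i j a b] wV[of a] wV[of b] sym[of "Op a (z i)" "Op b w"]
        by (auto simp: z'_def less_Suc_eq V_def)
    qed
    then show False using n[of "Suc n"] by auto
  qed
  then have "u = pr u" for u
  proof -
    have "u - pr u \<in> V" using pr by (simp add: V_def)
    then show ?thesis using \<open>V = {0}\<close> by simp
  qed
  then have "u \<in> span (e z ` I n)" for u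
    using orthogonal_family(4)[where e="e z" and s="t z", OF bil fin[of n] Be[OF Q] t0[OF Q], of u]
    unfolding pr_def by metis
  then have "span (e z ` I n) = UNIV" by auto
  then have "r * n = DIM('v)"
    using orthogonal_family(3)[where e="e z" and s="t z", OF bil fin[of n] Be[OF Q] t0[OF Q]] card
    by (simp del: dim_span)
  moreover have "\<forall>i<n. good (z i)" using Q by (simp add: Q_def)
  ultimately show ?thesis using orth[OF Q] by (intro exI[of _ n] exI[of _ z]) simp
qed

section \<open>Block matrices\<close>

lemmas matrix_mult_simps =
  bounded_bilinear.zero_left[OF bounded_bilinear_matrix_mult_real]
  bounded_bilinear.zero_right[OF bounded_bilinear_matrix_mult_real]
  bounded_bilinear.minus_left[OF bounded_bilinear_matrix_mult_real]
  bounded_bilinear.minus_right[OF bounded_bilinear_matrix_mult_real]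
  bounded_bilinear.scaleR_left[OF bounded_bilinear_matrix_mult_real]
  bounded_bilinear.scaleR_right[OF bounded_bilinear_matrix_mult_real]
  bounded_bilinear.add_left[OF bounded_bilinear_matrix_mult_real]
  bounded_bilinear.add_right[OF bounded_bilinear_matrix_mult_real]
  bounded_bilinear.diff_left[OF bounded_bilinear_matrix_mult_real]
  bounded_bilinear.diff_right[OF bounded_bilinear_matrix_mult_real]

lemmas transpose_simps =
  linear_add[OF bounded_linear.linear[OF bounded_linear_transpose[where 'f=real]]]
  linear_diff[OF bounded_linear.linear[OF bounded_linear_transpose[where 'f=real]]]
  linear_neg[OF bounded_linear.linear[OF bounded_linear_transpose[where 'f=real]]]
  linear_0[OF bounded_linear.linear[OF bounded_linear_transpose[where 'f=real]]]
  linear_scale[OF bounded_linear.linear[OF bounded_linear_transpose[where 'f=real]]]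
  matrix_transpose_mul transpose_transpose transpose_mat

lemma matrix_mult_left_right:
  "(A :: real^'n^'n) ** B = mat 1 \<Longrightarrow> B ** A = mat 1"
  using matrix_left_right_inverse by metis

lemma matrix_eq_iff_inner: "A = C \<longleftrightarrow> (\<forall>u v. u \<bullet> (A *v v) = u \<bullet> ((C :: real^'n^'k) *v v))"
proof
  assume *: "\<forall>u v. u \<bullet> (A *v v) = u \<bullet> (C *v v)"
  have "A *v v = C *v v" for v using * vector_eq_ldot by blast
  then show "A = C" by (simp add: matrix_eq)
qed simp

lemma inner_transpose: "(A *v u) \<bullet> v = u \<bullet> (transpose A *v (v :: real^'k))" for A :: "real^'n^'k"
  by (metis dot_lmul_matrix transpose_matrix_vector transpose_transpose)

lemma matrix_mult_entry: "(A ** B) $ i $ j = (\<Sum>k\<in>UNIV. A $ i $ k * B $ k $ j)"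
  by (simp add: matrix_matrix_mult_def)

lemma neg_matrix_vector: "(- A) *v v = - (A *v (v :: real^'n))"
  by (simp add: matrix_vector_mult_def vec_eq_iff sum_negf)

lemma scaleR_vector: "(x *\<^sub>R A) *v v = x *\<^sub>R (A *v (v :: real^'n))"
  by (simp add: scaleR_matrix_vector_assoc)

lemma scaleR_mat: "x *\<^sub>R (mat y :: real^'n^'n) = mat (x * y)"
  by (simp add: vec_eq_iff mat_def)

lemma trace_minus: "trace (- a) = - trace (a :: real^'n^'n)"
  by (simp add: trace_def sum_negf)

lemma sum_sum_type: "(\<Sum>s\<in>UNIV. f s) = (\<Sum>i\<in>UNIV. f (Inl i)) + (\<Sum>i\<in>UNIV. f (Inr i))"
  for f :: "'a::finite + 'b::finite \<Rightarrow> 'c::comm_monoid_add"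
  unfolding UNIV_Plus_UNIV[symmetric] by (subst sum.Plus) simp_all

definition blk :: "real^'n^'n \<Rightarrow> real^'n^'n \<Rightarrow> real^'n^'n \<Rightarrow> real^'n^'n \<Rightarrow> real^('n::finite + 'n)^('n + 'n)" where
  "blk a b c d = (\<chi> r s. case r of
      Inl i \<Rightarrow> (case s of Inl j \<Rightarrow> a $ i $ j | Inr j \<Rightarrow> b $ i $ j)
    | Inr i \<Rightarrow> (case s of Inl j \<Rightarrow> c $ i $ j | Inr j \<Rightarrow> d $ i $ j))"

lemma blk_component [simp]:
  "blk a b c d $ Inl i $ Inl j = a $ i $ j" "blk a b c d $ Inl i $ Inr j = b $ i $ j"
  "blk a b c d $ Inr i $ Inl j = c $ i $ j" "blk a b c d $ Inr i $ Inr j = d $ i $ j"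
  by (simp_all add: blk_def)

lemma vec_sum_eq_iff: "x = y \<longleftrightarrow> (\<forall>i. x $ Inl i = y $ Inl i) \<and> (\<forall>i. x $ Inr i = y $ Inr i)"
  for x :: "'b^('n::finite + 'k::finite)"
  by (metis sum.exhaust vec_eq_iff)

lemma blk_eq_iff: "blk a b c d = blk a' b' c' d' \<longleftrightarrow> a = a' \<and> b = b' \<and> c = c' \<and> d = d'"
  by (auto simp: vec_sum_eq_iff vec_eq_iff[of a] vec_eq_iff[of b] vec_eq_iff[of c] vec_eq_iff[of d]
      vec_eq_iff[of "_ $ _"])

definition ul :: "real^('n::finite + 'n)^('n + 'n) \<Rightarrow> real^'n^'n" where "ul T = (\<chi> i j. T $ Inl i $ Inl j)"
definition ur :: "real^('n::finite + 'n)^('n + 'n) \<Rightarrow> real^'n^'n" where "ur T = (\<chi> i j. T $ Inl i $ Inr j)"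
definition ll :: "real^('n::finite + 'n)^('n + 'n) \<Rightarrow> real^'n^'n" where "ll T = (\<chi> i j. T $ Inr i $ Inl j)"
definition lr :: "real^('n::finite + 'n)^('n + 'n) \<Rightarrow> real^'n^'n" where "lr T = (\<chi> i j. T $ Inr i $ Inr j)"

lemma blk_blocks: "blk (ul T) (ur T) (ll T) (lr T) = T"
  by (simp add: vec_sum_eq_iff ul_def ur_def ll_def lr_def)

lemma blocks_blk [simp]: "ul (blk a b c d) = a" "ur (blk a b c d) = b" "ll (blk a b c d) = c" "lr (blk a b c d) = d"
  by (simp_all add: ul_def ur_def ll_def lr_def vec_eq_iff)

lemma blk_exhaust: obtains a b c d where "T = blk a b c d"
  by (metis blk_blocks)

lemma blk_mult: "blk a b c d ** blk a' b' c' d' =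
    blk (a ** a' + b ** c') (a ** b' + b ** d') (c ** a' + d ** c') (c ** b' + d ** d')"
  by (simp add: vec_sum_eq_iff matrix_matrix_mult_def sum_sum_type)

lemma blk_linear: "blk a b c d + blk a' b' c' d' = blk (a + a') (b + b') (c + c') (d + d')"
  "blk a b c d - blk a' b' c' d' = blk (a - a') (b - b') (c - c') (d - d')"
  "- blk a b c d = blk (- a) (- b) (- c) (- d)" "x *\<^sub>R blk a b c d = blk (x *\<^sub>R a) (x *\<^sub>R b) (x *\<^sub>R c) (x *\<^sub>R d)"
  by (simp_all add: vec_sum_eq_iff)

lemma transpose_blk: "transpose (blk a b c d) = blk (transpose a) (transpose c) (transpose b) (transpose d)"
  by (simp add: vec_sum_eq_iff transpose_def)

lemma mat_blk: "mat x = blk (mat x) 0 0 (mat x)"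
  by (simp add: vec_sum_eq_iff mat_def)

lemma trace_blk: "trace (blk a b c d) = trace a + trace d"
  by (simp add: trace_def sum_sum_type)

lemma mat_minus_one: "mat (- x) = - mat x" for x :: "'a::ring_1"
  by (simp add: vec_eq_iff mat_def)

lemma mat_scaleR: "mat x = x *\<^sub>R (mat 1 :: real^'n^'n)"
  by (simp add: vec_eq_iff mat_def)

lemma bounded_linear_blk:
  assumes "bounded_linear f" "bounded_linear g" "bounded_linear h" "bounded_linear k"
  shows "bounded_linear (\<lambda>x :: 'v::euclidean_space. blk (f x) (g x) (h x) (k x))"
  using assms[THEN bounded_linear.linear]
  by (intro bounded_linearI') (simp_all add: linear_add linear_scale blk_linear)

lemma bounded_linear_blocks: "bounded_linear ul" "bounded_linear ur" "bounded_linear ll" "bounded_linear lr"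
  by (rule bounded_linearI'; simp add: ul_def ur_def ll_def lr_def vec_eq_iff)+

lemma smooth_on_blk:
  assumes "open S" "smooth_on S f" "smooth_on S g" "smooth_on S h" "smooth_on S k"
  shows "smooth_on S (\<lambda>x. blk (f x) (g x) (h x) (k x))"
proof -
  have "smooth_on S (\<lambda>x. (blk (f x) 0 0 0 + blk 0 (g x) 0 0) + (blk 0 0 (h x) 0 + blk 0 0 0 (k x)))"
    using assms
    by (intro smooth_on_add smooth_on_bounded_linear_comp[where f=f and L="\<lambda>a. blk a 0 0 0"]
        smooth_on_bounded_linear_comp[where f=g and L="\<lambda>a. blk 0 a 0 0"]
        smooth_on_bounded_linear_comp[where f=h and L="\<lambda>a. blk 0 0 a 0"]
        smooth_on_bounded_linear_comp[where f=k and L="\<lambda>a. blk 0 0 0 a"]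
        bounded_linear_blk bounded_linear_ident bounded_linear_zero)
  then show ?thesis by (simp add: blk_linear)
qed

section \<open>Generalized structures in components\<close>

definition Bm :: "real^('m::finite + 'm)^('m + 'm)" where "Bm = blk 0 (mat 1) (mat 1) 0"

lemma blk_mult_vector: "(blk a b c d *v X) $ Inl i = (a *v vpart X + b *v fpart X) $ i"
  "(blk a b c d *v X) $ Inr i = (c *v vpart X + d *v fpart X) $ i"
  by (simp_all add: matrix_vector_mult_def sum_sum_type vpart_def fpart_def)

lemma bform_eq: "bform X Y = X \<bullet> (Bm *v Y)"
  by (simp add: bform_def pairing_def inner_vec_def sum_sum_type Bm_def blk_mult_vector matrix_vector_mul_lid
      vpart_def fpart_def mult.commute)

lemma lin_structure_iff: "lin_structure lam T \<longleftrightarrow>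
    T ** T = mat lam \<and> trace T = 0 \<and> transpose T ** Bm = - (Bm ** T)"
proof -
  have "(\<forall>u v. bform (T *v u) v = - bform u (T *v v)) \<longleftrightarrow> transpose T ** Bm = - (Bm ** T)"
    unfolding matrix_eq_iff_inner[of "transpose T ** Bm"]
    by (simp add: bform_eq inner_transpose matrix_vector_mul_assoc
        matrix_vector_mult_diff_rdistrib[of 0, simplified])
  then show ?thesis by (simp add: lin_structure_def)
qed

lemma Ik_blk: "Ik k h = blk 0 (k *\<^sub>R matrix_inv h) h 0"
  by (simp add: vec_sum_eq_iff Ik_def)

text \<open>The action of an isomorphism \<open>M\<close> with inverse \<open>N\<close> on vectors and covectors.\<close>

definition GG :: "real^'m^'m \<Rightarrow> real^'m^'m \<Rightarrow> real^('m::finite + 'm)^('m + 'm)" where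
  "GG M N = blk M 0 0 (transpose N)"

lemma gtrans_GG: "gtrans c d x = GG (jacobian c d x) (jacobian d c x)"
  by (simp add: vec_sum_eq_iff gtrans_def GG_def)

lemma GG_mult: "GG M N ** GG M' N' = GG (M ** M') (N' ** N)"
  by (simp add: GG_def blk_mult matrix_mult_simps transpose_simps)

lemma GG_one: "GG (mat 1) (mat 1) = mat 1"
  by (simp add: GG_def mat_blk[of 1] transpose_simps)

lemma GG_inverse: "M ** N = mat 1 \<Longrightarrow> GG M N ** GG N M = mat 1"
  by (simp add: GG_mult GG_one)

lemma GG_Bm: "M ** N = mat 1 \<Longrightarrow> transpose (GG M N) ** Bm ** GG M N = Bm"
  by (simp add: GG_def Bm_def blk_mult transpose_blk matrix_mult_simps transpose_simps
      matrix_mult_left_right matrix_transpose_mul[symmetric])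

lemma GG_Ik:
  assumes "M ** N = mat 1" "invertible h"
  shows "Ik k (transpose M ** h ** M) = GG N M ** Ik k h ** GG M N"
proof -
  have "(transpose M ** h ** M) ** (N ** matrix_inv h ** transpose N)
      = transpose M ** (h ** (M ** N) ** matrix_inv h) ** transpose N"
    by (simp only: matrix_mul_assoc)
  also have "\<dots> = mat 1"
    using assms matrix_inv_invertible(1)[OF assms(2)] matrix_mult_left_right[OF assms(1)]
    by (simp add: matrix_transpose_mul[symmetric] transpose_mat)
  finally have "matrix_inv (transpose M ** h ** M) = N ** matrix_inv h ** transpose N"
    by (rule matrix_inv_unique)
  then show ?thesis
    by (simp add: Ik_blk GG_def blk_mult matrix_mult_simps)
qed

text \<open>Indexed by \<open>k = - lam * ell\<close> in place of \<open>ell\<close>, because the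
  sign of \<open>k\<close> decides between the complex and the split geometry.\<close>

definition fiber_pred :: "real \<Rightarrow> real \<Rightarrow> real^'m^'m \<Rightarrow> real^('m::finite + 'm)^('m + 'm) \<Rightarrow> bool" where
  "fiber_pred lam k h T \<longleftrightarrow> lin_structure lam T \<and> T ** Ik k h = - (Ik k h ** T)"

definition fiber_pred_sig :: "nat \<Rightarrow> real^'m^'m \<Rightarrow> real^('m::finite + 'm)^('m + 'm) \<Rightarrow> bool" where
  "fiber_pred_sig n h T \<longleftrightarrow> fiber_pred 1 (-1) h T \<and> has_signature (beta_form h T) (2*n) (2*CARD('m) - 2*n)"

section \<open>Naturality of the fiber conditions under isomorphisms\<close>

lemma matrix_conj_mult:
  assumes "G' ** G = (mat 1 :: real^'n^'n)"
  shows "(G ** S ** G') ** (G ** T ** G') = G ** (S ** T) ** G'"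
proof -
  have "(G ** S ** G') ** (G ** T ** G') = G ** S ** (G' ** G) ** T ** G'"
    by (simp only: matrix_mul_assoc)
  then show ?thesis by (simp add: assms matrix_mul_assoc)
qed

lemma isometry_inverse:
  assumes "G' ** G = (mat 1 :: real^'n^'n)" "transpose G ** B ** G = B"
  shows "transpose G ** B = B ** G'" "B ** G = transpose G' ** B" "transpose G' ** B ** G' = B"
proof -
  have GG': "G ** G' = mat 1" by (rule matrix_mult_left_right[OF assms(1)])
  have "transpose G ** B = transpose G ** B ** (G ** G')" by (simp add: GG')
  also have "\<dots> = B ** G'" by (simp only: matrix_mul_assoc assms(2))
  finally show 1: "transpose G ** B = B ** G'" .
  have tr: "transpose G' ** transpose G = mat 1"
    by (simp add: matrix_transpose_mul[symmetric] GG' transpose_mat)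
  have "B ** G = (transpose G' ** transpose G) ** (B ** G)" by (simp add: tr)
  also have "\<dots> = transpose G' ** B" using assms(2) by (simp add: matrix_mul_assoc[symmetric])
  finally show 2: "B ** G = transpose G' ** B" .
  show "transpose G' ** B ** G' = B"
    unfolding 2[symmetric] by (simp add: matrix_mul_assoc[symmetric] GG')
qed

lemma conj_transpose:
  assumes "G' ** G = (mat 1 :: real^'n^'n)" "transpose G ** B ** G = B"
    and "transpose T ** B = x *\<^sub>R (B ** T)"
  shows "transpose (G ** T ** G') ** B = x *\<^sub>R (B ** (G ** T ** G'))"
proof -
  note iso = isometry_inverse[OF assms(1,2)]
  have "transpose (G ** T ** G') ** B = transpose G' ** transpose T ** (transpose G ** B)"
    by (simp only: matrix_transpose_mul matrix_mul_assoc)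
  also have "\<dots> = transpose G' ** (transpose T ** B) ** G'"
    by (simp only: iso(1) matrix_mul_assoc)
  also have "\<dots> = x *\<^sub>R ((transpose G' ** B) ** T ** G')"
    by (simp add: assms(3) matrix_mult_simps matrix_mul_assoc)
  also have "\<dots> = x *\<^sub>R (B ** (G ** T ** G'))"
    by (simp only: iso(2)[symmetric] matrix_mul_assoc)
  finally show ?thesis .
qed

lemma trace_conj: "G' ** G = (mat 1 :: real^'n^'n) \<Longrightarrow> trace (G ** T ** G') = trace T"
  by (metis matrix_mul_assoc matrix_mul_lid trace_mul_sym)

lemma lin_structure_conj:
  fixes G :: "real^('m::finite + 'm)^('m + 'm)"
  assumes "G' ** G = mat 1" "transpose G ** Bm ** G = Bm" "lin_structure lam T"
  shows "lin_structure lam (G ** T ** G')"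
proof -
  have GG': "G ** G' = mat 1" by (rule matrix_mult_left_right[OF assms(1)])
  have "(G ** T ** G') ** (G ** T ** G') = mat lam"
    using assms(3) GG' unfolding matrix_conj_mult[OF assms(1)] lin_structure_iff
    by (simp add: mat_scaleR[of lam] matrix_mult_simps)
  then show ?thesis
    using assms(3) trace_conj[OF assms(1)] conj_transpose[OF assms(1,2), of T "- 1"]
    unfolding lin_structure_iff by simp
qed

lemma anticommute_conj:
  assumes "G' ** G = (mat 1 :: real^'n^'n)" "T ** I = - (I ** T)"
  shows "(G ** T ** G') ** (G ** I ** G') = - ((G ** I ** G') ** (G ** T ** G'))"
  by (simp add: matrix_conj_mult[OF assms(1)] assms(2) matrix_mult_simps)

lemma has_signature_congruence:
  fixes C G :: "real^'n^'n"
  assumes "G' ** G = mat 1" "has_signature (\<lambda>u v. u \<bullet> (C *v v)) p q"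
  shows "has_signature (\<lambda>u v. u \<bullet> ((transpose G ** C ** G) *v v)) p q"
proof -
  have "has_signature (\<lambda>u v. (G *v u) \<bullet> (C *v (G *v v))) p q"
    by (rule has_signature_transport[OF assms(2) matrix_vector_mul_linear matrix_vector_mul_linear[of G']])
      (simp_all add: matrix_vector_mul_assoc assms(1) matrix_mult_left_right[OF assms(1)])
  then show ?thesis by (simp add: inner_transpose matrix_vector_mul_assoc matrix_mul_assoc)
qed

lemma beta_form_eq: "beta_form h T = (\<lambda>u v. u \<bullet> ((transpose (T ** Ik (-1) h) ** Bm) *v v))"
  by (simp add: fun_eq_iff beta_form_def bform_eq inner_transpose matrix_vector_mul_assoc)

text \<open>Conjugation by \<open>GG M N\<close> preserves \<open>b\<close> and carries
  \<open>Ik k\<close> of the pulled back metric to \<open>Ik k\<close> of \<open>h\<close>. The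
  converse will be this same implication for the inverse pair \<open>N\<close>,
  \<open>M\<close>.\<close>

lemma fiber_pred_natural1:
  assumes MN: "M ** N = mat 1" and h: "invertible h" and T: "fiber_pred lam k (transpose M ** h ** M) T"
  shows "fiber_pred lam k h (GG M N ** T ** GG N M)"
proof -
  have inv: "GG N M ** GG M N = mat 1" by (rule GG_inverse[OF matrix_mult_left_right[OF MN]])
  have "GG M N ** Ik k (transpose M ** h ** M) ** GG N M
      = (GG M N ** GG N M) ** Ik k h ** (GG M N ** GG N M)"
    unfolding GG_Ik[OF MN h] by (simp only: matrix_mul_assoc)
  then have "GG M N ** Ik k (transpose M ** h ** M) ** GG N M = Ik k h"
    by (simp add: GG_inverse[OF MN])
  then show ?thesis
    using anticommute_conj[OF inv, of T "Ik k (transpose M ** h ** M)"] T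
      lin_structure_conj[OF inv GG_Bm[OF MN]]
    unfolding fiber_pred_def by simp
qed

lemma congruence_back:
  fixes h M :: "real^'n^'n"
  assumes "M ** N = mat 1"
  shows "transpose N ** (transpose M ** h ** M) ** N = h"
proof -
  have "transpose N ** (transpose M ** h ** M) ** N = transpose (M ** N) ** h ** (M ** N)"
    by (simp only: matrix_transpose_mul matrix_mul_assoc)
  then show ?thesis by (simp add: assms transpose_mat)
qed

lemma invertible_congruence:
  fixes h M :: "real^'n^'n"
  assumes "M ** N = mat 1" "invertible h"
  shows "invertible (transpose M ** h ** M)"
  using assms matrix_mult_left_right[OF assms(1)]
  by (metis invertible_def invertible_mult transpose_invertible)

lemma GG_conj_back:
  assumes "M ** N = mat 1"
  shows "GG N M ** (GG M N ** T ** GG N M) ** GG M N = T"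
proof -
  have "GG N M ** (GG M N ** T ** GG N M) ** GG M N = (GG N M ** GG M N) ** T ** (GG N M ** GG M N)"
    by (simp only: matrix_mul_assoc)
  then show ?thesis by (simp add: GG_inverse[OF matrix_mult_left_right[OF assms]])
qed

text \<open>This serves twice: with \<open>M\<close> a Jacobian it makes the fiber independent of
  the chart, with \<open>M\<close> an orthonormal frame it moves the fiber to the model metric
  \<open>eta p\<close>.\<close>

lemma fiber_pred_natural:
  assumes MN: "M ** N = mat 1" and h: "invertible h"
  shows "fiber_pred lam k (transpose M ** h ** M) T \<longleftrightarrow> fiber_pred lam k h (GG M N ** T ** GG N M)"
  using fiber_pred_natural1[OF MN h]
    fiber_pred_natural1[OF matrix_mult_left_right[OF MN] invertible_congruence[OF MN h],
      of lam k "GG M N ** T ** GG N M"]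
  unfolding congruence_back[OF MN] GG_conj_back[OF MN] by blast

lemma fiber_pred_sig_natural1:
  assumes MN: "M ** N = mat 1" and h: "invertible h" and T: "fiber_pred_sig n (transpose M ** h ** M) T"
  shows "fiber_pred_sig n h (GG M N ** T ** GG N M)"
proof -
  let ?G = "GG M N" and ?G' = "GG N M"
  have inv: "?G ** ?G' = mat 1" by (rule GG_inverse[OF MN])
  have inv': "?G' ** ?G = mat 1" by (rule GG_inverse[OF matrix_mult_left_right[OF MN]])
  note iso = isometry_inverse[OF inv' GG_Bm[OF MN]]
  have "transpose ?G' ** (transpose (T ** Ik (-1) (transpose M ** h ** M)) ** Bm) ** ?G'
      = transpose ?G' ** (transpose ?G ** transpose (Ik (-1) h) ** transpose ?G' ** transpose T ** Bm) ** ?G'"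
    unfolding GG_Ik[OF MN h] by (simp only: matrix_transpose_mul matrix_mul_assoc)
  also have "\<dots> = transpose (?G ** ?G') ** transpose (Ik (-1) h) ** transpose ?G' ** transpose T ** (Bm ** ?G')"
    by (simp only: matrix_transpose_mul matrix_mul_assoc)
  also have "\<dots> = transpose (?G ** T ** ?G' ** Ik (-1) h) ** Bm"
    by (simp add: inv transpose_mat iso(1)[symmetric] matrix_transpose_mul matrix_mul_assoc)
  finally have eq: "transpose ?G' ** (transpose (T ** Ik (-1) (transpose M ** h ** M)) ** Bm) ** ?G'
      = transpose (?G ** T ** ?G' ** Ik (-1) h) ** Bm" .
  show ?thesis
    using T fiber_pred_natural1[OF MN h] has_signature_congruence[OF inv]
    unfolding fiber_pred_sig_def beta_form_eq eq[symmetric] by blast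
qed

lemma fiber_pred_sig_natural:
  assumes MN: "M ** N = mat 1" and h: "invertible h"
  shows "fiber_pred_sig n (transpose M ** h ** M) T \<longleftrightarrow> fiber_pred_sig n h (GG M N ** T ** GG N M)"
  using fiber_pred_sig_natural1[OF MN h]
    fiber_pred_sig_natural1[OF matrix_mult_left_right[OF MN] invertible_congruence[OF MN h],
      of n "GG M N ** T ** GG N M"]
  unfolding congruence_back[OF MN] GG_conj_back[OF MN] by blast

section \<open>Orthonormal frames\<close>

text \<open>Polarization: if \<open>B w w\<close> vanished for all \<open>w\<close> in
  \<open>V\<close>, expanding \<open>B (u + v) (u + v)\<close> would give
  \<open>B u v = 0\<close>.\<close>

lemma ex_nonisotropic:
  fixes B :: "'v::euclidean_space \<Rightarrow> 'v \<Rightarrow> real"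
  assumes "bilinear B" "\<And>u v. B u v = B v u" "subspace V" "u \<in> V" "v \<in> V" "B u v \<noteq> 0"
  shows "\<exists>w\<in>V. B w w \<noteq> 0"
proof (rule ccontr)
  assume "\<not> ?thesis"
  then have 0: "B w w = 0" if "w \<in> V" for w using that by blast
  have "B (u + v) (u + v) = B u u + 2 * B u v + B v v"
    using assms(2)[of v u] by (simp add: bilinear_ladd[OF assms(1)] bilinear_radd[OF assms(1)])
  then show False using 0 subspace_add[OF assms(3-5)] assms(4-6) by simp
qed

section \<open>Enumeration of the coordinates and the diagonal form \<open>eta\<close>\<close>

lemma bij_pos: "bij_betw (pos :: 'm::finite \<Rightarrow> nat) UNIV {..<CARD('m)}"
  unfolding pos_def by (rule to_nat_on_finite) simp

lemma pos_less: "pos (i :: 'm::finite) < CARD('m)"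
  using bij_betwE[OF bij_pos] by auto

lemma idx_pos: "idx (pos i) = i"
  unfolding pos_def idx_def by (simp add: from_nat_into_to_nat_on countable_finite)

lemma pos_idx: "k < CARD('m::finite) \<Longrightarrow> pos (idx k :: 'm) = k"
  using bij_pos[where 'm='m] idx_pos by (metis bij_betw_def imageE lessThan_iff)

lemma pos_eq_iff: "pos i = pos j \<longleftrightarrow> i = j"
  by (metis idx_pos)

lemma card_pos_less:
  assumes "n \<le> CARD('m::finite)"
  shows "card {i :: 'm. pos i < n} = n"
proof -
  have "bij_betw pos {i :: 'm. pos i < n} {..<n}"
    unfolding bij_betw_def
  proof
    show "inj_on pos {i :: 'm. pos i < n}" by (simp add: inj_on_def pos_eq_iff)
    show "pos ` {i :: 'm. pos i < n} = {..<n}"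
    proof (intro equalityI subsetI)
      fix k assume k: "k \<in> {..<n}"
      then have "pos (idx k :: 'm) = k" using assms by (intro pos_idx) simp
      then show "k \<in> pos ` {i :: 'm. pos i < n}" using k by (intro image_eqI[of _ _ "idx k"]) simp_all
    qed auto
  qed
  from bij_betw_same_card[OF this] show ?thesis by simp
qed

text \<open>Orthogonalization returns positive and negative vectors in arbitrary order, whereas
  \<open>eta p\<close> expects the positive ones at the positions below \<open>p\<close>; this
  reordering bridges the two.\<close>

lemma ex_enumeration:
  assumes "card {i. i < CARD('m::finite) \<and> Q i} = p"
  shows "\<exists>e. bij_betw e (UNIV :: 'm set) {..<CARD('m)} \<and> (\<forall>i. pos i < p \<longleftrightarrow> Q (e i))"
proof -
  let ?A = "{i. i < CARD('m) \<and> Q i}" and ?B = "{i. i < CARD('m) \<and> \<not> Q i}"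
  have "card ?A \<le> card {..<CARD('m)}" by (rule card_mono) auto
  then have p: "p \<le> CARD('m)" using assms by simp
  note card1 = card_pos_less[OF p]
  have card2: "card {i :: 'm. \<not> pos i < p} = CARD('m) - p"
    using card_Diff_subset[of "{i :: 'm. pos i < p}" UNIV] card1 by (simp add: Compl_eq_Diff_UNIV[symmetric] Collect_neg_eq)
  have card3: "card ?B = CARD('m) - p"
  proof -
    have "?B = {..<CARD('m)} - ?A" by auto
    then show ?thesis using assms card_Diff_subset[of ?A "{..<CARD('m)}"] by auto
  qed
  obtain f where f: "bij_betw f {i :: 'm. pos i < p} ?A"
    using finite_same_card_bij[of "{i :: 'm. pos i < p}" ?A] card1 assms by auto
  obtain f' where f': "bij_betw f' {i :: 'm. \<not> pos i < p} ?B"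
    using finite_same_card_bij[of "{i :: 'm. \<not> pos i < p}" ?B] card2 card3 by auto
  define e where "e i = (if i \<in> {i. pos i < p} then f i else f' i)" for i
  have "bij_betw e ({i. pos i < p} \<union> {i. \<not> pos i < p}) (?A \<union> ?B)"
    unfolding e_def by (rule bij_betw_disjoint_Un[OF f f']) auto
  moreover have "{i :: 'm. pos i < p} \<union> {i. \<not> pos i < p} = UNIV" "?A \<union> ?B = {..<CARD('m)}" by auto
  ultimately have "bij_betw e UNIV {..<CARD('m)}" by simp
  moreover have "pos i < p \<longleftrightarrow> Q (e i)" for i
    using bij_betwE[OF f] bij_betwE[OF f'] by (auto simp: e_def)
  ultimately show ?thesis by blast
qed

definition eta :: "nat \<Rightarrow> real^'m::finite^'m" where
  "eta p = (\<chi> i j. if i = j then (if pos i < p then 1 else - 1) else 0)"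

lemma eta_mult_vector: "eta p *v v = (\<chi> i. (if pos i < p then 1 else - 1) * v $ i)"
  by (simp add: vec_eq_iff matrix_vector_mult_def eta_def if_distrib[of "\<lambda>x. x * _"] cong: if_cong)

lemma eta_mult_eta: "eta p ** eta p = mat 1"
  by (simp add: matrix_eq matrix_vector_mul_assoc[symmetric] eta_mult_vector vec_eq_iff matrix_vector_mul_lid)

lemma transpose_eta: "transpose (eta p) = eta p"
  by (auto simp: vec_eq_iff transpose_def eta_def)

lemma std_form_eq: "std_form p u v = u \<bullet> (eta p *v v)"
  by (simp add: std_form_def inner_vec_def eta_mult_vector mult_ac)

lemma bilinear_matrix: "bilinear (\<lambda>u v. u \<bullet> ((C :: real^'n^'n) *v v))"
  by (simp add: bilinear_def linear_iff inner_add_left inner_add_right matrix_vector_right_distrib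
      matrix_vector_mult_scaleR)

lemma has_signature_matrix:
  fixes h :: "real^'n^'n"
  assumes "has_signature (\<lambda>u v. u \<bullet> (h *v v)) p q"
  shows "transpose h = h" "invertible h"
proof -
  show "transpose h = h"
    unfolding matrix_eq_iff_inner using assms
    by (metis (no_types, lifting) has_signature_def inner_commute inner_transpose)
  have "x = 0" if "h *v x = 0" for x
  proof (rule has_signature_nondegenerate[OF assms])
    show "x \<bullet> (h *v v) = 0" for v
      using assms that by (metis (no_types, lifting) has_signature_def inner_zero_right)
  qed
  then show "invertible h"
    using matrix_left_invertible_ker invertible_left_inverse by blast
qed

text \<open>\<open>adapted_frame\<close> with the identity as the only operator yields vectors of
  square 1 or -1. The law of inertia shows that \<open>p\<close> of them are positive, and
  \<open>ex_enumeration\<close> puts these first.\<close>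

lemma orthonormal_frame:
  fixes h :: "real^'m^'m"
  assumes h: "has_signature (\<lambda>u v. u \<bullet> (h *v v)) p q"
  obtains E :: "real^'m^'m" where "transpose E ** h ** E = eta p"
proof -
  define B where "B = (\<lambda>u v. u \<bullet> (h *v v))"
  have bil: "bilinear B" and sym: "\<And>u v. B u v = B v u"
    using h unfolding has_signature_def B_def by blast+
  define good where "good z \<longleftrightarrow> B z z = 1 \<or> B z z = - 1" for z
  have "\<exists>n z. 1 * n = DIM(real^'m) \<and> (\<forall>i<n. good (z i)) \<and> (\<forall>i<n. \<forall>j<n. \<forall>a<1::nat. \<forall>b<1::nat.
      B (z i) (z j) = (if i = j \<and> a = b then 1 * B (z i) (z i) else 0))"
  proof (rule adapted_frame[where B=B and r=1 and Op="\<lambda>_ z. z" and Cl="{\<lambda>z. z}" and eps="\<lambda>_. 1"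
        and good=good and s="\<lambda>z. B z z", OF bil sym])
    show "u = 0" if "\<And>v. B u v = 0" for u
      using has_signature_nondegenerate[OF h] that unfolding B_def by blast
    show "\<exists>z\<in>V. good z" if V: "subspace V" "V \<noteq> {0}" "\<And>u. u \<in> V \<Longrightarrow> (\<And>v. v \<in> V \<Longrightarrow> B u v = 0) \<Longrightarrow> u = 0"
      for V
    proof -
      obtain u where u: "u \<in> V" "u \<noteq> 0" using V(1,2) subspace_0 by blast
      then obtain v where v: "v \<in> V" "B u v \<noteq> 0" using V(3) by blast
      obtain w where w: "w \<in> V" "B w w \<noteq> 0"
        using ex_nonisotropic[OF bil sym V(1) u(1) v] by blast
      define z where "z = (1 / sqrt \<bar>B w w\<bar>) *\<^sub>R w"
      have "B z z = B w w / \<bar>B w w\<bar>"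
        by (simp add: z_def bilinear_lmul[OF bil] bilinear_rmul[OF bil])
      then have "good z" using w(2) by (simp add: good_def abs_if)
      moreover have "z \<in> V" unfolding z_def by (rule subspace_scale[OF V(1) w(1)])
      ultimately show ?thesis by blast
    qed
  qed (auto simp: good_def)
  then obtain n z where nz: "n = DIM(real^'m)" "\<And>i. i < n \<Longrightarrow> good (z i)"
    "\<And>i j a b. i < n \<Longrightarrow> j < n \<Longrightarrow> B (z i) (z j) = (if i = j then B (z i) (z i) else 0)"
    by (simp only: less_one mult_1) (metis)
  have n: "n = CARD('m)" using nz(1) by simp
  have orth: "B (z i) (z j) = (if i = j then B (z i) (z i) else 0)" if "i < n" "j < n" for i j
    by (rule nz(3)[OF that])
  have "has_signature B (card {i \<in> {..<n}. B (z i) (z i) > 0}) (card {i \<in> {..<n}. B (z i) (z i) < 0})"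
  proof (rule has_signature_orthogonal_basis[where e=z, OF bil sym])
    show "B (z i) (z i) \<noteq> 0" if "i \<in> {..<n}" for i using nz(2)[of i] that by (auto simp: good_def)
    show "B (z i) (z j) = (if i = j then B (z i) (z i) else 0)" if "i \<in> {..<n}" "j \<in> {..<n}" for i j
      using orth[of i j] that by blast
  qed (simp_all add: n)
  then have "card {i. i < CARD('m) \<and> B (z i) (z i) > 0} = p"
    using has_signature_unique(1)[OF _ h[folded B_def]] n by simp
  then obtain e where e: "bij_betw e (UNIV :: 'm set) {..<CARD('m)}" "\<And>i. pos i < p \<longleftrightarrow> B (z (e i)) (z (e i)) > 0"
    using ex_enumeration[where 'm='m and Q="\<lambda>i. B (z i) (z i) > 0" and p=p] by blast
  have en: "e i < n" for i using bij_betwE[OF e(1)] n by simp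
  have ee: "e i = e j \<longleftrightarrow> i = j" for i j using e(1) by (auto simp: bij_betw_def inj_eq)
  define E where "E = (\<chi> i j. z (e j) $ i)"
  have "(transpose E ** h ** E) $ i $ j = z (e i) \<bullet> (h *v z (e j))" for i j
    by (simp add: E_def matrix_matrix_mult_def transpose_def inner_vec_def matrix_vector_mult_def
        sum_distrib_left sum_distrib_right mult.assoc) (rule sum.swap)
  also have "\<dots> i j = eta p $ i $ j" for i j
    using orth[OF en en, of i j] nz(2)[OF en[of i]] e(2)[of i]
    by (auto simp: B_def[symmetric, THEN fun_cong, THEN fun_cong] ee eta_def good_def)
  finally have "transpose E ** h ** E = eta p" by (simp add: vec_eq_iff)
  then show ?thesis by (rule that)
qed

text \<open>A constant frame \<open>E0\<close> that is orthonormal at \<open>x\<close> has the Gram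
  matrix \<open>eta p ** w y\<close> at \<open>y\<close>, with \<open>w x = mat 1\<close>. Since
  Gram matrices are symmetric, \<open>eta p\<close> intertwines \<open>transpose (w y)\<close> with
  \<open>w y\<close>, hence also their inverse square roots; so correcting \<open>E0\<close> by
  \<open>r (w y)\<close> changes the Gram matrix to
  \<open>eta p ** (r (w y) ** w y ** r (w y)) = eta p\<close>.\<close>

lemma local_orthonormal_frame:
  fixes h :: "'u::euclidean_space \<Rightarrow> real^'m^'m"
  assumes V: "open V" "x \<in> V" and h: "smooth_on V h"
    and sig: "\<And>y. y \<in> V \<Longrightarrow> has_signature (\<lambda>u v. u \<bullet> (h y *v v)) p q"
  obtains W and E :: "'u \<Rightarrow> real^'m^'m" where "open W" "x \<in> W" "W \<subseteq> V" "smooth_on W E"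
    "\<And>y. y \<in> W \<Longrightarrow> transpose (E y) ** h y ** E y = eta p"
proof -
  obtain E0 :: "real^'m^'m" where E0: "transpose E0 ** h x ** E0 = eta p"
    by (rule orthonormal_frame[OF sig[OF V(2)]])
  obtain W' and r :: "real^'m^'m \<Rightarrow> real^'m^'m" where W': "open W'" "mat 1 \<in> W'" and r: "smooth_on W' r"
    and tr: "\<And>w. w \<in> W' \<Longrightarrow> transpose w \<in> W'"
    and rr: "\<And>w. w \<in> W' \<Longrightarrow> r w ** w ** r w = (mat 1 :: real^'m^'m)"
    and rt: "\<And>w. w \<in> W' \<Longrightarrow> r (transpose w) = transpose (r w)"
    and rc: "\<And>w w' C. w \<in> W' \<Longrightarrow> w' \<in> W' \<Longrightarrow> w ** C = C ** w' \<Longrightarrow> r w ** C = C ** r w'"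
  proof (rule matrix_inverse_sqrt_near_identity[where 'n='m], goal_cases)
    case (1 W r)
    show ?thesis using 1(2-) by (rule that)
  qed
  define w where "w y = eta p ** (transpose E0 ** h y ** E0)" for y
  have w: "smooth_on V w"
    unfolding w_def by (intro smooth_on_matrix_mult V(1) h smooth_on_const)
  define W where "W = V \<inter> w -` W'"
  have W: "open W" unfolding W_def
    by (rule continuous_open_preimage[OF smooth_on_continuous_on[OF w] V(1) W'(1)])
  have xW: "x \<in> W" using W'(2) V(2) by (simp add: W_def w_def E0 eta_mult_eta)
  have "smooth_on W (\<lambda>y. E0 ** r (w y))"
    by (intro smooth_on_matrix_mult W smooth_on_const smooth_on_compose[OF W W'(1) r] smooth_on_subset[OF w])
      (auto simp: W_def)
  moreover have "transpose (E0 ** r (w y)) ** h y ** (E0 ** r (w y)) = eta p" if y: "y \<in> W" for y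
  proof -
    have wy: "w y \<in> W'" using y by (simp add: W_def)
    have hy: "transpose (h y) = h y" using has_signature_matrix(1)[OF sig] y by (simp add: W_def)
    have ew: "eta p ** w y = transpose E0 ** h y ** E0"
      by (simp add: w_def matrix_mul_assoc eta_mult_eta)
    then have "transpose (w y) ** eta p = eta p ** w y"
      by (metis hy matrix_transpose_mul matrix_mul_assoc transpose_eta transpose_transpose)
    then have "transpose (r (w y)) ** eta p = eta p ** r (w y)"
      using rc[OF tr[OF wy] wy] rt[OF wy] by metis
    then have "transpose (r (w y)) ** (eta p ** w y) ** r (w y) = eta p ** (r (w y) ** w y ** r (w y))"
      by (simp add: matrix_mul_assoc)
    then show ?thesis by (simp add: ew rr[OF wy] matrix_transpose_mul matrix_mul_assoc)
  qed
  ultimately show ?thesis using that[of W] W xW by (simp add: W_def)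
qed

section \<open>Charts\<close>

lemma smooth_atlasD:
  assumes "smooth_atlas A" "c \<in> A"
  shows "open (cdom c)" "open (cmap c ` cdom c)"
    and "homeomorphism (cdom c) (cmap c ` cdom c) (cmap c) (cinv c)"
    and "d \<in> A \<Longrightarrow> smooth_on (cmap c ` (cdom c \<inter> cdom d)) (cmap d \<circ> cinv c)"
  using assms unfolding smooth_atlas_def by blast+

lemma chart_inverse:
  assumes "smooth_atlas A" "c \<in> A"
  shows "x \<in> cdom c \<Longrightarrow> cinv c (cmap c x) = x"
    and "y \<in> cmap c ` cdom c \<Longrightarrow> cmap c (cinv c y) = y"
    and "y \<in> cmap c ` cdom c \<Longrightarrow> cinv c y \<in> cdom c"
  using smooth_atlasD(3)[OF assms] unfolding homeomorphism_def by auto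

lemma open_chart_image:
  assumes "smooth_atlas A" "c \<in> A" "open U"
  shows "open (cmap c ` (U \<inter> cdom c))"
proof -
  have "openin (top_of_set (cmap c ` cdom c)) (cmap c ` (U \<inter> cdom c))"
    by (rule homeomorphism_imp_open_map[OF smooth_atlasD(3)[OF assms(1,2)]])
      (metis Int_commute assms(3) openin_open)
  then show ?thesis using smooth_atlasD(2)[OF assms(1,2)] openin_open_trans by blast
qed

lemma open_chart_vimage:
  assumes "smooth_atlas A" "c \<in> A" "open W"
  shows "open (cdom c \<inter> cmap c -` W)"
  using smooth_atlasD(1,3)[OF assms(1,2)] assms(3)
  by (intro continuous_open_preimage) (auto simp: homeomorphism_def)

abbreviation transition :: "('a, 'm::finite) chart \<Rightarrow> ('a, 'm) chart \<Rightarrow> real^'m \<Rightarrow> real^'m" where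
  "transition c d \<equiv> cmap d \<circ> cinv c"

lemma transition_has_derivative:
  assumes "smooth_atlas A" "c \<in> charts_at A x" "d \<in> charts_at A x"
  shows "(transition c d has_derivative (\<lambda>v. jacobian c d x *v v)) (at (cmap c x))"
proof -
  have "(transition c d has_derivative frechet_derivative (transition c d) (at (cmap c x))) (at (cmap c x))"
    using assms by (intro smooth_on_has_derivative[OF smooth_atlasD(4)[where A=A and d=d]])
      (auto simp: charts_at_def)
  then show ?thesis
    unfolding jacobian_def by (simp add: matrix_works has_derivative_linear)
qed

lemma jacobian_unique:
  assumes "smooth_atlas A" "c \<in> charts_at A x" "d \<in> charts_at A x"
    and "(transition c d has_derivative (\<lambda>v. M *v v)) (at (cmap c x))"
  shows "jacobian c d x = M"
  using has_derivative_unique[OF transition_has_derivative[OF assms(1-3)] assms(4)]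
  by (simp add: matrix_eq fun_eq_iff)

lemma jacobian_self:
  assumes "smooth_atlas A" "c \<in> charts_at A x"
  shows "jacobian c c x = mat 1"
proof (rule jacobian_unique[OF assms(1,2,2)])
  have c: "c \<in> A" "x \<in> cdom c" using assms by (auto simp: charts_at_def)
  have "((\<lambda>y. y) has_derivative (\<lambda>v. mat 1 *v v)) (at (cmap c x))"
    by (simp add: matrix_vector_mul_lid)
  then show "(transition c c has_derivative (\<lambda>v. mat 1 *v v)) (at (cmap c x))"
    by (rule has_derivative_transform_within_open[OF _ smooth_atlasD(2)[OF assms(1) c(1)]])
      (use c chart_inverse(2)[OF assms(1) c(1)] in auto)
qed

lemma jacobian_mult:
  assumes "smooth_atlas A" "c \<in> charts_at A x" "d \<in> charts_at A x" "e \<in> charts_at A x"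
  shows "jacobian d e x ** jacobian c d x = jacobian c e x"
proof (rule jacobian_unique[OF assms(1,2,4), symmetric])
  have c: "c \<in> A" "x \<in> cdom c" and d: "d \<in> A" "x \<in> cdom d"
    using assms by (auto simp: charts_at_def)
  have x: "transition c d (cmap c x) = cmap d x" using chart_inverse(1)[OF assms(1) c] by simp
  have "((\<lambda>y. transition d e (transition c d y)) has_derivative
      (\<lambda>v. jacobian d e x *v (jacobian c d x *v v))) (at (cmap c x))"
    using has_derivative_compose[OF transition_has_derivative[OF assms(1-3)],
        of "transition d e" "\<lambda>v. jacobian d e x *v v"]
      transition_has_derivative[OF assms(1,3,4)] unfolding x by blast
  then have "((\<lambda>y. transition d e (transition c d y)) has_derivative
      (\<lambda>v. (jacobian d e x ** jacobian c d x) *v v)) (at (cmap c x))"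
    by (simp add: matrix_vector_mul_assoc)
  then show "(transition c e has_derivative (\<lambda>v. (jacobian d e x ** jacobian c d x) *v v)) (at (cmap c x))"
  proof (rule has_derivative_transform_within_open)
    show "open (cmap c ` (cdom d \<inter> cdom c))"
      by (rule open_chart_image[OF assms(1) c(1) smooth_atlasD(1)[OF assms(1) d(1)]])
    show "cmap c x \<in> cmap c ` (cdom d \<inter> cdom c)" using c d by blast
    show "transition d e (transition c d y) = transition c e y" if "y \<in> cmap c ` (cdom d \<inter> cdom c)" for y
      using that chart_inverse(1)[OF assms(1) c(1)] chart_inverse(1)[OF assms(1) d(1)] by auto
  qed
qed

lemma jacobian_inverse:
  assumes "smooth_atlas A" "c \<in> charts_at A x" "d \<in> charts_at A x"
  shows "jacobian c d x ** jacobian d c x = mat 1"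
  using jacobian_mult[OF assms(1,3,2,3)] jacobian_self[OF assms(1,3)] by simp

lemma gtrans_mult:
  assumes "smooth_atlas A" "c \<in> charts_at A x" "d \<in> charts_at A x" "e \<in> charts_at A x"
  shows "gtrans d e x ** gtrans c d x = gtrans c e x"
  using jacobian_mult[OF assms] jacobian_mult[OF assms(1,4,3,2)] by (simp add: gtrans_GG GG_mult)

lemma gtrans_self:
  assumes "smooth_atlas A" "c \<in> charts_at A x"
  shows "gtrans c c x = mat 1"
  by (simp add: gtrans_GG jacobian_self[OF assms] GG_one)

lemma smooth_on_matrix:
  fixes D :: "'u::real_normed_vector \<Rightarrow> real^'n \<Rightarrow> real^'k"
  assumes "open S" "\<And>v. smooth_on S (\<lambda>x. D x v)"
  shows "smooth_on S (\<lambda>x. matrix (D x))"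
proof -
  have "bounded_linear (\<lambda>v :: real^'k. (\<chi> i l. if l = j then v $ i else 0) :: real^'n^'k)" for j
    by (rule bounded_linearI') (simp_all add: vec_eq_iff)
  then have "smooth_on S (\<lambda>x. \<Sum>j\<in>UNIV. (\<chi> i l. if l = j then D x (axis j 1) $ i else 0) :: real^'n^'k)"
    by (intro smooth_on_sum[OF assms(1)] smooth_on_bounded_linear_comp[where
        L="\<lambda>v :: real^'k. (\<chi> i l. if l = j then v $ i else 0) :: real^'n^'k" for j, OF _ assms(1)] assms(2))
  then show ?thesis
    by (rule smooth_on_cong[OF assms(1), rotated]) (simp add: matrix_def vec_eq_iff)
qed

lemma smooth_on_jacobian:
  assumes A: "smooth_atlas A" and c: "c \<in> A" and d: "d \<in> A"
  shows "smooth_on (cmap c ` (cdom d \<inter> cdom c)) (\<lambda>y. jacobian c d (cinv c y))"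
    and "smooth_on (cmap c ` (cdom d \<inter> cdom c)) (\<lambda>y. jacobian d c (cinv c y))"
proof -
  let ?S = "cmap c ` (cdom d \<inter> cdom c)" and ?S' = "cmap d ` (cdom c \<inter> cdom d)"
  have S: "open ?S" "open ?S'"
    using open_chart_image[OF A c] open_chart_image[OF A d] smooth_atlasD(1)[OF A] c d by blast+
  have t: "smooth_on ?S (transition c d)" "smooth_on ?S' (transition d c)"
    using smooth_atlasD(4)[OF A c d] smooth_atlasD(4)[OF A d c] by (simp_all add: Int_commute)
  have "smooth_on ?S (\<lambda>y. matrix (frechet_derivative (transition c d) (at y)))"
    by (intro smooth_on_matrix S smooth_on_frechet_derivative t)
  then show "smooth_on ?S (\<lambda>y. jacobian c d (cinv c y))"
    by (rule smooth_on_cong[OF S(1), rotated]) (use chart_inverse(1)[OF A c] in \<open>auto simp: jacobian_def\<close>)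
  have "smooth_on ?S' (\<lambda>y. matrix (frechet_derivative (transition d c) (at y)))"
    by (intro smooth_on_matrix S smooth_on_frechet_derivative t)
  then have "smooth_on ?S (\<lambda>y. matrix (frechet_derivative (transition d c) (at (transition c d y))))"
    by (rule smooth_on_compose[OF S _ t(1)]) (use chart_inverse(1)[OF A c] in auto)
  then show "smooth_on ?S (\<lambda>y. jacobian d c (cinv c y))"
    by (rule smooth_on_cong[OF S(1), rotated]) (use chart_inverse(1)[OF A c] in \<open>auto simp: jacobian_def\<close>)
qed

lemma smooth_on_GG:
  assumes "open S" "smooth_on S f" "smooth_on S g"
  shows "smooth_on S (\<lambda>x. GG (f x) (g x))"
  unfolding GG_def by (intro smooth_on_blk smooth_on_const smooth_on_transpose assms)

lemma smooth_on_gtrans: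
  assumes A: "smooth_atlas A" and c: "c \<in> A" and d: "d \<in> A"
  shows "smooth_on (cmap c ` (cdom d \<inter> cdom c)) (\<lambda>y. gtrans c d (cinv c y))"
    and "smooth_on (cmap c ` (cdom d \<inter> cdom c)) (\<lambda>y. gtrans d c (cinv c y))"
  unfolding gtrans_GG
  by (intro smooth_on_GG smooth_on_jacobian[OF assms] open_chart_image[OF A c] smooth_atlasD(1)[OF A d])+

lemma gEndD:
  "S \<in> gEnd A x \<Longrightarrow> c \<in> charts_at A x \<Longrightarrow> d \<in> charts_at A x \<Longrightarrow>
    S d = gtrans c d x ** S c ** gtrans d c x"
  "S \<in> gEnd A x \<Longrightarrow> c \<notin> charts_at A x \<Longrightarrow> S c = 0"
  unfolding gEnd_def by blast+

lemma bilinear_formsD: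
  "h \<in> bilinear_forms A x \<Longrightarrow> c \<in> charts_at A x \<Longrightarrow> d \<in> charts_at A x \<Longrightarrow>
    h c = transpose (jacobian c d x) ** h d ** jacobian c d x"
  unfolding bilinear_forms_def by blast

text \<open>The inverse of evaluation at the chart \<open>c\<close>, which identifies
  \<open>gEnd A x\<close> with the space of all matrices.\<close>

definition gend_of :: "('a, 'm::finite) chart set \<Rightarrow> ('a, 'm) chart \<Rightarrow> 'a \<Rightarrow> real^('m + 'm)^('m + 'm) \<Rightarrow> ('a, 'm) gend" where
  "gend_of A c x T = (\<lambda>d. if d \<in> charts_at A x then gtrans c d x ** T ** gtrans d c x else 0)"

lemma gend_of_in_gEnd:
  assumes A: "smooth_atlas A" and c: "c \<in> charts_at A x"
  shows "gend_of A c x T \<in> gEnd A x" "gend_of A c x T c = T"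
proof -
  have eq: "gtrans c e x ** T ** gtrans e c x = gtrans d e x ** (gtrans c d x ** T ** gtrans d c x) ** gtrans e d x"
    if "d \<in> charts_at A x" "e \<in> charts_at A x" for d e
  proof -
    have "gtrans d e x ** (gtrans c d x ** T ** gtrans d c x) ** gtrans e d x
        = (gtrans d e x ** gtrans c d x) ** T ** (gtrans d c x ** gtrans e d x)"
      by (simp only: matrix_mul_assoc)
    then show ?thesis using gtrans_mult[OF A c that] gtrans_mult[OF A that(2,1) c] by simp
  qed
  show "gend_of A c x T \<in> gEnd A x"
    unfolding gEnd_def
  proof (intro CollectI conjI ballI allI impI)
    fix d e assume de: "d \<in> charts_at A x" "e \<in> charts_at A x"
    show "gend_of A c x T e = gtrans d e x ** gend_of A c x T d ** gtrans e d x"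
      by (simp only: gend_of_def de if_True) (rule eq[OF de])
  qed (simp add: gend_of_def)
  show "gend_of A c x T c = T" by (simp add: gend_of_def c gtrans_self[OF A c])
qed

lemma gend_of_component:
  assumes "c \<in> charts_at A x" "S \<in> gEnd A x"
  shows "gend_of A c x (S c) = S"
proof
  fix d
  show "gend_of A c x (S c) d = S d"
  proof (cases "d \<in> charts_at A x")
    case True
    then show ?thesis by (simp only: gend_of_def if_True gEndD(1)[OF assms(2,1) True, symmetric])
  next
    case False
    then show ?thesis by (simp only: gend_of_def if_False gEndD(2)[OF assms(2) False])
  qed
qed

text \<open>A chart change acts on endomorphisms through \<open>GG\<close> of the Jacobians and on
  the metric by congruence, which is exactly the situation of \<open>natural\<close>.\<close>

lemma gEnd_pred_chart:
  assumes A: "smooth_atlas A" and c: "c \<in> charts_at A x" and h: "h \<in> bilinear_forms A x"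
    and inv: "\<And>d. d \<in> charts_at A x \<Longrightarrow> invertible (h d)"
    and natural: "\<And>h M N T. M ** N = mat 1 \<Longrightarrow> invertible h \<Longrightarrow>
      P (transpose M ** h ** M) T \<longleftrightarrow> P h (GG M N ** T ** GG N M)"
    and S: "S \<in> gEnd A x"
  shows "(\<forall>d\<in>charts_at A x. P (h d) (S d)) \<longleftrightarrow> P (h c) (S c)"
proof -
  have "P (h d) (S d) \<longleftrightarrow> P (h c) (S c)" if d: "d \<in> charts_at A x" for d
  proof -
    have "h c = transpose (jacobian c d x) ** h d ** jacobian c d x"
      by (rule bilinear_formsD[OF h c d])
    moreover have "S d = GG (jacobian c d x) (jacobian d c x) ** S c ** GG (jacobian d c x) (jacobian c d x)"
      unfolding gtrans_GG[symmetric] by (rule gEndD(1)[OF S c d])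
    ultimately show ?thesis using natural[OF jacobian_inverse[OF A c d] inv[OF d]] by simp
  qed
  then show ?thesis using c by blast
qed

section \<open>Bundles associated with the orthonormal frames\<close>

lemma coset_eq_iff:
  assumes "group G" "subgroup H G" "a \<in> carrier G" "b \<in> carrier G"
  shows "a <#\<^bsub>G\<^esub> H = b <#\<^bsub>G\<^esub> H \<longleftrightarrow> inv\<^bsub>G\<^esub> a \<otimes>\<^bsub>G\<^esub> b \<in> H"
proof
  assume "a <#\<^bsub>G\<^esub> H = b <#\<^bsub>G\<^esub> H"
  then have "b \<in> a <#\<^bsub>G\<^esub> H" using group.lcos_self[OF assms(1,4,2)] by simp
  then show "inv\<^bsub>G\<^esub> a \<otimes>\<^bsub>G\<^esub> b \<in> H" by (rule subgroup.lcos_module_imp[OF assms(2,1,3)])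
next
  assume "inv\<^bsub>G\<^esub> a \<otimes>\<^bsub>G\<^esub> b \<in> H"
  then have "b \<in> a <#\<^bsub>G\<^esub> H" by (rule subgroup.lcos_module_rev[OF assms(2,1,3,4)])
  then show "a <#\<^bsub>G\<^esub> H = b <#\<^bsub>G\<^esub> H"
    by (rule group.l_repr_independence[OF assms(1) _ assms(3,2)])
qed

text \<open>Criterion for a bundle associated with the orthonormal frames. \<open>P (eta p)\<close>
  cuts out the model fiber and \<open>phi\<close> is to be thought of as an orbit map onto it:
  \<open>stab\<close> identifies its level sets with cosets, and \<open>sec\<close> gives both
  surjectivity and smooth local lifts. \<open>natural\<close> transports the model to the points
  near \<open>x0\<close> along a smooth orthonormal frame and makes the outcome independent of the
  chart.\<close>

lemma fiber_bundle_homogeneous: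
  fixes A :: "('a::{t2_space, second_countable_topology}, 'm::finite) chart set"
    and G :: "('g::euclidean_space) monoid"
  assumes A: "smooth_atlas A" and g: "pseudo_riemannian A g p q"
    and natural: "\<And>h M N T. M ** N = mat 1 \<Longrightarrow> invertible h \<Longrightarrow>
      P (transpose M ** h ** M) T \<longleftrightarrow> P h (GG M N ** T ** GG N M)"
    and Z: "\<And>x. Z x = {S \<in> gEnd A x. \<forall>c\<in>charts_at A x. P (g x c) (S c)}"
    and G: "group G" "closed (carrier G)" "subgroup H G" "closed H"
    and phi: "smooth_on UNIV phi" "\<And>a. a \<in> carrier G \<Longrightarrow> P (eta p) (phi a)"
    and stab: "\<And>a b. a \<in> carrier G \<Longrightarrow> b \<in> carrier G \<Longrightarrow> phi a = phi b \<longleftrightarrow> inv\<^bsub>G\<^esub> a \<otimes>\<^bsub>G\<^esub> b \<in> H"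
    and sec: "\<And>T. P (eta p) T \<Longrightarrow> \<exists>W \<alpha>. open W \<and> T \<in> W \<and> smooth_on W \<alpha> \<and>
      (\<forall>T'\<in>W. P (eta p) T' \<longrightarrow> \<alpha> T' \<in> carrier G \<and> phi (\<alpha> T') = T')"
  shows "fiber_bundle A Z G H"
proof -
  have sig: "has_signature (\<lambda>u v. u \<bullet> (g x c *v v)) p q" if "c \<in> charts_at A x" for x c
    using g that by (simp add: pseudo_riemannian_def)
  have gx: "g x \<in> bilinear_forms A x" for x
    using g by (simp add: pseudo_riemannian_def smooth_section_def)
  have Zc: "S \<in> Z x \<longleftrightarrow> S \<in> gEnd A x \<and> P (g x c) (S c)" if c: "c \<in> charts_at A x" for x c S
    using gEnd_pred_chart[where P=P, OF A c gx has_signature_matrix(2)[OF sig] natural, of S]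
    unfolding Z by auto
  \<comment> \<open>The map induced on cosets; by \<open>stab\<close> its value does not depend on
    the chosen representative.\<close>
  define phi' where "phi' C = phi (SOME a. a \<in> C)" for C
  have phi': "phi' (a <#\<^bsub>G\<^esub> H) = phi a" if a: "a \<in> carrier G" for a
  proof -
    have "(SOME b. b \<in> a <#\<^bsub>G\<^esub> H) \<in> a <#\<^bsub>G\<^esub> H"
      using group.lcos_self[OF G(1) a G(3)] by (rule someI)
    then show ?thesis
      unfolding phi'_def using stab[OF a] subgroup.lcos_module_imp[OF G(3,1) a]
        subgroup.elemlcos_carrier[OF G(3,1) a] by metis
  qed
  have "\<exists>U \<Psi>. open U \<and> x0 \<in> U \<and> local_trivialization A Z G H U \<Psi>" for x0
  proof -
    obtain c0 where c0: "c0 \<in> A" "x0 \<in> cdom c0" using A unfolding smooth_atlas_def by blast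
    define h where "h y = g (cinv c0 y) c0" for y
    have h: "smooth_on (cmap c0 ` cdom c0) h"
      using g c0(1) unfolding pseudo_riemannian_def smooth_section_def h_def by blast
    have hsig: "has_signature (\<lambda>u v. u \<bullet> (h y *v v)) p q" if "y \<in> cmap c0 ` cdom c0" for y
      unfolding h_def using c0(1) chart_inverse(3)[OF A c0(1) that] by (intro sig) (simp add: charts_at_def)
    obtain W0 and E :: "real^'m \<Rightarrow> real^'m^'m" where W0: "open W0" "cmap c0 x0 \<in> W0" "W0 \<subseteq> cmap c0 ` cdom c0"
      and E: "smooth_on W0 E" "\<And>y. y \<in> W0 \<Longrightarrow> transpose (E y) ** h y ** E y = eta p"
    proof (rule local_orthonormal_frame[OF smooth_atlasD(2)[OF A c0(1)] imageI[OF c0(2)] h hsig], goal_cases)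
      case (2 W E)
      show ?case using 2(2-) by (rule that)
    qed
    \<comment> \<open>The inverse of \<open>E y\<close>, read off from
      \<open>transpose (E y) ** h y ** E y = eta p\<close> because \<open>eta p\<close> is its own
      inverse; in this form it is visibly smooth.\<close>
    define N where "N y = eta p ** transpose (E y) ** h y" for y
    have NE: "N y ** E y = mat 1" "E y ** N y = mat 1" if "y \<in> W0" for y
    proof -
      show "N y ** E y = mat 1"
        using E(2)[OF that] by (simp add: N_def matrix_mul_assoc[symmetric] eta_mult_eta)
      then show "E y ** N y = mat 1" by (rule matrix_mult_left_right)
    qed
    have N: "smooth_on W0 N" unfolding N_def
      by (intro smooth_on_matrix_mult smooth_on_const smooth_on_transpose W0(1) E(1) smooth_on_subset[OF h W0(3)])
    define F where "F y = GG (E y) (N y)" for y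
    define F' where "F' y = GG (N y) (E y)" for y
    have FF: "F y ** F' y = mat 1" "F' y ** F y = mat 1" if "y \<in> W0" for y
      unfolding F_def F'_def by (rule GG_inverse[OF NE(2)[OF that]], rule GG_inverse[OF NE(1)[OF that]])
    have F: "smooth_on W0 F" "smooth_on W0 F'" unfolding F_def F'_def
      by (intro smooth_on_GG W0(1) E(1) N)+
    have PF: "P (eta p) T \<longleftrightarrow> P (h y) (F y ** T ** F' y)" if "y \<in> W0" for y T
    proof -
      have y: "y \<in> cmap c0 ` cdom c0" using W0(3) that by blast
      from natural[where T=T, OF NE(2)[OF that] has_signature_matrix(2)[OF hsig[OF y]]]
      show ?thesis unfolding E(2)[OF that] F_def F'_def .
    qed
    define U where "U = cdom c0 \<inter> cmap c0 -` W0"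
    have U: "open U" unfolding U_def by (rule open_chart_vimage[OF A c0(1) W0(1)])
    have x0: "x0 \<in> U" using c0 W0 by (simp add: U_def)
    have Uc: "c0 \<in> charts_at A x" "cmap c0 x \<in> W0" "h (cmap c0 x) = g x c0" if "x \<in> U" for x
      using that c0(1) chart_inverse(1)[OF A c0(1)] by (auto simp: U_def charts_at_def h_def)
    define fib where "fib x T = gend_of A c0 x (F (cmap c0 x) ** T ** F' (cmap c0 x))" for x T
    have fibZ: "fib x T \<in> Z x" if "x \<in> U" "P (eta p) T" for x T
      using gend_of_in_gEnd[OF A Uc(1)[OF that(1)]] PF[OF Uc(2)[OF that(1)]] that(2) Uc(3)[OF that(1)]
      unfolding Zc[OF Uc(1)[OF that(1)]] fib_def by simp
    have fib_back: "F' (cmap c0 x) ** fib x T c0 ** F (cmap c0 x) = T" if "x \<in> U" for x T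
    proof -
      have "F' (cmap c0 x) ** fib x T c0 ** F (cmap c0 x)
          = (F' (cmap c0 x) ** F (cmap c0 x)) ** T ** (F' (cmap c0 x) ** F (cmap c0 x))"
        unfolding fib_def gend_of_in_gEnd(2)[OF A Uc(1)[OF that]] by (simp only: matrix_mul_assoc)
      then show ?thesis by (simp add: FF[OF Uc(2)[OF that]])
    qed
    have fib_surj: "P (eta p) (F' (cmap c0 x) ** S c0 ** F (cmap c0 x))"
      "fib x (F' (cmap c0 x) ** S c0 ** F (cmap c0 x)) = S" if "x \<in> U" "S \<in> Z x" for x S
    proof -
      have "F (cmap c0 x) ** (F' (cmap c0 x) ** S c0 ** F (cmap c0 x)) ** F' (cmap c0 x)
          = (F (cmap c0 x) ** F' (cmap c0 x)) ** S c0 ** (F (cmap c0 x) ** F' (cmap c0 x))"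
        by (simp only: matrix_mul_assoc)
      then have eq: "F (cmap c0 x) ** (F' (cmap c0 x) ** S c0 ** F (cmap c0 x)) ** F' (cmap c0 x) = S c0"
        by (simp add: FF[OF Uc(2)[OF that(1)]])
      have S: "S \<in> gEnd A x" "P (g x c0) (S c0)" using that Zc[OF Uc(1)[OF that(1)]] by auto
      show "P (eta p) (F' (cmap c0 x) ** S c0 ** F (cmap c0 x))"
        unfolding PF[OF Uc(2)[OF that(1)]] eq Uc(3)[OF that(1)] by (rule S(2))
      show "fib x (F' (cmap c0 x) ** S c0 ** F (cmap c0 x)) = S"
        unfolding fib_def eq by (rule gend_of_component[OF Uc(1)[OF that(1)] S(1)])
    qed
    define \<Psi> where "\<Psi> z = (fst z, fib (fst z) (phi' (snd z)))" for z
    have Psi: "\<Psi> (x, a <#\<^bsub>G\<^esub> H) = (x, fib x (phi a))" if "a \<in> carrier G" for x a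
      by (simp add: \<Psi>_def phi'[OF that])
    have lcos: "C \<in> lcosets\<^bsub>G\<^esub> H \<longleftrightarrow> (\<exists>a\<in>carrier G. C = a <#\<^bsub>G\<^esub> H)" for C
      by (auto simp: LCOSETS_def)
    have bij: "bij_betw \<Psi> (U \<times> (lcosets\<^bsub>G\<^esub> H)) (Sigma U Z)"
      unfolding bij_betw_def
    proof (intro conjI equalityI subsetI inj_onI)
      fix z z' assume z: "z \<in> U \<times> (lcosets\<^bsub>G\<^esub> H)" "z' \<in> U \<times> (lcosets\<^bsub>G\<^esub> H)" "\<Psi> z = \<Psi> z'"
      obtain x a where za: "z = (x, a <#\<^bsub>G\<^esub> H)" "a \<in> carrier G" "x \<in> U" using z(1) lcos by auto
      obtain x' b where zb: "z' = (x', b <#\<^bsub>G\<^esub> H)" "b \<in> carrier G" "x' \<in> U" using z(2) lcos by auto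
      have x: "x' = x" "fib x (phi a) = fib x (phi b)" using z(3) Psi za zb by auto
      then have "phi a = phi b" using fib_back[OF za(3)] by metis
      then show "z = z'"
        using stab[OF za(2) zb(2)] coset_eq_iff[OF G(1,3) za(2) zb(2)] x(1) za(1) zb(1) by simp
    next
      fix z assume "z \<in> \<Psi> ` (U \<times> (lcosets\<^bsub>G\<^esub> H))"
      then obtain x a where "z = \<Psi> (x, a <#\<^bsub>G\<^esub> H)" "a \<in> carrier G" "x \<in> U" using lcos by auto
      then show "z \<in> Sigma U Z" using Psi fibZ phi(2) by simp
    next
      fix z assume "z \<in> Sigma U Z"
      then obtain x S where z: "z = (x, S)" "x \<in> U" "S \<in> Z x" by auto
      from sec[OF fib_surj(1)[OF z(2,3)]] fib_surj(1)[OF z(2,3)] obtain a where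
        "a \<in> carrier G" "phi a = F' (cmap c0 x) ** S c0 ** F (cmap c0 x)" by blast
      then have "z = \<Psi> (x, a <#\<^bsub>G\<^esub> H)" using Psi fib_surj(2)[OF z(2,3)] z(1) by simp
      then show "z \<in> \<Psi> ` (U \<times> (lcosets\<^bsub>G\<^esub> H))" using z(2) lcos \<open>a \<in> carrier G\<close> by blast
    qed
    have smooth: "smooth_rel (cmap c ` (U \<inter> cdom c) \<times> carrier G) (\<lambda>(y, a). end_coords c (\<Psi> (cinv c y, a <#\<^bsub>G\<^esub> H)))"
      and sections: "\<And>z. z \<in> Sigma (U \<inter> cdom c) Z \<Longrightarrow>
        \<exists>W a. open W \<and> end_coords c z \<in> W \<and> smooth_on W a \<and>
          (\<forall>z'\<in>Sigma (U \<inter> cdom c) Z. end_coords c z' \<in> W \<longrightarrow>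
             a (end_coords c z') \<in> carrier G \<and> \<Psi> (fst z', a (end_coords c z') <#\<^bsub>G\<^esub> H) = z')"
      if c: "c \<in> A" for c
    proof -
      define Y where "Y = cmap c ` (U \<inter> cdom c)"
      have Y: "open Y" unfolding Y_def by (rule open_chart_image[OF A c U])
      have Ysub: "Y \<subseteq> cmap c ` (cdom c0 \<inter> cdom c)" by (auto simp: Y_def U_def)
      have tr: "smooth_on Y (transition c c0)"
        using smooth_on_subset[OF smooth_atlasD(4)[OF A c c0(1)]] Ysub by (simp add: Int_commute)
      have trW: "transition c c0 ` Y \<subseteq> W0"
        using chart_inverse(1)[OF A c] Uc(2) by (auto simp: Y_def)
      \<comment> \<open>Conjugation from the model to an arbitrary chart \<open>c\<close>: the
        orthonormal frame in \<open>c0\<close> followed by the change from \<open>c0\<close> to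
        \<open>c\<close>, both written in the coordinates of \<open>c\<close>.\<close>
      define K where "K y = gtrans c0 c (cinv c y) ** F (transition c c0 y)" for y
      define K' where "K' y = F' (transition c c0 y) ** gtrans c c0 (cinv c y)" for y
      have K: "smooth_on Y K" "smooth_on Y K'"
        unfolding K_def K'_def
        by (intro smooth_on_matrix_mult Y smooth_on_compose[OF Y W0(1) _ tr trW] F
            smooth_on_subset[OF smooth_on_gtrans(1)[OF A c c0(1)] Ysub]
            smooth_on_subset[OF smooth_on_gtrans(2)[OF A c c0(1)] Ysub])+
      have YU: "open (Y \<times> UNIV)" by (rule open_Times[OF Y open_UNIV])
      have Kfst: "smooth_on (Y \<times> UNIV) (\<lambda>z. K (fst z))" "smooth_on (Y \<times> UNIV) (\<lambda>z. K' (fst z))"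
      proof -
        have "smooth_on (Y \<times> UNIV) (fst :: _ \<Rightarrow> real^'m)" "fst ` (Y \<times> UNIV) \<subseteq> Y"
          using smooth_on_bounded_linear[OF bounded_linear_fst YU] by auto
        then show "smooth_on (Y \<times> UNIV) (\<lambda>z. K (fst z))" "smooth_on (Y \<times> UNIV) (\<lambda>z. K' (fst z))"
          using smooth_on_compose[OF YU Y K(1)] smooth_on_compose[OF YU Y K(2)] by blast+
      qed
      have in_chart: "c \<in> charts_at A x" "cinv c (cmap c x) = x" "cmap c x \<in> Y" "x \<in> U"
        if "x \<in> U \<inter> cdom c" for x
        using that c chart_inverse(1)[OF A c] by (auto simp: charts_at_def Y_def)
      have comp: "fib x T c = K (cmap c x) ** T ** K' (cmap c x)" if x: "x \<in> U \<inter> cdom c" for x T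
        using in_chart(1,2)[OF x]
        by (simp add: fib_def gend_of_def K_def K'_def matrix_mul_assoc)
      have comp': "K' (cmap c x) ** S c ** K (cmap c x) = F' (cmap c0 x) ** S c0 ** F (cmap c0 x)"
        if x: "x \<in> U \<inter> cdom c" and S: "S \<in> Z x" for x S
      proof -
        have "S \<in> gEnd A x" using S Z by blast
        then have "S c0 = gtrans c c0 x ** S c ** gtrans c0 c x"
          by (rule gEndD(1)[OF _ in_chart(1)[OF x] Uc(1)[OF in_chart(4)[OF x]]])
        then show ?thesis
          using in_chart(2)[OF x] by (simp add: K_def K'_def matrix_mul_assoc)
      qed
      show "smooth_rel (cmap c ` (U \<inter> cdom c) \<times> carrier G) (\<lambda>(y, a). end_coords c (\<Psi> (cinv c y, a <#\<^bsub>G\<^esub> H)))"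
        unfolding smooth_rel_def
      proof
        fix z assume z: "z \<in> cmap c ` (U \<inter> cdom c) \<times> carrier G"
        define f where "f z = (fst z, K (fst z) ** phi (snd z) ** K' (fst z))" for z
        have "smooth_on (Y \<times> UNIV) f"
          unfolding f_def
          by (intro smooth_on_Pair smooth_on_matrix_mult YU open_Times Y open_UNIV Kfst
              smooth_on_bounded_linear[OF bounded_linear_fst]
              smooth_on_compose[OF _ open_UNIV phi(1) smooth_on_bounded_linear[OF bounded_linear_snd]]) auto
        moreover have "f y = (case y of (y, a) \<Rightarrow> end_coords c (\<Psi> (cinv c y, a <#\<^bsub>G\<^esub> H)))"
          if "y \<in> (cmap c ` (U \<inter> cdom c) \<times> carrier G) \<inter> Y \<times> UNIV" for y
        proof -
          obtain x a where y: "y = (cmap c x, a)" "x \<in> U \<inter> cdom c" "a \<in> carrier G" using \<open>y \<in> _\<close> by auto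
          then show ?thesis
            using in_chart(2)[OF y(2)] Psi[OF y(3)] comp[OF y(2)] by (simp add: f_def end_coords_def)
        qed
        moreover have "z \<in> Y \<times> UNIV" using z by (auto simp: Y_def)
        ultimately show "\<exists>W F. open W \<and> z \<in> W \<and> smooth_on W F \<and>
            (\<forall>y\<in>(cmap c ` (U \<inter> cdom c) \<times> carrier G) \<inter> W.
               F y = (case y of (y, a) \<Rightarrow> end_coords c (\<Psi> (cinv c y, a <#\<^bsub>G\<^esub> H))))"
          by (intro exI[of _ "Y \<times> UNIV"] exI[of _ f] conjI ballI open_Times Y open_UNIV)
      qed
      fix z assume "z \<in> Sigma (U \<inter> cdom c) Z"
      then obtain x S where z: "z = (x, S)" "x \<in> U \<inter> cdom c" "S \<in> Z x" by auto
      \<comment> \<open>The transport undone: the model matrix of an endomorphism given by its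
        component in \<open>c\<close>. Composing it with a local lift of the model gives the
        required local lift into G.\<close>
      define \<Theta> where "\<Theta> z = K' (fst z) ** snd z ** K (fst z)" for z
      have \<Theta>: "smooth_on (Y \<times> UNIV) \<Theta>"
        unfolding \<Theta>_def
        by (intro smooth_on_matrix_mult YU Kfst smooth_on_bounded_linear[OF bounded_linear_snd])
      have \<Theta>Z: "\<Theta> (end_coords c (x, S)) = F' (cmap c0 x) ** S c0 ** F (cmap c0 x)"
        if "x \<in> U \<inter> cdom c" "S \<in> Z x" for x S
        using comp'[OF that] by (simp add: \<Theta>_def end_coords_def)
      have PT: "P (eta p) (\<Theta> (end_coords c (x, S)))" if "x \<in> U \<inter> cdom c" "S \<in> Z x" for x S
        unfolding \<Theta>Z[OF that] using fib_surj(1)[OF in_chart(4)[OF that(1)] that(2)] .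
      obtain W1 \<alpha> where W1: "open W1" "\<Theta> (end_coords c z) \<in> W1" "smooth_on W1 \<alpha>"
        and \<alpha>: "\<And>T'. T' \<in> W1 \<Longrightarrow> P (eta p) T' \<Longrightarrow> \<alpha> T' \<in> carrier G \<and> phi (\<alpha> T') = T'"
        using sec[OF PT[OF z(2,3)]] unfolding z(1) by blast
      define W where "W = (Y \<times> UNIV) \<inter> \<Theta> -` W1"
      have W: "open W" unfolding W_def
        by (rule continuous_open_preimage[OF smooth_on_continuous_on[OF \<Theta>] YU W1(1)])
      have "end_coords c z \<in> W"
        using W1(2) in_chart(3)[OF z(2)] z(1) by (simp add: W_def end_coords_def)
      moreover have "smooth_on W (\<lambda>z. \<alpha> (\<Theta> z))"
        by (rule smooth_on_compose[OF W W1(1,3) smooth_on_subset[OF \<Theta>]]) (auto simp: W_def)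
      moreover have "\<alpha> (\<Theta> (end_coords c z')) \<in> carrier G \<and>
          \<Psi> (fst z', \<alpha> (\<Theta> (end_coords c z')) <#\<^bsub>G\<^esub> H) = z'"
        if z': "z' \<in> Sigma (U \<inter> cdom c) Z" "end_coords c z' \<in> W" for z'
      proof -
        obtain x' S' where x': "z' = (x', S')" "x' \<in> U \<inter> cdom c" "S' \<in> Z x'" using z'(1) by auto
        have "\<Theta> (end_coords c z') \<in> W1" using z'(2) by (simp add: W_def)
        then have a: "\<alpha> (\<Theta> (end_coords c z')) \<in> carrier G" "phi (\<alpha> (\<Theta> (end_coords c z'))) = \<Theta> (end_coords c z')"
          using \<alpha> PT[OF x'(2,3)] x'(1) by auto
        then show ?thesis
          using Psi[OF a(1)] fib_surj(2)[OF in_chart(4)[OF x'(2)] x'(3)] \<Theta>Z[OF x'(2,3)] x'(1) by simp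
      qed
      ultimately show "\<exists>W a. open W \<and> end_coords c z \<in> W \<and> smooth_on W a \<and>
          (\<forall>z'\<in>Sigma (U \<inter> cdom c) Z. end_coords c z' \<in> W \<longrightarrow>
             a (end_coords c z') \<in> carrier G \<and> \<Psi> (fst z', a (end_coords c z') <#\<^bsub>G\<^esub> H) = z')"
        using W by blast
    qed
    have "local_trivialization A Z G H U \<Psi>"
      unfolding local_trivialization_def using bij smooth sections by (simp add: \<Psi>_def)
    then show ?thesis using U x0 by blast
  qed
  then show ?thesis
    unfolding fiber_bundle_def using G Z by blast
qed

section \<open>The orthogonal groups\<close>

lemma O_real_iff: "T \<in> carrier (O_real a) \<longleftrightarrow> transpose T ** eta a ** T = eta a"
proof -
  have "(\<forall>u v. std_form a (T *v u) (T *v v) = std_form a u v) \<longleftrightarrow> transpose T ** eta a ** T = eta a"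
    unfolding matrix_eq_iff_inner
    by (simp add: std_form_eq inner_transpose matrix_vector_mul_assoc matrix_mul_assoc)
  moreover have "invertible T" if "transpose T ** eta a ** T = eta a"
  proof -
    have "(eta a ** transpose T ** eta a) ** T = eta a ** (transpose T ** eta a ** T)"
      by (simp only: matrix_mul_assoc)
    then have "(eta a ** transpose T ** eta a) ** T = mat 1" by (simp add: that eta_mult_eta)
    then show ?thesis by (auto simp: invertible_left_inverse)
  qed
  ultimately show ?thesis by (auto simp: O_real_def)
qed

lemma O_real_inverse:
  assumes "T \<in> carrier (O_real a)"
  shows "(eta a ** transpose T ** eta a) ** T = mat 1" "T ** (eta a ** transpose T ** eta a) = mat 1"
    and "T ** eta a ** transpose T = eta a"
proof -
  have "(eta a ** transpose T ** eta a) ** T = eta a ** (transpose T ** eta a ** T)"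
    by (simp only: matrix_mul_assoc)
  then show "(eta a ** transpose T ** eta a) ** T = mat 1"
    using assms by (simp add: O_real_iff eta_mult_eta)
  then show 1: "T ** (eta a ** transpose T ** eta a) = mat 1" by (rule matrix_mult_left_right)
  have "T ** eta a ** transpose T = T ** (eta a ** transpose T ** eta a) ** eta a"
    by (simp add: matrix_mul_assoc[symmetric] eta_mult_eta)
  then show "T ** eta a ** transpose T = eta a" by (simp only: 1 matrix_mul_lid)
qed

lemma O_real_iff': "T \<in> carrier (O_real a) \<longleftrightarrow> T ** eta a ** transpose T = eta a"
proof
  assume "T ** eta a ** transpose T = eta a"
  then have "transpose T \<in> carrier (O_real a)" by (simp add: O_real_iff transpose_transpose)
  from O_real_inverse(3)[OF this] show "T \<in> carrier (O_real a)" by (simp add: O_real_iff transpose_transpose)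
qed (rule O_real_inverse(3))

lemma O_real_mult: "mult (O_real a) = (**)" "one (O_real a) = mat 1"
  by (simp_all add: O_real_def)

lemma O_real_closed_mult:
  assumes "S \<in> carrier (O_real a)" "T \<in> carrier (O_real a)"
  shows "S ** T \<in> carrier (O_real a)"
proof -
  have "transpose (S ** T) ** eta a ** (S ** T) = transpose T ** (transpose S ** eta a ** S) ** T"
    by (simp only: matrix_transpose_mul matrix_mul_assoc)
  then show ?thesis using assms by (simp add: O_real_iff)
qed

lemma O_real_closed_inverse:
  assumes "T \<in> carrier (O_real a)"
  shows "eta a ** transpose T ** eta a \<in> carrier (O_real a)"
proof -
  have "transpose (eta a ** transpose T ** eta a) ** eta a ** (eta a ** transpose T ** eta a)
      = eta a ** T ** (eta a ** eta a) ** (eta a ** transpose T ** eta a)"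
    by (simp only: matrix_transpose_mul matrix_mul_assoc transpose_eta transpose_transpose)
  also have "\<dots> = eta a ** (T ** (eta a ** transpose T ** eta a))"
    by (simp only: eta_mult_eta matrix_mul_rid matrix_mul_assoc)
  finally show ?thesis by (simp add: O_real_iff O_real_inverse[OF assms])
qed

lemma group_O_real: "group (O_real a)"
proof (rule groupI)
  show "\<exists>S\<in>carrier (O_real a). S \<otimes>\<^bsub>O_real a\<^esub> T = \<one>\<^bsub>O_real a\<^esub>" if "T \<in> carrier (O_real a)" for T
    using O_real_closed_inverse[OF that] O_real_inverse(1)[OF that] by (auto simp: O_real_mult)
qed (simp_all add: O_real_mult O_real_closed_mult matrix_mul_assoc, simp add: O_real_iff transpose_mat)

lemma inv_O_real: "T \<in> carrier (O_real a) \<Longrightarrow> inv\<^bsub>O_real a\<^esub> T = eta a ** transpose T ** eta a"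
  by (rule group.inv_equality[OF group_O_real])
    (simp_all add: O_real_mult O_real_inverse O_real_closed_inverse)

lemma continuous_on_matrix_mult:
  fixes f :: "'u::topological_space \<Rightarrow> 'f::{real_normed_field, euclidean_space}^'n^'k"
  shows "continuous_on S f \<Longrightarrow> continuous_on S g \<Longrightarrow> continuous_on S (\<lambda>x. f x ** g x)"
  by (rule bounded_bilinear.continuous_on[OF bounded_bilinear_matrix_mult])

lemma continuous_on_transpose:
  fixes f :: "'u::topological_space \<Rightarrow> 'f::euclidean_space^'n^'k"
  shows "continuous_on S f \<Longrightarrow> continuous_on S (\<lambda>x. transpose (f x))"
  by (rule bounded_linear.continuous_on[OF bounded_linear_transpose])

lemma closed_O_real: "closed (carrier (O_real a :: (real^'m^'m) monoid))"
proof -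
  have "carrier (O_real a :: (real^'m^'m) monoid) = {T. transpose T ** eta a ** T = eta a}" using O_real_iff by blast
  then show ?thesis
    by (simp only:) (intro closed_Collect_eq continuous_on_matrix_mult continuous_on_transpose
        continuous_on_id continuous_on_const)
qed

section \<open>The typical fiber for \<open>\<lambda> \<ell> = -1\<close>\<close>

lemmas eta_cancel = eta_mult_eta matrix_mul_assoc[of _ "eta p" "eta p" for p, symmetric, unfolded eta_mult_eta matrix_mul_rid]

lemma Ik_eta: "Ik k (eta p) = blk 0 (k *\<^sub>R eta p) (eta p) 0"
  by (simp add: Ik_blk matrix_inv_unique(1)[OF eta_mult_eta])

lemma fiber_pred_eta_blk:
  "fiber_pred lam 1 (eta p) (blk a b c d) \<longleftrightarrow>
    (a ** a + b ** c = mat lam \<and> a ** b + b ** d = 0 \<and> c ** a + d ** c = 0 \<and> c ** b + d ** d = mat lam) \<and>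
    trace a + trace d = 0 \<and>
    (transpose c = - c \<and> transpose a = - d \<and> transpose d = - a \<and> transpose b = - b) \<and>
    (b ** eta p = - (eta p ** c) \<and> a ** eta p = - (eta p ** d) \<and> d ** eta p = - (eta p ** a) \<and> c ** eta p = - (eta p ** b))"
  unfolding fiber_pred_def lin_structure_iff
  by (simp add: Ik_eta Bm_def blk_mult transpose_blk blk_linear mat_blk[of lam] blk_eq_iff trace_blk
      matrix_mult_simps conj_ac)

text \<open>The endomorphism that sends \<open>u + g u\<close> to \<open>R u - g (R u)\<close> and
  \<open>u - g u\<close> to \<open>R' u + g (R' u)\<close>, where
  \<open>R' = eta p ** transpose R ** eta p\<close> is the metric adjoint of \<open>R\<close>;
  \<open>X\<close> and \<open>Y\<close> are the half sum and the half difference of \<open>R\<close>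
  and \<open>R'\<close>. Its square acts by \<open>R' ** R\<close> on one graph and by
  \<open>R ** R'\<close> on the other.\<close>

definition para_of :: "nat \<Rightarrow> real^'m^'m \<Rightarrow> real^('m::finite + 'm)^('m + 'm)" where
  "para_of p R = (let X = (1/2) *\<^sub>R (R + eta p ** transpose R ** eta p);
     Y = (1/2) *\<^sub>R (R - eta p ** transpose R ** eta p)
   in blk X (Y ** eta p) (- (eta p ** Y)) (- (eta p ** X ** eta p)))"

text \<open>The map \<open>R\<close> with \<open>S (u + g u) = R u - g (R u)\<close>; \<open>S\<close> interchanges the graphs of \<open>g\<close> and \<open>-g\<close>.\<close>

definition para_to :: "nat \<Rightarrow> real^('m::finite + 'm)^('m + 'm) \<Rightarrow> real^'m^'m" where
  "para_to p T = ul T + ur T ** eta p"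

lemma half_add: "(1/2) *\<^sub>R (x + y) + (1/2) *\<^sub>R (x - y) = x" "(1/2) *\<^sub>R (x + y) - (1/2) *\<^sub>R (x - y) = y"
  for x y :: "'v::real_vector"
  by (simp_all add: scaleR_add_right scaleR_diff_right flip: scaleR_2 scaleR_add_left)

lemma para_to_of: "para_to p (para_of p R) = R"
  by (simp add: para_to_def para_of_def Let_def eta_cancel half_add)

text \<open>Skewness together with anticommutation makes \<open>a - b ** eta p\<close> the metric
  adjoint of \<open>R = a + b ** eta p\<close>. So \<open>a\<close> and \<open>b ** eta p\<close>
  are the half sum and half difference, and the product of \<open>R\<close> with its adjoint is
  computed from the first block row of the equation for the square.\<close>

lemma para_of_to:
  assumes "fiber_pred lam 1 (eta p) T"
  shows "para_of p (para_to p T) = T" "para_to p T ** eta p ** transpose (para_to p T) = lam *\<^sub>R eta p"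
proof -
  obtain a b c d where T: "T = blk a b c d" by (rule blk_exhaust)
  note F = assms[unfolded T fiber_pred_eta_blk]
  have ec: "eta p ** c = - (b ** eta p)" and ed: "eta p ** d = - (a ** eta p)" and ea: "eta p ** a = - (d ** eta p)"
    using F by simp_all
  have c: "c = - (eta p ** b ** eta p)"
  proof -
    have "c = eta p ** (eta p ** c)" by (simp add: matrix_mul_assoc eta_mult_eta)
    then show ?thesis by (simp add: ec matrix_mult_simps matrix_mul_assoc)
  qed
  have d: "d = - (eta p ** a ** eta p)"
  proof -
    have "d = eta p ** (eta p ** d)" by (simp add: matrix_mul_assoc eta_mult_eta)
    then show ?thesis by (simp add: ed matrix_mult_simps matrix_mul_assoc)
  qed
  have "transpose (a + b ** eta p) = - d - eta p ** b"
    using F by (simp add: transpose_simps transpose_eta matrix_mult_simps)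
  then have R': "eta p ** transpose (a + b ** eta p) ** eta p = a - b ** eta p"
    by (simp add: matrix_mult_simps ed eta_cancel matrix_mul_assoc)
  show "para_of p (para_to p T) = T"
    unfolding T para_to_def blocks_blk para_of_def R' Let_def half_add
    by (simp add: half_add eta_cancel c[symmetric] d[symmetric] matrix_mul_assoc)
  have "(a + b ** eta p) ** (a - b ** eta p) = a ** a - a ** b ** eta p + b ** (eta p ** a) - b ** (eta p ** b ** eta p)"
    by (simp add: matrix_mult_simps matrix_mul_assoc)
  also have "\<dots> = (a ** a + b ** c) - (a ** b + b ** d) ** eta p"
    by (simp add: ea c matrix_mult_simps matrix_mul_assoc)
  also have "\<dots> = mat lam" using F by (simp add: matrix_mult_simps)
  finally have RR: "(a + b ** eta p) ** (a - b ** eta p) = mat lam" .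
  have "(a + b ** eta p) ** eta p ** transpose (a + b ** eta p)
      = (a + b ** eta p) ** (eta p ** transpose (a + b ** eta p) ** eta p) ** eta p"
    by (simp add: matrix_mul_assoc eta_cancel)
  also have "\<dots> = lam *\<^sub>R eta p"
    unfolding R' RR by (simp add: mat_scaleR[of lam] matrix_mult_simps)
  finally show "para_to p T ** eta p ** transpose (para_to p T) = lam *\<^sub>R eta p"
    unfolding T para_to_def blocks_blk .
qed

lemma fiber_pred_para_of:
  assumes R: "R ** eta p ** transpose R = lam *\<^sub>R eta p" and lam: "lam \<noteq> 0"
  shows "fiber_pred lam 1 (eta p) (para_of p R)"
proof -
  define R' where "R' = eta p ** transpose R ** eta p"
  define X where "X = (1/2) *\<^sub>R (R + R')"
  define Y where "Y = (1/2) *\<^sub>R (R - R')"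
  have RR': "R ** R' = mat lam"
  proof -
    have "R ** R' = (R ** eta p ** transpose R) ** eta p" by (simp add: R'_def matrix_mul_assoc)
    then show ?thesis unfolding R by (simp add: mat_scaleR[of lam] matrix_mult_simps eta_mult_eta)
  qed
  have "R ** ((1/lam) *\<^sub>R R') = mat 1"
    using lam by (simp add: matrix_mult_simps RR' mat_scaleR[of lam])
  then have "((1/lam) *\<^sub>R R') ** R = mat 1" by (rule matrix_mult_left_right)
  then have "lam *\<^sub>R (((1/lam) *\<^sub>R R') ** R) = lam *\<^sub>R mat 1" by simp
  then have R'R: "R' ** R = mat lam"
    using lam by (simp add: matrix_mult_simps mat_scaleR[of lam])
  have tR: "transpose R = eta p ** R' ** eta p" "transpose R' = eta p ** R ** eta p"
    by (simp_all add: R'_def transpose_simps transpose_eta matrix_mul_assoc eta_cancel)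
  have tX: "transpose X = eta p ** X ** eta p" and tY: "transpose Y = - (eta p ** Y ** eta p)"
    by (simp_all add: X_def Y_def transpose_simps tR matrix_mult_simps add.commute flip: scaleR_minus_right)
  have XY: "X + Y = R" "X - Y = R'" unfolding X_def Y_def by (rule half_add)+
  \<comment> \<open>Both orders of the product of \<open>R\<close> and \<open>R'\<close> equal
    \<open>mat lam\<close>. Their sum gives \<open>X ** X - Y ** Y = mat lam\<close>, and then
    either of them shows that \<open>X\<close> and \<open>Y\<close> commute; these are the block
    equations for the square.\<close>
  have "(X + Y) ** (X - Y) = mat lam" "(X - Y) ** (X + Y) = mat lam"
    unfolding XY by (rule RR', rule R'R)
  then have e1: "X ** X - X ** Y + Y ** X - Y ** Y = mat lam"
    and e2: "X ** X + X ** Y - Y ** X - Y ** Y = mat lam"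
    by (simp_all add: matrix_mult_simps algebra_simps)
  have "2 *\<^sub>R (X ** X - Y ** Y) = 2 *\<^sub>R mat lam"
    using arg_cong2[OF e1 e2, of "(+)"] by (simp add: scaleR_2 algebra_simps)
  then have sq: "X ** X - Y ** Y = mat lam" by simp
  then have comm: "X ** Y = Y ** X" using e1 by (simp add: algebra_simps)
  have comm': "eta p ** X ** Y = eta p ** Y ** X"
    by (simp only: matrix_mul_assoc[symmetric] comm)
  have eYe: "eta p ** Y ** eta p ** eta p ** Y ** eta p = eta p ** (Y ** Y) ** eta p"
    "eta p ** X ** eta p ** eta p ** X ** eta p = eta p ** (X ** X) ** eta p"
    by (simp_all add: matrix_mul_assoc eta_cancel)
  have sq': "eta p ** (X ** X) ** eta p - eta p ** (Y ** Y) ** eta p = mat lam"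
  proof -
    have "eta p ** (X ** X) ** eta p - eta p ** (Y ** Y) ** eta p = eta p ** (X ** X - Y ** Y) ** eta p"
      by (simp add: matrix_mult_simps)
    then show ?thesis unfolding sq by (simp add: mat_scaleR[of lam] matrix_mult_simps eta_mult_eta)
  qed
  have trace: "trace (eta p ** X ** eta p) = trace X"
    by (rule trace_conj[OF eta_mult_eta])
  have "fiber_pred lam 1 (eta p) (blk X (Y ** eta p) (- (eta p ** Y)) (- (eta p ** X ** eta p)))"
    unfolding fiber_pred_eta_blk
    using sq sq' comm comm'
    by (simp add: matrix_mult_simps transpose_simps transpose_eta tX tY matrix_mul_assoc eta_cancel
        trace_def[symmetric] trace trace_minus)
  then show ?thesis by (simp add: para_of_def Let_def X_def Y_def R'_def)
qed

lemma smooth_on_para_of: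
  assumes "open S" "smooth_on S f"
  shows "smooth_on S (\<lambda>x. para_of p (f x))"
  unfolding para_of_def Let_def
  by (intro smooth_on_blk smooth_on_minus smooth_on_scaleR_const smooth_on_add smooth_on_diff
      smooth_on_matrix_mult smooth_on_const smooth_on_transpose assms)

lemma smooth_on_para_to:
  assumes "open S" "smooth_on S f"
  shows "smooth_on S (\<lambda>x. para_to p (f x))"
  unfolding para_to_def
  by (intro smooth_on_add smooth_on_matrix_mult smooth_on_const assms
      smooth_on_bounded_linear_comp[OF bounded_linear_blocks(1)] smooth_on_bounded_linear_comp[OF bounded_linear_blocks(2)])

text \<open>\<open>R0\<close> is an involutive base point among the isometries
  (\<open>lam = 1\<close>) or anti-isometries (\<open>lam = - 1\<close>). A pair (a, b) moves it to
  a R0 b^-1, hence fixes it exactly when b = R0 a R0; this is the embedding that defines the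
  subgroup.\<close>

lemma para_fiber_bundle:
  fixes A :: "('a::{t2_space, second_countable_topology}, 'm::finite) chart set" and R0 :: "real^'m^'m"
  assumes A: "smooth_atlas A" "pseudo_riemannian A g p q"
    and lam: "lam * lam = 1" "lam \<noteq> 0"
    and R0: "R0 ** R0 = mat 1" "transpose R0 = R0" "R0 ** eta p ** R0 = lam *\<^sub>R eta p"
    and Z: "\<And>x. Z x = {S \<in> gEnd A x. \<forall>c\<in>charts_at A x. fiber_pred lam 1 (g x c) (S c)}"
  shows "fiber_bundle A Z ((O_real p :: (real^'m^'m) monoid) \<times>\<times> (O_real p :: (real^'m^'m) monoid))
    ((\<lambda>T. (T, R0 ** T ** R0)) ` carrier (O_real p))"
proof -
  let ?O = "O_real p :: (real^'m^'m) monoid"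
  let ?G = "?O \<times>\<times> ?O" and ?H = "(\<lambda>T. (T, R0 ** T ** R0)) ` carrier ?O"
  let ?inv = "\<lambda>T. eta p ** transpose T ** eta p"
  have G: "group ?G" by (intro DirProd_group group_O_real)
  have carG: "carrier ?G = carrier ?O \<times> carrier ?O" by simp
  have clG: "closed (carrier ?G)" unfolding carG by (intro closed_Times closed_O_real)
  have R0R0: "X ** R0 ** R0 = X" for X by (simp add: matrix_mul_assoc[symmetric] R0(1))
  have conj: "R0 ** T ** R0 \<in> carrier ?O" if T: "T \<in> carrier ?O" for T
  proof -
    have "(R0 ** T ** R0) ** eta p ** transpose (R0 ** T ** R0)
        = R0 ** T ** (R0 ** eta p ** R0) ** transpose T ** R0"
      by (simp only: matrix_transpose_mul matrix_mul_assoc R0(2))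
    also have "\<dots> = lam *\<^sub>R (R0 ** (T ** eta p ** transpose T) ** R0)"
      by (simp add: R0(3) matrix_mult_simps matrix_mul_assoc)
    also have "\<dots> = eta p"
      unfolding O_real_inverse(3)[OF T] R0(3) using lam(1) by simp
    finally show ?thesis by (simp add: O_real_iff')
  qed
  have H: "?H = {z \<in> carrier ?O \<times> carrier ?O. snd z = R0 ** fst z ** R0}"
    using conj by auto
  have clH: "closed ?H"
    unfolding H Collect_conj_eq Collect_mem_eq
    by (intro closed_Int closed_Times closed_O_real closed_Collect_eq continuous_on_matrix_mult
        continuous_on_fst continuous_on_snd continuous_on_id continuous_on_const)
  have subH: "subgroup ?H ?G"
  proof (rule group.subgroupI[OF G])
    show "?H \<subseteq> carrier ?G" unfolding H carG by auto
    have "mat 1 \<in> carrier ?O" by (simp add: O_real_iff transpose_mat)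
    then show "?H \<noteq> {}" by blast
    fix z assume "z \<in> ?H"
    then obtain T where T: "z = (T, R0 ** T ** R0)" "T \<in> carrier ?O" by auto
    have "inv\<^bsub>?G\<^esub> z = (?inv T, ?inv (R0 ** T ** R0))"
      unfolding T(1) by (simp add: inv_DirProd[OF group_O_real group_O_real T(2) conj[OF T(2)]] inv_O_real T(2) conj)
    also have "?inv (R0 ** T ** R0) = R0 ** ?inv T ** R0"
    proof -
      \<comment> \<open>\<open>R0\<close> and \<open>eta p\<close> commute up to the factor
        \<open>lam\<close>, which enters twice and disappears because
        \<open>lam * lam = 1\<close>.\<close>
      have er: "eta p ** R0 = lam *\<^sub>R (R0 ** eta p)" "R0 ** eta p = lam *\<^sub>R (eta p ** R0)"
      proof -
        have "R0 ** (R0 ** eta p ** R0) = eta p ** R0" by (simp add: matrix_mul_assoc R0(1))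
        then show "eta p ** R0 = lam *\<^sub>R (R0 ** eta p)" by (simp add: R0(3) matrix_mult_simps)
        have "(R0 ** eta p ** R0) ** R0 = R0 ** eta p" by (simp add: R0R0)
        then show "R0 ** eta p = lam *\<^sub>R (eta p ** R0)" by (simp add: R0(3) matrix_mult_simps)
      qed
      have "?inv (R0 ** T ** R0) = (eta p ** R0) ** transpose T ** (R0 ** eta p)"
        by (simp only: matrix_transpose_mul matrix_mul_assoc R0(2))
      also have "\<dots> = (lam * lam) *\<^sub>R (R0 ** eta p ** transpose T ** (eta p ** R0))"
        by (subst er(1), subst er(2)) (simp only: matrix_mult_simps scaleR_scaleR)
      finally show ?thesis by (simp add: lam(1) matrix_mul_assoc)
    qed
    finally show "inv\<^bsub>?G\<^esub> z \<in> ?H" using O_real_closed_inverse[OF T(2)] by auto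
    fix z' assume "z' \<in> ?H"
    then obtain T' where T': "z' = (T', R0 ** T' ** R0)" "T' \<in> carrier ?O" by auto
    have "z \<otimes>\<^bsub>?G\<^esub> z' = (T ** T', R0 ** (T ** T') ** R0)"
      using T T' by (simp add: O_real_mult matrix_mul_assoc R0R0)
    then show "z \<otimes>\<^bsub>?G\<^esub> z' \<in> ?H" using O_real_closed_mult[OF T(2) T'(2)] by auto
  qed
  define phi where "phi z = para_of p (fst z ** R0 ** ?inv (snd z))" for z :: "(real^'m^'m) \<times> (real^'m^'m)"
  have R: "(a ** R0 ** ?inv b) ** eta p ** transpose (a ** R0 ** ?inv b) = lam *\<^sub>R eta p"
    if a: "a \<in> carrier ?O" and b: "b \<in> carrier ?O" for a b
  proof -
    have "(a ** R0 ** ?inv b) ** eta p ** transpose (a ** R0 ** ?inv b)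
       = a ** R0 ** (?inv b ** eta p ** transpose (?inv b)) ** R0 ** transpose a"
      by (simp only: matrix_transpose_mul matrix_mul_assoc R0(2))
    also have "\<dots> = a ** (R0 ** eta p ** R0) ** transpose a"
      unfolding O_real_inverse(3)[OF O_real_closed_inverse[OF b]] by (simp only: matrix_mul_assoc)
    also have "\<dots> = lam *\<^sub>R (a ** eta p ** transpose a)"
      by (simp add: R0(3) matrix_mult_simps)
    finally show ?thesis by (simp only: O_real_inverse(3)[OF a])
  qed
  show ?thesis
  proof (rule fiber_bundle_homogeneous[where P="fiber_pred lam 1" and phi=phi,
        OF A fiber_pred_natural Z G clG subH clH])
    show "smooth_on UNIV phi"
      unfolding phi_def
      by (intro smooth_on_para_of smooth_on_matrix_mult smooth_on_const smooth_on_transpose open_UNIV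
          smooth_on_bounded_linear[OF bounded_linear_fst] smooth_on_bounded_linear[OF bounded_linear_snd])
    show "fiber_pred lam 1 (eta p) (phi a)" if "a \<in> carrier ?G" for a
      unfolding phi_def using that R lam(2) by (intro fiber_pred_para_of) auto
    show "phi a = phi b \<longleftrightarrow> inv\<^bsub>?G\<^esub> a \<otimes>\<^bsub>?G\<^esub> b \<in> ?H" if ab: "a \<in> carrier ?G" "b \<in> carrier ?G" for a b
    proof -
      obtain a1 a2 b1 b2 where e: "a = (a1, a2)" "b = (b1, b2)" by (metis surj_pair)
      have c: "a1 \<in> carrier ?O" "a2 \<in> carrier ?O" "b1 \<in> carrier ?O" "b2 \<in> carrier ?O"
        using ab e by auto
      have 1: "phi a = phi b \<longleftrightarrow> a1 ** R0 ** ?inv a2 = b1 ** R0 ** ?inv b2"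
        unfolding phi_def e fst_conv snd_conv by (metis para_to_of)
      have 2: "inv\<^bsub>?G\<^esub> a \<otimes>\<^bsub>?G\<^esub> b = (?inv a1 ** b1, ?inv a2 ** b2)"
        unfolding e by (simp add: inv_DirProd[OF group_O_real group_O_real c(1,2)] inv_O_real c O_real_mult)
      have cl: "?inv a1 ** b1 \<in> carrier ?O" "?inv a2 ** b2 \<in> carrier ?O"
        by (intro O_real_closed_mult O_real_closed_inverse c)+
      have "a1 ** R0 ** ?inv a2 = b1 ** R0 ** ?inv b2 \<longleftrightarrow> ?inv a2 ** b2 = R0 ** (?inv a1 ** b1) ** R0"
      proof
        assume *: "a1 ** R0 ** ?inv a2 = b1 ** R0 ** ?inv b2"
        have "R0 ** (?inv a1 ** b1) ** R0 = R0 ** ?inv a1 ** (b1 ** R0 ** ?inv b2) ** b2"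
          by (simp add: matrix_mul_assoc[symmetric] O_real_inverse(1)[OF c(4), unfolded matrix_mul_assoc[symmetric]])
        also have "\<dots> = R0 ** (?inv a1 ** a1) ** R0 ** ?inv a2 ** b2"
          unfolding *[symmetric] by (simp only: matrix_mul_assoc)
        also have "\<dots> = ?inv a2 ** b2"
          unfolding O_real_inverse(1)[OF c(1)] by (simp add: R0(1))
        finally show "?inv a2 ** b2 = R0 ** (?inv a1 ** b1) ** R0" by simp
      next
        assume *: "?inv a2 ** b2 = R0 ** (?inv a1 ** b1) ** R0"
        have "a1 ** R0 ** ?inv a2 = a1 ** R0 ** (?inv a2 ** b2) ** ?inv b2"
          by (simp only: matrix_mul_assoc[symmetric] O_real_inverse(2)[OF c(4), unfolded matrix_mul_assoc[symmetric]]
              matrix_mul_rid)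
        also have "\<dots> = a1 ** (R0 ** R0) ** ?inv a1 ** b1 ** R0 ** ?inv b2"
          unfolding * by (simp only: matrix_mul_assoc)
        also have "\<dots> = (a1 ** ?inv a1) ** b1 ** R0 ** ?inv b2"
          unfolding R0(1) by (simp only: matrix_mul_assoc matrix_mul_rid)
        finally show "a1 ** R0 ** ?inv a2 = b1 ** R0 ** ?inv b2"
          unfolding O_real_inverse(2)[OF c(1)] by simp
      qed
      then show ?thesis unfolding 1 2 H using cl by simp
    qed
    show "\<exists>W \<alpha>. open W \<and> T \<in> W \<and> smooth_on W \<alpha> \<and>
        (\<forall>T'\<in>W. fiber_pred lam 1 (eta p) T' \<longrightarrow> \<alpha> T' \<in> carrier ?G \<and> phi (\<alpha> T') = T')"
      if "fiber_pred lam 1 (eta p) T" for T :: "real^('m + 'm)^('m + 'm)"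
    proof (intro exI conjI ballI impI)
      \<comment> \<open>The lift is global: R = (R R0) R0, and R R0 is an isometry whenever R comes
        from a point of the fiber.\<close>
      show "smooth_on UNIV (\<lambda>T. (para_to p T ** R0, mat 1))"
        by (intro smooth_on_Pair smooth_on_matrix_mult smooth_on_para_to smooth_on_const open_UNIV
            smooth_on_bounded_linear[OF bounded_linear_ident])
      fix T' :: "real^('m + 'm)^('m + 'm)"
      assume T': "fiber_pred lam 1 (eta p) T'"
      have "(para_to p T' ** R0) ** eta p ** transpose (para_to p T' ** R0)
          = para_to p T' ** (R0 ** eta p ** R0) ** transpose (para_to p T')"
        by (simp only: matrix_transpose_mul matrix_mul_assoc R0(2))
      also have "\<dots> = eta p"
        using lam(1) by (simp add: R0(3) matrix_mult_simps para_of_to(2)[OF T'])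
      finally show "(para_to p T' ** R0, mat 1) \<in> carrier ?G"
        by (simp add: O_real_iff' transpose_mat)
      show "phi (para_to p T' ** R0, mat 1) = T'"
        by (simp add: phi_def R0R0 transpose_mat eta_cancel matrix_mul_assoc para_of_to(1)[OF T'])
    qed auto
  qed
qed

section \<open>The swap of the two halves and split signature\<close>

lemma swap_mat_mult_vector:
  assumes m: "CARD('m::finite) = 2 * p"
  shows "swap_mat *v v = (\<chi> i :: 'm. v $ idx ((pos i + p) mod (2 * p)))"
proof -
  have "pos j = (pos i + p) mod (2 * p) \<longleftrightarrow> j = idx ((pos i + p) mod (2 * p))" for i j :: 'm
    using m pos_less[of i] pos_idx[of "(pos i + p) mod (2 * p)", where 'm='m] idx_pos[of j] by fastforce
  then show ?thesis
    using m by (simp add: vec_eq_iff matrix_vector_mult_def swap_mat_def if_distrib[of "\<lambda>x. x * _"] cong: if_cong)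
qed

text \<open>The swap exchanges the positions below \<open>p\<close> with the others, hence the two
  signs of \<open>eta p\<close>. It is therefore an involutive anti-isometry and can serve as base
  point for \<open>lam = - 1\<close>.\<close>

lemma swap_mat_properties:
  assumes m: "CARD('m::finite) = 2 * p"
  shows "swap_mat ** swap_mat = (mat 1 :: real^'m^'m)" "transpose swap_mat = (swap_mat :: real^'m^'m)"
    "swap_mat ** eta p ** swap_mat = ((- 1) *\<^sub>R eta p :: real^'m^'m)"
proof -
  have tau: "((k + p) mod (2 * p) + p) mod (2 * p) = k" "(k + p) mod (2 * p) < p \<longleftrightarrow> \<not> k < p" "(k + p) mod (2 * p) < 2 * p"
    if "k < 2 * p" for k
  proof -
    have "(k + p) mod (2 * p) = (if k < p then k + p else k - p)"
      using that by (auto simp: mod_if le_mod_geq)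
    then show "((k + p) mod (2 * p) + p) mod (2 * p) = k" "(k + p) mod (2 * p) < p \<longleftrightarrow> \<not> k < p"
      "(k + p) mod (2 * p) < 2 * p"
      using that by (auto simp: mod_if)
  qed
  have pos: "pos (i :: 'm) < 2 * p" for i using pos_less[of i] m by simp
  have pi: "pos (idx ((pos i + p) mod (2 * p)) :: 'm) = (pos i + p) mod (2 * p)" for i :: 'm
    using pos_idx tau(3)[OF pos] m by metis
  show "swap_mat ** swap_mat = (mat 1 :: real^'m^'m)"
    by (simp add: matrix_eq matrix_vector_mul_assoc[symmetric] swap_mat_mult_vector[OF m] pi tau[OF pos] idx_pos
        vec_eq_iff)
  show "transpose swap_mat = (swap_mat :: real^'m^'m)"
    using m tau(1)[OF pos] by (simp add: vec_eq_iff transpose_def swap_mat_def)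
  show "swap_mat ** eta p ** swap_mat = ((- 1) *\<^sub>R eta p :: real^'m^'m)"
    by (simp add: matrix_eq matrix_vector_mul_assoc[symmetric] swap_mat_mult_vector[OF m] pi tau[OF pos] idx_pos
        eta_mult_vector vec_eq_iff neg_matrix_vector)
qed

text \<open>In an orthonormal frame a structure yields \<open>R\<close> with
  \<open>R ** eta p ** transpose R = - eta p\<close>. So \<open>eta p\<close> is congruent to its
  negative, and the law of inertia compares \<open>(p, q)\<close> with
  \<open>(q, p)\<close>.\<close>

lemma neutral_signature:
  assumes h: "has_signature (\<lambda>u v. u \<bullet> (h *v v)) p q" and T: "fiber_pred (- 1) 1 (h :: real^'m^'m) T"
  shows "p = q"
proof -
  obtain E :: "real^'m^'m" where E: "transpose E ** h ** E = eta p" by (rule orthonormal_frame[OF h])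
  have NE: "(eta p ** transpose E ** h) ** E = mat 1"
    using E by (simp add: matrix_mul_assoc[symmetric] eta_mult_eta)
  have "fiber_pred (- 1) 1 (eta p) (GG (eta p ** transpose E ** h) E ** T ** GG E (eta p ** transpose E ** h))"
    using fiber_pred_natural[OF matrix_mult_left_right[OF NE] has_signature_matrix(2)[OF h]]
      GG_conj_back[OF NE] T unfolding E by metis
  from para_of_to(2)[OF this] obtain R :: "real^'m^'m" where R: "R ** eta p ** transpose R = (- 1) *\<^sub>R eta p" by blast
  have eta: "has_signature (\<lambda>u v. u \<bullet> (eta p *v v :: real^'m)) p q"
    using has_signature_congruence[OF NE h] unfolding E .
  have "R ** (- (eta p ** transpose R ** eta p)) = - (R ** eta p ** transpose R) ** eta p"
    by (simp add: matrix_mult_simps matrix_mul_assoc)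
  also have "\<dots> = mat 1" unfolding R by (simp add: eta_mult_eta matrix_mult_simps)
  finally have inv: "R ** (- (eta p ** transpose R ** eta p)) = mat 1" .
  have "transpose (- (eta p ** transpose R ** eta p)) ** transpose R = mat 1"
    by (simp add: matrix_transpose_mul[symmetric] inv transpose_mat)
  from has_signature_congruence[OF this eta] have "has_signature (\<lambda>u v. u \<bullet> (((- 1) *\<^sub>R eta p) *v v :: real^'m)) p q"
    unfolding transpose_transpose R .
  then have "has_signature (\<lambda>u v. - (u \<bullet> (eta p *v v :: real^'m))) p q"
    by (simp add: neg_matrix_vector)
  from has_signature_neg[OF this] have "has_signature (\<lambda>u v. u \<bullet> (eta p *v v :: real^'m)) q p" by simp
  with eta show "p = q" by (rule has_signature_unique)
qed

section \<open>Complex matrices as real block matrices\<close>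

definition Rem :: "complex^'n^'k \<Rightarrow> real^'n^'k" where "Rem a = (\<chi> i j. Re (a $ i $ j))"
definition Imm :: "complex^'n^'k \<Rightarrow> real^'n^'k" where "Imm a = (\<chi> i j. Im (a $ i $ j))"

definition C2R :: "complex^'m^'m \<Rightarrow> real^('m::finite + 'm)^('m + 'm)" where
  "C2R a = blk (Rem a) (- Imm a) (Imm a) (Rem a)"

definition R2C :: "real^('m::finite + 'm)^('m + 'm) \<Rightarrow> complex^'m^'m" where
  "R2C T = (\<chi> i j. Complex (ul T $ i $ j) (ll T $ i $ j))"

text \<open>Multiplication by the imaginary unit, with real parts in the \<open>Inl\<close> and
  imaginary parts in the \<open>Inr\<close> components.\<close>

definition Js :: "real^('m::finite + 'm)^('m + 'm)" where "Js = blk 0 (- mat 1) (mat 1) 0"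

text \<open>The real part of the form \<open>Z\<^sup>t W\<close>; its imaginary part is \<open>- Bs (Js Z) W\<close>.\<close>

definition Bs :: "real^('m::finite + 'm)^('m + 'm)" where "Bs = blk (mat 1) 0 0 (- mat 1)"

lemma complex_mat_eq_iff: "a = b \<longleftrightarrow> Rem a = Rem b \<and> Imm a = Imm b"
  by (auto simp: vec_eq_iff Rem_def Imm_def complex_eq_iff)

lemma Rem_Imm_mult: "Rem (a ** b) = Rem a ** Rem b - Imm a ** Imm b" "Imm (a ** b) = Rem a ** Imm b + Imm a ** Rem b"
  by (simp_all add: vec_eq_iff Rem_def Imm_def matrix_matrix_mult_def sum_subtractf sum.distrib)

lemma Rem_Imm_transpose: "Rem (transpose a) = transpose (Rem a)" "Imm (transpose a) = transpose (Imm a)"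
  by (simp_all add: vec_eq_iff Rem_def Imm_def transpose_def)

lemma Rem_Imm_mat: "Rem (mat 1) = mat 1" "Imm (mat 1) = 0"
  by (simp_all add: vec_eq_iff Rem_def Imm_def mat_def)

lemma C2R_mult: "C2R (a ** b) = C2R a ** C2R b"
  by (simp add: C2R_def blk_mult Rem_Imm_mult matrix_mult_simps blk_eq_iff)

lemma C2R_one: "C2R (mat 1) = mat 1"
  by (simp add: C2R_def Rem_Imm_mat mat_blk[of 1])

lemma C2R_eq_iff: "C2R a = C2R b \<longleftrightarrow> a = b"
  by (auto simp: C2R_def blk_eq_iff complex_mat_eq_iff)

lemma Bs_mult: "Bs ** Bs = mat 1" "transpose Bs = Bs"
  by (simp_all add: Bs_def blk_mult mat_blk[of 1] matrix_mult_simps transpose_blk transpose_simps)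

lemma Js_mult: "Js ** Js = - mat 1" "transpose Js = - Js" "Js ** Bs = - (Bs ** Js)"
  by (simp_all add: Js_def Bs_def blk_mult mat_blk[of 1] matrix_mult_simps transpose_blk transpose_simps blk_linear)

text \<open>The complex transpose is the adjoint for the real form \<open>Bs\<close>, whereas the
  transpose of the real block matrix corresponds to the conjugate transpose.\<close>

lemma C2R_transpose: "C2R (transpose a) = Bs ** transpose (C2R a) ** Bs"
  by (simp add: C2R_def Bs_def blk_mult matrix_mult_simps transpose_blk transpose_simps Rem_Imm_transpose)

lemma Js_C2R: "Js ** C2R a = C2R a ** Js"
  by (simp add: C2R_def Js_def blk_mult matrix_mult_simps)

lemma C2R_R2C:
  assumes "T ** Js = Js ** T"
  shows "C2R (R2C T) = T"
proof -
  obtain a b c d where T: "T = blk a b c d" by (rule blk_exhaust)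
  have "b = - c" "d = a"
    using arg_cong[OF assms, of ul] arg_cong[OF assms, of ll]
    by (simp_all add: T Js_def blk_mult matrix_mult_simps)
  moreover have "Rem (R2C T) = a" "Imm (R2C T) = c"
    by (simp_all add: T R2C_def Rem_def Imm_def vec_eq_iff)
  ultimately show ?thesis by (simp add: T C2R_def)
qed

lemma bounded_linear_C2R: "bounded_linear C2R"
proof -
  have "bounded_linear Rem" "bounded_linear Imm"
    by (rule bounded_linearI'; simp add: Rem_def Imm_def vec_eq_iff)+
  then show ?thesis unfolding C2R_def[abs_def]
    by (intro bounded_linear_blk bounded_linear_minus)
qed

lemma bounded_linear_R2C: "bounded_linear R2C"
  by (rule bounded_linearI') (simp_all add: R2C_def ul_def ll_def vec_eq_iff complex_eq_iff)

section \<open>The complex orthogonal group\<close>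

lemma pairing_mult_axis: "pairing (axis i 1) ((X :: complex^'m^'m) *v axis j 1) = X $ i $ j"
  by (simp add: pairing_def axis_def matrix_vector_mult_def if_distrib[of "\<lambda>x. x * _"]
      if_distrib[of "\<lambda>x. _ * x"] cong: if_cong)

lemma pairing_mult: "pairing (a *v Z) W = pairing Z (transpose a *v (W :: complex^'m))"
proof -
  have "pairing (a *v Z) W = (\<Sum>i\<in>UNIV. \<Sum>j\<in>UNIV. a $ i $ j * Z $ j * W $ i)"
    by (simp add: pairing_def matrix_vector_mult_def sum_distrib_right)
  also have "\<dots> = (\<Sum>j\<in>UNIV. \<Sum>i\<in>UNIV. a $ i $ j * Z $ j * W $ i)" by (rule sum.swap)
  also have "\<dots> = pairing Z (transpose a *v W)"
    by (simp add: pairing_def matrix_vector_mult_def sum_distrib_left transpose_def mult_ac)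
  finally show ?thesis .
qed

lemma pairing_preserved_iff:
  "(\<forall>Z W. pairing (a *v Z) (a *v W) = pairing Z W) \<longleftrightarrow> transpose a ** a = (mat 1 :: complex^'m^'m)"
proof
  assume *: "\<forall>Z W. pairing (a *v Z) (a *v W) = pairing Z W"
  have "(transpose a ** a) $ i $ j = mat 1 $ i $ j" for i j
    using *[rule_format, of "axis i 1" "axis j 1"]
    unfolding pairing_mult matrix_vector_mul_assoc pairing_mult_axis
    using pairing_mult_axis[of i "mat 1" j] by (simp add: matrix_vector_mul_lid)
  then show "transpose a ** a = mat 1" by (simp add: vec_eq_iff)
next
  assume "transpose a ** a = mat 1"
  then show "\<forall>Z W. pairing (a *v Z) (a *v W) = pairing Z W"
    by (simp add: pairing_mult matrix_vector_mul_assoc matrix_vector_mul_lid)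
qed

lemma O_complex_iff: "a \<in> carrier O_complex \<longleftrightarrow> transpose a ** a = (mat 1 :: complex^'m^'m)"
proof -
  have "invertible a" if "transpose a ** a = (mat 1 :: complex^'m^'m)"
    using that by (auto simp: invertible_left_inverse)
  then show ?thesis unfolding O_complex_def using pairing_preserved_iff[of a] by auto
qed

lemma O_complex_inverse: "a \<in> carrier O_complex \<Longrightarrow> a ** transpose a = (mat 1 :: complex^'m^'m)"
  using matrix_left_right_inverse[of "transpose a" a] by (simp add: O_complex_iff)

lemma O_complex_mult: "mult O_complex = (**)" "one O_complex = mat 1"
  by (simp_all add: O_complex_def)

lemma O_complex_closed_mult:
  assumes "a \<in> carrier O_complex" "b \<in> carrier O_complex"
  shows "a ** b \<in> carrier (O_complex :: (complex^'m^'m) monoid)"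
proof -
  have "transpose (a ** b) ** (a ** b) = transpose b ** (transpose a ** a) ** b"
    by (simp only: matrix_transpose_mul matrix_mul_assoc)
  then show ?thesis using assms by (simp add: O_complex_iff)
qed

lemma O_complex_transpose: "a \<in> carrier O_complex \<Longrightarrow> transpose a \<in> carrier (O_complex :: (complex^'m^'m) monoid)"
  using O_complex_inverse[of a] by (simp add: O_complex_iff transpose_transpose)

lemma O_complex_one: "mat 1 \<in> carrier (O_complex :: (complex^'m^'m) monoid)"
  by (simp add: O_complex_iff transpose_mat)

lemma group_O_complex: "group (O_complex :: (complex^'m^'m) monoid)"
proof (rule groupI)
  show "\<exists>b\<in>carrier O_complex. b \<otimes>\<^bsub>O_complex\<^esub> a = \<one>\<^bsub>O_complex\<^esub>"
    if "a \<in> carrier (O_complex :: (complex^'m^'m) monoid)" for a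
    using O_complex_transpose[OF that] that by (auto simp: O_complex_mult O_complex_iff)
qed (simp_all add: O_complex_mult O_complex_closed_mult O_complex_one matrix_mul_assoc)

lemma inv_O_complex:
  "a \<in> carrier (O_complex :: (complex^'m^'m) monoid) \<Longrightarrow> inv\<^bsub>O_complex\<^esub> a = transpose a"
  by (rule group.inv_equality[OF group_O_complex])
    (simp_all add: O_complex_mult O_complex_transpose, simp add: O_complex_iff)

lemma closed_O_complex: "closed (carrier (O_complex :: (complex^'m^'m) monoid))"
proof -
  have "carrier (O_complex :: (complex^'m^'m) monoid) = {a. transpose a ** a = mat 1}" using O_complex_iff by blast
  then show ?thesis
    by (simp only:) (intro closed_Collect_eq continuous_on_matrix_mult continuous_on_transpose
        continuous_on_id continuous_on_const)
qed

lemma C2R_orthogonal: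
  assumes "a \<in> carrier O_complex"
  shows "C2R (transpose a) ** C2R a = mat 1" "C2R a ** C2R (transpose a) = mat 1"
    "transpose (C2R a) ** Bs ** C2R a = Bs"
proof -
  show 1: "C2R (transpose a) ** C2R a = mat 1"
    using assms by (simp add: C2R_mult[symmetric] O_complex_iff C2R_one)
  then show "C2R a ** C2R (transpose a) = mat 1" by (rule matrix_mult_left_right)
  have "transpose (C2R a) ** Bs ** C2R a = (Bs ** Bs) ** transpose (C2R a) ** Bs ** C2R a" by (simp add: Bs_mult)
  also have "\<dots> = Bs ** (C2R (transpose a) ** C2R a)"
    by (simp only: C2R_transpose matrix_mul_assoc)
  finally show "transpose (C2R a) ** Bs ** C2R a = Bs" by (simp add: 1)
qed

section \<open>The typical fiber for \<open>\<lambda> = \<ell>\<close>\<close>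

text \<open>For \<open>lam * lam = 1\<close> these are the antilinear \<open>T\<close> with T^2 =
  lam and c(T u, T v) = cnj (c(u, v)), where c(Z, W) = Z^t W: the last condition gives the real
  part, and antilinearity adds the imaginary part. They are real structures for
  \<open>lam = 1\<close> and quaternionic structures for \<open>lam = - 1\<close>.\<close>

definition std_pred :: "real \<Rightarrow> real^('m::finite + 'm)^('m + 'm) \<Rightarrow> bool" where
  "std_pred lam T \<longleftrightarrow> T ** T = mat lam \<and> T ** Js = - (Js ** T) \<and> transpose T ** Bs = lam *\<^sub>R (Bs ** T)"

text \<open>The antilinear map \<open>Z \<mapsto> \<Theta> (cnj Z)\<close> for a real matrix \<open>\<Theta>\<close>.\<close>

definition antilin :: "real^'m^'m \<Rightarrow> real^('m::finite + 'm)^('m + 'm)" where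
  "antilin Th = blk Th 0 0 (- Th)"

text \<open>Conjugation of the base point \<open>antilin Th\<close>. On \<open>O_complex\<close> the
  transpose is the inverse; writing it as the transpose makes the map smooth on the whole matrix
  space.\<close>

definition orbit_map :: "real^'m^'m \<Rightarrow> complex^'m^'m \<Rightarrow> real^('m::finite + 'm)^('m + 'm)" where
  "orbit_map Th a = C2R a ** antilin Th ** C2R (transpose a)"

lemma std_pred_antilin:
  assumes "Th ** Th = mat lam" "transpose Th = lam *\<^sub>R Th"
  shows "std_pred lam (antilin Th)"
  using assms unfolding std_pred_def antilin_def Js_def Bs_def
  by (simp add: blk_mult mat_blk[of lam] matrix_mult_simps transpose_blk transpose_simps blk_linear)

lemma std_pred_conj:
  assumes a: "a \<in> carrier O_complex" and T: "std_pred lam T"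
  shows "std_pred lam (C2R a ** T ** C2R (transpose a))"
proof -
  note C = C2R_orthogonal[OF a]
  have "C2R a ** Js ** C2R (transpose a) = Js ** (C2R a ** C2R (transpose a))"
    by (simp add: Js_C2R[symmetric] matrix_mul_assoc)
  then have J: "C2R a ** Js ** C2R (transpose a) = Js" by (simp add: C(2))
  have "(C2R a ** T ** C2R (transpose a)) ** Js = - (Js ** (C2R a ** T ** C2R (transpose a)))"
    using anticommute_conj[OF C(1), of T Js] T unfolding J std_pred_def by blast
  moreover have "(C2R a ** T ** C2R (transpose a)) ** (C2R a ** T ** C2R (transpose a)) = mat lam"
    using T C(2) unfolding matrix_conj_mult[OF C(1)] std_pred_def
    by (simp add: mat_scaleR[of lam] matrix_mult_simps)
  ultimately show ?thesis
    using conj_transpose[OF C(1,3)] T unfolding std_pred_def by blast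
qed

lemma orbit_map_eq_iff:
  assumes a: "a \<in> carrier O_complex" and b: "b \<in> carrier O_complex"
  shows "orbit_map Th a = orbit_map Th b \<longleftrightarrow>
    C2R (transpose a ** b) ** antilin Th = antilin Th ** C2R (transpose a ** b)"
proof -
  note A = C2R_orthogonal[OF a] and B = C2R_orthogonal[OF b]
  have 1: "C2R (transpose a) ** orbit_map Th a ** C2R b = (C2R (transpose a) ** C2R a) ** antilin Th ** C2R (transpose a ** b)"
    unfolding orbit_map_def C2R_mult by (simp only: matrix_mul_assoc)
  have 2: "C2R (transpose a) ** orbit_map Th b ** C2R b = C2R (transpose a ** b) ** antilin Th ** (C2R (transpose b) ** C2R b)"
    unfolding orbit_map_def C2R_mult by (simp only: matrix_mul_assoc)
  have 3: "X = Y" if "C2R (transpose a) ** X ** C2R b = C2R (transpose a) ** Y ** C2R b" for X Y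
  proof -
    have "(C2R a ** C2R (transpose a)) ** X ** (C2R b ** C2R (transpose b))
        = (C2R a ** C2R (transpose a)) ** Y ** (C2R b ** C2R (transpose b))"
      using arg_cong[OF that, of "\<lambda>X. C2R a ** X ** C2R (transpose b)"] by (simp only: matrix_mul_assoc)
    then show ?thesis by (simp add: A B)
  qed
  show ?thesis using 1 2 3 unfolding A(1) B(1) by (metis matrix_mul_lid matrix_mul_rid)
qed

definition stabilizer :: "real^'m^'m \<Rightarrow> (complex^'m^'m) set" where
  "stabilizer Th = {a \<in> carrier O_complex. C2R a ** antilin Th = antilin Th ** C2R a}"

lemma closed_stabilizer: "closed (stabilizer Th)"
proof -
  have "continuous_on UNIV C2R" by (rule linear_continuous_on[OF bounded_linear_C2R])
  then show ?thesis
    unfolding stabilizer_def Collect_conj_eq Collect_mem_eq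
    by (intro closed_Int closed_O_complex closed_Collect_eq continuous_on_matrix_mult continuous_on_const)
qed

lemma subgroup_stabilizer: "subgroup (stabilizer Th) O_complex"
proof (rule group.subgroupI[OF group_O_complex])
  show "stabilizer Th \<subseteq> carrier O_complex" by (auto simp: stabilizer_def)
  have "mat 1 \<in> stabilizer Th" by (simp add: stabilizer_def O_complex_one C2R_one)
  then show "stabilizer Th \<noteq> {}" by blast
  fix a assume a: "a \<in> stabilizer Th"
  then have ac: "a \<in> carrier O_complex" and comm: "C2R a ** antilin Th = antilin Th ** C2R a"
    by (auto simp: stabilizer_def)
  note C = C2R_orthogonal[OF ac]
  have "C2R (transpose a) ** antilin Th = C2R (transpose a) ** (antilin Th ** C2R a) ** C2R (transpose a)"
    by (simp add: matrix_mul_assoc[symmetric] C(2))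
  also have "\<dots> = (C2R (transpose a) ** C2R a) ** antilin Th ** C2R (transpose a)"
    unfolding comm[symmetric] by (simp only: matrix_mul_assoc)
  finally show "inv\<^bsub>O_complex\<^esub> a \<in> stabilizer Th"
    by (simp add: inv_O_complex[OF ac] stabilizer_def O_complex_transpose[OF ac] C(1))
  fix b assume b: "b \<in> stabilizer Th"
  then have bc: "b \<in> carrier O_complex" and comm': "C2R b ** antilin Th = antilin Th ** C2R b"
    by (auto simp: stabilizer_def)
  have "C2R (a ** b) ** antilin Th = C2R a ** (C2R b ** antilin Th)"
    by (simp only: C2R_mult matrix_mul_assoc)
  also have "\<dots> = (C2R a ** antilin Th) ** C2R b" by (simp only: comm' matrix_mul_assoc)
  also have "\<dots> = antilin Th ** C2R (a ** b)" by (simp only: comm C2R_mult matrix_mul_assoc)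
  finally show "a \<otimes>\<^bsub>O_complex\<^esub> b \<in> stabilizer Th"
    by (simp add: stabilizer_def O_complex_mult O_complex_closed_mult ac bc)
qed

lemma smooth_on_orbit_map: "smooth_on UNIV (orbit_map Th)"
  unfolding orbit_map_def[abs_def]
  by (intro smooth_on_matrix_mult smooth_on_const open_UNIV smooth_on_bounded_linear[OF bounded_linear_C2R]
      smooth_on_bounded_linear_comp[OF bounded_linear_C2R] smooth_on_bounded_linear[OF bounded_linear_transpose])

text \<open>For involutions (or complex structures) \<open>T\<close> and \<open>S\<close>, \<open>u = (1 + \<lambda> T S) / 2\<close> satisfies \<open>T u = u S\<close>;
  it is made orthogonal by the inverse square root of \<open>u u\<^sup>*\<close>, which commutes with \<open>T\<close>.\<close>

lemma orbit_map_local_section: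
  fixes Th :: "real^'m::finite^'m"
  assumes lam: "lam * lam = 1" and Th: "Th ** Th = mat lam" "transpose Th = lam *\<^sub>R Th"
    and a1: "a1 \<in> carrier O_complex"
  shows "\<exists>W \<alpha>. open W \<and> orbit_map Th a1 \<in> W \<and> smooth_on W \<alpha> \<and>
    (\<forall>T\<in>W. std_pred lam T \<longrightarrow> \<alpha> T \<in> carrier O_complex \<and> orbit_map Th (\<alpha> T) = T)"
proof -
  define S where "S = orbit_map Th a1"
  have "std_pred lam S" unfolding S_def orbit_map_def by (rule std_pred_conj[OF a1 std_pred_antilin[OF Th]])
  then have S: "S ** S = mat lam" "S ** Js = - (Js ** S)" "transpose S ** Bs = lam *\<^sub>R (Bs ** S)"
    by (auto simp: std_pred_def)
  obtain V and r :: "real^('m + 'm)^('m + 'm) \<Rightarrow> real^('m + 'm)^('m + 'm)" where V: "open V" "mat 1 \<in> V" and r: "smooth_on V r"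
    and tr: "\<And>w. w \<in> V \<Longrightarrow> transpose w \<in> V"
    and rr: "\<And>w. w \<in> V \<Longrightarrow> r w ** w ** r w = mat 1"
    and rt: "\<And>w. w \<in> V \<Longrightarrow> r (transpose w) = transpose (r w)"
    and rc: "\<And>w w' C. w \<in> V \<Longrightarrow> w' \<in> V \<Longrightarrow> w ** C = C ** w' \<Longrightarrow> r w ** C = C ** r w'"
  proof (rule matrix_inverse_sqrt_near_identity[where 'n="'m + 'm"], goal_cases)
    case (1 W r)
    show ?thesis using 1(2-) by (rule that)
  qed
  define u where "u T = (1/2) *\<^sub>R (mat 1 + lam *\<^sub>R (T ** S))" for T
  \<comment> \<open>The \<open>Bs\<close>-adjoint of \<open>u T\<close>. At \<open>T = S\<close>
    both are the identity, because S^2 = lam and \<open>lam * lam = 1\<close>.\<close>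
  define v where "v T = (1/2) *\<^sub>R (mat 1 + lam *\<^sub>R (S ** T))" for T
  define w where "w T = u T ** v T" for T
  have lin: "smooth_on UNIV (\<lambda>T :: real^('m + 'm)^('m + 'm). T)"
    by (rule smooth_on_bounded_linear[OF bounded_linear_ident open_UNIV])
  have su: "smooth_on UNIV u" and sv: "smooth_on UNIV v"
    unfolding u_def v_def
    by (intro smooth_on_bounded_linear_comp[OF bounded_linear_scaleR_right] smooth_on_add smooth_on_const
        open_UNIV smooth_on_matrix_mult lin)+
  have sw: "smooth_on UNIV w" unfolding w_def by (intro smooth_on_matrix_mult open_UNIV su sv)
  define W where "W = UNIV \<inter> w -` V"
  have W: "open W" unfolding W_def
    by (rule continuous_open_preimage[OF smooth_on_continuous_on[OF sw] open_UNIV V(1)])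
  have "lam *\<^sub>R mat lam = (mat 1 :: real^('m + 'm)^('m + 'm))" by (simp add: scaleR_mat lam)
  then have "u S = mat 1" "v S = mat 1"
    unfolding u_def v_def by (simp_all add: S(1) flip: scaleR_2)
  then have SW: "S \<in> W" using V(2) by (simp add: W_def w_def)
  \<comment> \<open>\<open>S\<close> is already the image of the base point under \<open>a1\<close>,
    so the element that carries \<open>S\<close> to \<open>T\<close> is multiplied by
    \<open>a1\<close> on the right.\<close>
  define \<alpha> where "\<alpha> T = R2C (r (w T) ** u T) ** a1" for T
  have "smooth_on W \<alpha>"
    unfolding \<alpha>_def
    by (intro smooth_on_matrix_mult smooth_on_const W smooth_on_bounded_linear_comp[OF bounded_linear_R2C]
        smooth_on_compose[OF W V(1) r] smooth_on_subset[OF su] smooth_on_subset[OF sw])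
      (auto simp: W_def)
  moreover have "\<alpha> T \<in> carrier O_complex \<and> orbit_map Th (\<alpha> T) = T" if TW: "T \<in> W" and "std_pred lam T" for T
  proof -
    have T: "T ** T = mat lam" "T ** Js = - (Js ** T)" "transpose T ** Bs = lam *\<^sub>R (Bs ** T)"
      using \<open>std_pred lam T\<close> by (auto simp: std_pred_def)
    have wV: "w T \<in> V" using TW by (simp add: W_def)
    have l2: "lam *\<^sub>R (mat lam ** X) = X" "lam *\<^sub>R (X ** mat lam) = X" for X :: "real^('m + 'm)^('m + 'm)"
      by (simp_all add: mat_scaleR[of lam] matrix_mult_simps lam)
    have TTS: "lam *\<^sub>R (T ** (T ** S)) = S" and TSS: "lam *\<^sub>R (T ** S ** S) = T"
      and SST: "lam *\<^sub>R (S ** (S ** T)) = T" and STT: "lam *\<^sub>R (S ** T ** T) = S"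
      using l2 S(1) T(1) by (simp_all add: matrix_mul_assoc[of T T] matrix_mul_assoc[of S S] matrix_mul_assoc[symmetric, of _ S S]
          matrix_mul_assoc[symmetric, of _ T T])
    have Tu: "T ** u T = u T ** S"
      by (simp add: u_def matrix_mult_simps TTS TSS add.commute)
    have Sv: "S ** v T = v T ** T"
      by (simp add: v_def matrix_mult_simps SST STT add.commute)
    have Tw: "w T ** T = T ** w T"
      unfolding w_def by (metis Sv Tu matrix_mul_assoc)
    have uJ: "u T ** Js = Js ** u T" and vJ: "v T ** Js = Js ** v T"
      using S(2) T(2)
      by (simp_all add: u_def v_def matrix_mult_simps matrix_mul_assoc[symmetric])
        (simp_all add: matrix_mul_assoc matrix_mult_simps)
    have wJ: "w T ** Js = Js ** w T" unfolding w_def by (metis uJ vJ matrix_mul_assoc)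
    have uB: "transpose (u T) ** Bs = Bs ** v T"
    proof -
      have "transpose S ** transpose T ** Bs = lam *\<^sub>R ((transpose S ** Bs) ** T)"
        by (simp add: matrix_mul_assoc[symmetric] T(3) matrix_mult_simps)
      also have "\<dots> = Bs ** (S ** T)" by (simp add: S(3) matrix_mult_simps lam matrix_mul_assoc)
      finally show ?thesis by (simp add: u_def v_def transpose_simps matrix_mult_simps)
    qed
    have vB: "transpose (v T) ** Bs = Bs ** u T"
    proof -
      have "transpose T ** transpose S ** Bs = lam *\<^sub>R ((transpose T ** Bs) ** S)"
        by (simp add: matrix_mul_assoc[symmetric] S(3) matrix_mult_simps)
      also have "\<dots> = Bs ** (T ** S)" by (simp add: T(3) matrix_mult_simps lam matrix_mul_assoc)
      finally show ?thesis by (simp add: u_def v_def transpose_simps matrix_mult_simps)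
    qed
    have "transpose (w T) ** Bs = Bs ** w T"
      unfolding w_def matrix_transpose_mul by (metis uB vB matrix_mul_assoc)
    \<comment> \<open>The commutation rule for the pair \<open>transpose (w T)\<close>,
      \<open>w T\<close> with \<open>Bs\<close> as intertwiner: the inverse root of a
      \<open>Bs\<close>-self-adjoint matrix is again \<open>Bs\<close>-self-adjoint.\<close>
    then have rB: "transpose (r (w T)) ** Bs = Bs ** r (w T)"
      using rc[OF tr[OF wV] wV] rt[OF wV] by simp
    have rT: "r (w T) ** T = T ** r (w T)" and rJ: "r (w T) ** Js = Js ** r (w T)"
      using rc[OF wV wV] Tw wJ by blast+
    \<comment> \<open>The orthogonal factor in a polar decomposition of \<open>u T\<close>:
      \<open>a ** a'\<close> is \<open>r (w T) ** w T ** r (w T) = mat 1\<close>, and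
      \<open>a'\<close> is the \<open>Bs\<close>-adjoint of \<open>a\<close>.\<close>
    define a where "a = r (w T) ** u T"
    define a' where "a' = v T ** r (w T)"
    have aa': "a ** a' = mat 1" using rr[OF wV] by (simp add: a_def a'_def w_def matrix_mul_assoc)
    have a'a: "a' ** a = mat 1" by (rule matrix_mult_left_right[OF aa'])
    have "a ** Js = Js ** a" unfolding a_def by (metis uJ rJ matrix_mul_assoc)
    then have Ca: "C2R (R2C a) = a" by (rule C2R_R2C)
    have "transpose a ** Bs = transpose (u T) ** (transpose (r (w T)) ** Bs)"
      by (simp only: a_def matrix_transpose_mul matrix_mul_assoc)
    also have "\<dots> = Bs ** a'"
      by (simp add: rB a'_def) (simp only: matrix_mul_assoc uB)
    finally have aB: "transpose a ** Bs = Bs ** a'" .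
    have Ca': "C2R (transpose (R2C a)) = a'"
      by (simp add: C2R_transpose Ca matrix_mul_assoc[symmetric] aB) (simp add: matrix_mul_assoc Bs_mult)
    have "C2R (transpose (R2C a) ** R2C a) = C2R (mat 1)"
      by (simp add: C2R_mult Ca Ca' a'a C2R_one)
    then have ca: "R2C a \<in> carrier O_complex" by (simp add: C2R_eq_iff O_complex_iff)
    have "orbit_map Th (\<alpha> T) = a ** S ** a'"
      by (simp add: orbit_map_def \<alpha>_def a_def[symmetric] C2R_mult Ca Ca' matrix_transpose_mul S_def matrix_mul_assoc)
    also have "\<dots> = r (w T) ** (u T ** S) ** a'" by (simp only: a_def matrix_mul_assoc)
    also have "\<dots> = (r (w T) ** T) ** u T ** a'" by (simp only: Tu[symmetric] matrix_mul_assoc)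
    also have "\<dots> = T ** (a ** a')" by (simp only: rT a_def matrix_mul_assoc)
    finally have "orbit_map Th (\<alpha> T) = T" by (simp add: aa')
    moreover have "\<alpha> T \<in> carrier O_complex"
      unfolding \<alpha>_def a_def[symmetric] by (rule O_complex_closed_mult[OF ca a1])
    ultimately show ?thesis by blast
  qed
  ultimately show ?thesis using W SW unfolding S_def by blast
qed

section \<open>Transitivity\<close>

text \<open>The two hypotheses are the real and, up to sign, the imaginary part of orthonormality
  for the complex form, so the complex matrix with columns \<open>x i\<close> is orthogonal.\<close>

lemma C2R_of_frame:
  fixes x :: "'m::finite \<Rightarrow> real^('m + 'm)"
  assumes X: "\<And>i j. x i \<bullet> (Bs *v x j) = (if i = j then 1 else 0)"
    and JX: "\<And>i j. (Js *v x i) \<bullet> (Bs *v x j) = 0"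
  shows "\<exists>a\<in>carrier O_complex. \<forall>i. C2R a *v axis (Inl i) 1 = x i \<and> C2R a *v axis (Inr i) 1 = Js *v x i"
proof -
  define a :: "complex^'m^'m" where "a = (\<chi> k i. Complex (x i $ Inl k) (x i $ Inr k))"
  have Ja: "Js *v axis (Inl i) 1 = (axis (Inr i) 1 :: real^('m + 'm))" for i
    by (simp add: vec_sum_eq_iff Js_def blk_mult_vector vpart_def fpart_def axis_def matrix_vector_mul_lid)
      (auto simp: vec_eq_iff matrix_vector_mult_def mat_def if_distrib[of "\<lambda>x. x * _"] cong: if_cong)
  have 1: "C2R a *v axis (Inl i) 1 = x i" for i
    by (simp add: matrix_vector_mult_basis column_def vec_sum_eq_iff C2R_def a_def Rem_def Imm_def)
  have 2: "C2R a *v axis (Inr i) 1 = Js *v x i" for i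
    unfolding Ja[symmetric] matrix_vector_mul_assoc Js_C2R[symmetric]
    unfolding matrix_vector_mul_assoc[symmetric] 1 ..
  have B: "u \<bullet> (Bs *v w) = (\<Sum>k\<in>UNIV. u $ Inl k * w $ Inl k - u $ Inr k * w $ Inr k)" for u w :: "real^('m + 'm)"
    by (simp add: inner_vec_def sum_sum_type Bs_def blk_mult_vector vpart_def fpart_def matrix_vector_mul_lid
        neg_matrix_vector sum_subtractf sum_negf)
  have J: "(Js *v u) $ Inl k = - u $ Inr k" "(Js *v u) $ Inr k = u $ Inl k" for u :: "real^('m + 'm)" and k
    by (simp_all add: Js_def blk_mult_vector vpart_def fpart_def matrix_vector_mul_lid neg_matrix_vector)
  have "(transpose a ** a) $ i $ j = mat 1 $ i $ j" for i j
  proof (rule complex_eqI)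
    show "Re ((transpose a ** a) $ i $ j) = Re (mat 1 $ i $ j)"
      using X[of i j] by (simp add: B matrix_matrix_mult_def transpose_def a_def mat_def)
    have "Im ((transpose a ** a) $ i $ j) = - ((Js *v x i) \<bullet> (Bs *v x j))"
      unfolding B J by (simp add: matrix_matrix_mult_def transpose_def a_def sum_negf[symmetric])
    then show "Im ((transpose a ** a) $ i $ j) = Im (mat 1 $ i $ j)"
      by (simp add: JX mat_def)
  qed
  then have "transpose a ** a = mat 1" by (simp add: vec_eq_iff)
  then show ?thesis using 1 2 by (intro bexI[of _ a]) (simp_all add: O_complex_iff)
qed

text \<open>An antilinear map is determined by its values on a complex basis. Since
  \<open>Th\<close> is real, the values on \<open>Js *v x i\<close> have the coefficients of
  \<open>- Th\<close>, which is the second block of \<open>antilin Th\<close>.\<close>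

lemma orbit_map_of_frame:
  fixes x :: "'m::finite \<Rightarrow> real^('m + 'm)"
  assumes T: "T ** Js = - (Js ** T)"
    and X: "\<And>i j. x i \<bullet> (Bs *v x j) = (if i = j then 1 else 0)"
    and JX: "\<And>i j. (Js *v x i) \<bullet> (Bs *v x j) = 0"
    and Tx: "\<And>i. T *v x i = (\<Sum>j\<in>UNIV. Th $ j $ i *\<^sub>R x j)"
  shows "\<exists>a\<in>carrier O_complex. orbit_map Th a = T"
proof -
  obtain a :: "complex^'m^'m" where a: "a \<in> carrier O_complex" and a1: "\<And>i. C2R a *v axis (Inl i) 1 = x i"
    and a2: "\<And>i. C2R a *v axis (Inr i) 1 = Js *v x i"
    using C2R_of_frame[of x, OF X JX] by blast
  have basis: "v = (\<Sum>j\<in>UNIV. v $ Inl j *\<^sub>R axis (Inl j) 1) + (\<Sum>j\<in>UNIV. v $ Inr j *\<^sub>R axis (Inr j) 1)"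
    for v :: "real^('m + 'm)"
    by (auto simp: vec_sum_eq_iff axis_def if_distrib[of "\<lambda>x. _ * x"] cong: if_cong)
  have C2Rv: "C2R a *v v = (\<Sum>j\<in>UNIV. v $ Inl j *\<^sub>R x j) + (\<Sum>j\<in>UNIV. v $ Inr j *\<^sub>R (Js *v x j))" for v
    by (subst basis[of v]) (simp add: matrix_vector_right_distrib linear_sum[OF matrix_vector_mul_linear]
        matrix_vector_mult_scaleR a1 a2)
  have col1: "(antilin Th *v axis (Inl i) 1) $ Inl j = Th $ j $ i" "(antilin Th *v axis (Inl i) 1) $ Inr j = 0"
    and col2: "(antilin Th *v axis (Inr i) 1) $ Inr j = - Th $ j $ i" "(antilin Th *v axis (Inr i) 1) $ Inl j = 0"
    for i j
    by (simp_all add: matrix_vector_mult_basis column_def antilin_def)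
  have TJ: "T *v (Js *v u) = - (Js *v (T *v u))" for u
    using T by (simp add: matrix_vector_mul_assoc neg_matrix_vector)
  have "(T ** C2R a) *v axis s 1 = (C2R a ** antilin Th) *v axis s 1" for s
  proof (cases s)
    case (Inl i)
    have "(C2R a ** antilin Th) *v axis s 1 = (\<Sum>j\<in>UNIV. Th $ j $ i *\<^sub>R x j)"
      unfolding Inl by (simp add: matrix_vector_mul_assoc[symmetric] C2Rv col1)
    moreover have "(T ** C2R a) *v axis s 1 = T *v x i"
      unfolding Inl by (simp add: matrix_vector_mul_assoc[symmetric] a1)
    ultimately show ?thesis by (simp only: Tx)
  next
    case (Inr i)
    have "(C2R a ** antilin Th) *v axis s 1 = - (\<Sum>j\<in>UNIV. Th $ j $ i *\<^sub>R (Js *v x j))"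
      unfolding Inr by (simp add: matrix_vector_mul_assoc[symmetric] C2Rv col2 sum_negf)
    also have "\<dots> = - (Js *v (T *v x i))"
      unfolding Tx by (simp add: linear_sum[OF matrix_vector_mul_linear] matrix_vector_mult_scaleR)
    also have "\<dots> = (T ** C2R a) *v axis s 1"
      unfolding Inr by (simp add: matrix_vector_mul_assoc[symmetric] a2 TJ)
    finally show ?thesis ..
  qed
  then have eq: "T ** C2R a = C2R a ** antilin Th"
    by (simp add: vec_eq_iff matrix_vector_mult_basis column_def)
  have "orbit_map Th a = T ** (C2R a ** C2R (transpose a))"
    unfolding orbit_map_def eq[symmetric] by (simp only: matrix_mul_assoc)
  then show ?thesis using a by (auto simp: C2R_orthogonal(2)[OF a])
qed

section \<open>Normal forms of real and quaternionic structures\<close>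

lemma Bs_bilinear: "bilinear (\<lambda>u v. u \<bullet> (Bs *v v))"
  by (rule bilinear_matrix)

lemma Bs_symmetric: "u \<bullet> (Bs *v v) = v \<bullet> (Bs *v u)"
  by (metis Bs_mult(2) inner_commute inner_transpose)

lemma Bs_nondegenerate: "(\<And>v. u \<bullet> (Bs *v v) = 0) \<Longrightarrow> u = 0"
  by (metis Bs_mult(1) inner_eq_zero_iff matrix_vector_mul_assoc matrix_vector_mul_lid)

lemma Js_Js: "Js *v (Js *v u) = - u"
  by (simp add: matrix_vector_mul_assoc Js_mult neg_matrix_vector matrix_vector_mul_lid)

lemma Bs_Js: "(Js *v u) \<bullet> (Bs *v v) = u \<bullet> (Bs *v (Js *v v))"
proof -
  have "(Js *v u) \<bullet> (Bs *v v) = u \<bullet> ((transpose Js ** Bs) *v v)"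
    by (simp only: inner_transpose matrix_vector_mul_assoc)
  also have "transpose Js ** Bs = Bs ** Js" by (simp add: Js_mult matrix_mult_simps)
  finally show ?thesis by (simp only: matrix_vector_mul_assoc)
qed

lemmas matrix_vector_linear = matrix_vector_right_distrib matrix_vector_mult_scaleR
  linear_neg[OF matrix_vector_mul_linear] linear_diff[OF matrix_vector_mul_linear]

context
  fixes lam :: real and T :: "real^('m::finite + 'm)^('m + 'm)"
  assumes T: "std_pred lam T"
begin

private abbreviation "X u v \<equiv> u \<bullet> (Bs *v v)"
private abbreviation "J u \<equiv> Js *v u"
private abbreviation "S u \<equiv> T *v u"

lemma std_pred_square: "S (S u) = lam *\<^sub>R u"
  using T by (simp add: std_pred_def matrix_vector_mul_assoc mat_scaleR[of lam] scaleR_vector matrix_vector_mul_lid)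

lemma std_pred_Js: "S (J u) = - J (S u)"
  using T by (simp add: std_pred_def matrix_vector_mul_assoc neg_matrix_vector)

lemma std_pred_Bs: "X (S u) v = lam * X u (S v)"
proof -
  have "X (S u) v = u \<bullet> ((transpose T ** Bs) *v v)" by (simp only: inner_transpose matrix_vector_mul_assoc)
  then show ?thesis using T by (simp add: std_pred_def scaleR_vector matrix_vector_mul_assoc)
qed

text \<open>\<open>B u v = X u (S v)\<close> is a real symmetric form whose signature is doubled,
  because \<open>B (J z) (J z) = B z z\<close>. Fixed vectors of \<open>T\<close> with
  \<open>B\<close>-squares 1 and -1 form a frame that is orthogonal for the complex form, with the
  same squares. Multiplying the negative vectors by i turns these squares into 1 and the eigenvalue
  1 of \<open>T\<close> into -1, so \<open>T\<close> has the matrix \<open>eta n\<close>.\<close>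

lemma real_transitivity:
  assumes lam1: "lam = 1" and sig: "has_signature (\<lambda>u v. u \<bullet> ((Bs ** T) *v v)) (2 * n) (2 * CARD('m) - 2 * n)"
    and n: "n \<le> CARD('m)"
  shows "\<exists>a\<in>carrier O_complex. orbit_map (eta n) a = T"
proof -
  define B where "B = (\<lambda>u v. X u (S v))"
  have Bsig: "has_signature B (2 * n) (2 * CARD('m) - 2 * n)"
    using sig by (simp add: B_def matrix_vector_mul_assoc)
  have bil: "bilinear B" and sym: "B u v = B v u" for u v
    using Bsig by (auto simp: has_signature_def)
  have BS: "B (S u) v = B u (S v)" for u v using std_pred_Bs[of u "S v"] lam1 by (simp add: B_def)
  have BJ: "B (J u) v = - B u (J v)" for u v by (simp add: B_def Bs_Js std_pred_Js matrix_vector_linear)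
  have BJJ: "B (J u) (J v) = B u v" for u v by (simp add: BJ Js_Js bilinear_rneg[OF bil])
  define good where "good z \<longleftrightarrow> S z = z \<and> (B z z = 1 \<or> B z z = - 1)" for z
  define Op :: "nat \<Rightarrow> real^('m + 'm) \<Rightarrow> real^('m + 'm)"
    where "Op a = (if a = 0 then (\<lambda>z. z) else (\<lambda>z. J z))" for a
  have zJz: "B z (J z) = 0" if "S z = z" for z
  proof -
    have "B z (J z) = - B z (J z)" using BS[of z "J z"] by (simp add: that std_pred_Js bilinear_rneg[OF bil])
    then show ?thesis by simp
  qed
  have less2: "a < 2 \<longleftrightarrow> a = 0 \<or> a = Suc 0" for a :: nat by auto
  have "\<exists>N z. 2 * N = DIM(real^('m + 'm)) \<and> (\<forall>i<N. good (z i)) \<and> (\<forall>i<N. \<forall>j<N. \<forall>a<2::nat. \<forall>b<2::nat.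
      B (Op a (z i)) (Op b (z j)) = (if i = j \<and> a = b then 1 * B (z i) (z i) else 0))"
  proof (rule adapted_frame[where B=B and Op=Op and r=2 and Cl="{(\<lambda>z. z), (\<lambda>z. J z), (\<lambda>z. S z)}"
        and eps="\<lambda>_. 1" and good=good and s="\<lambda>z. B z z", OF bil sym])
    show "u = 0" if "\<And>v. B u v = 0" for u using has_signature_nondegenerate[OF Bsig] that by blast
    show "B (Op a z) (Op b z) = (if a = b then 1 * B z z else 0)" if "good z" "a < 2" "b < 2" for z a b
      using that zJz[of z] BJ[of z z] BJJ[of z z] by (auto simp: good_def Op_def less2)
    show "B (C v) (Op a z) = 0"
      if C: "C \<in> {(\<lambda>z. z), (\<lambda>z. J z), (\<lambda>z. S z)}" and z: "good z" and v: "\<And>b. b < 2 \<Longrightarrow> B v (Op b z) = 0" and a: "a < 2"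
      for C z v a
      using C v[of 0] v[of 1] z a BS[of v z] BS[of v "J z"]
      by (auto simp: good_def Op_def less2 BJ Js_Js std_pred_Js bilinear_rneg[OF bil])
    show "\<exists>z\<in>V. good z" if V: "subspace V" "V \<noteq> {0}"
      and ClV: "\<And>C v. C \<in> {(\<lambda>z. z), (\<lambda>z. J z), (\<lambda>z. S z)} \<Longrightarrow> v \<in> V \<Longrightarrow> C v \<in> V"
      and nd: "\<And>u. u \<in> V \<Longrightarrow> (\<And>v. v \<in> V \<Longrightarrow> B u v = 0) \<Longrightarrow> u = 0" for V
    proof -
      have JV: "J v \<in> V" and SV: "S v \<in> V" if "v \<in> V" for v using ClV that by blast+
      \<comment> \<open>The fixed vectors of \<open>T\<close> in \<open>V\<close>. \<open>J\<close>
        maps them to the eigenvectors for -1, so \<open>V\<close> is the sum of \<open>U\<close> and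
        \<open>J U\<close>.\<close>
      define U where "U = {v \<in> V. S v = v}"
      have U: "subspace U"
        using V(1) by (auto simp: U_def subspace_def matrix_vector_linear)
      have decomp: "(1/2) *\<^sub>R (v + S v) \<in> U" "J ((1/2) *\<^sub>R (v - S v)) \<in> U" if "v \<in> V" for v
        using that V(1) JV[OF that] SV[OF that] JV[OF SV[OF that]]
        by (auto simp: U_def matrix_vector_linear std_pred_square lam1 std_pred_Js subspace_add subspace_diff subspace_scale algebra_simps)
      \<comment> \<open>Otherwise polarization makes \<open>U\<close> orthogonal to itself. It is
        orthogonal to the eigenvectors for -1 as well, since \<open>T\<close> is self-adjoint for
        \<open>B\<close>, so nondegeneracy on \<open>V\<close> would give first
        \<open>U = {0}\<close> and then \<open>V = {0}\<close>.\<close>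
      have "\<exists>w\<in>U. B w w \<noteq> 0"
      proof (rule ccontr)
        assume "\<not> ?thesis"
        then have BU: "B u v = 0" if "u \<in> U" "v \<in> U" for u v
          using ex_nonisotropic[OF bil sym U that] by blast
        have U0: "u = 0" if u: "u \<in> U" for u
        proof (rule nd)
          show "u \<in> V" using u by (simp add: U_def)
          fix v assume v: "v \<in> V"
          have "B u (v - S v) = 0" using BS[of u v] u by (simp add: U_def bilinear_rsub[OF bil])
          moreover have "B u (v + S v) = 0"
            using BU[OF u decomp(1)[OF v]] by (simp add: bilinear_rmul[OF bil])
          ultimately have "2 * B u v = 0" by (simp add: bilinear_rsub[OF bil] bilinear_radd[OF bil])
          then show "B u v = 0" by simp
        qed
        obtain v where v: "v \<in> V" "v \<noteq> 0" using V subspace_0 by blast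
        have "v + S v = 0" using U0[OF decomp(1)[OF v(1)]] by simp
        moreover have "J (v - S v) = 0"
          using U0[OF decomp(2)[OF v(1)]] by (simp add: matrix_vector_linear)
        then have "v - S v = 0" using Js_Js[of "v - S v"] by (simp add: matrix_vector_mult_0_right)
        ultimately have "2 *\<^sub>R v = 0" by (simp add: scaleR_2 algebra_simps)
        then show False using v(2) by simp
      qed
      then obtain w where w: "w \<in> U" "B w w \<noteq> 0" by blast
      define z where "z = (1 / sqrt \<bar>B w w\<bar>) *\<^sub>R w"
      have "B z z = B w w / \<bar>B w w\<bar>"
        by (simp add: z_def bilinear_lmul[OF bil] bilinear_rmul[OF bil])
      moreover have "z \<in> U" unfolding z_def by (rule subspace_scale[OF U w(1)])
      ultimately show ?thesis using w(2) by (intro bexI[of _ z]) (auto simp: good_def U_def abs_if)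
    qed
  qed (auto simp: good_def Op_def)
  then obtain N z where N: "2 * N = DIM(real^('m + 'm))" and z: "\<And>i. i < N \<Longrightarrow> good (z i)"
    and orth: "\<And>i j a b. i < N \<Longrightarrow> j < N \<Longrightarrow> a < 2 \<Longrightarrow> b < (2::nat) \<Longrightarrow>
      B (Op a (z i)) (Op b (z j)) = (if i = j \<and> a = b then 1 * B (z i) (z i) else 0)"
    by blast
  have Nm: "N = CARD('m)" using N by simp
  define I where "I = {..<N} \<times> {..<2::nat}"
  have "has_signature B (card {x\<in>I. B (z (fst x)) (z (fst x)) > 0}) (card {x\<in>I. B (z (fst x)) (z (fst x)) < 0})"
  proof (rule has_signature_orthogonal_basis[where e="\<lambda>x. Op (snd x) (z (fst x))", OF bil sym])
    show "finite I" "card I = DIM(real^('m + 'm))" using N by (simp_all add: I_def)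
    show "B (Op (snd x) (z (fst x))) (Op (snd y) (z (fst y))) = (if x = y then B (z (fst x)) (z (fst x)) else 0)"
      if "x \<in> I" "y \<in> I" for x y
      using orth[of "fst x" "fst y" "snd x" "snd y"] that unfolding I_def
      by (cases x, cases y) (simp only: mem_Times_iff lessThan_iff fst_conv snd_conv prod.inject mult_1)
    show "B (z (fst x)) (z (fst x)) \<noteq> 0" if "x \<in> I" for x
      using z[of "fst x"] that by (auto simp: I_def good_def)
  qed
  \<comment> \<open>Each index is counted twice, once for \<open>z i\<close> and once for
    \<open>J (z i)\<close>; hence \<open>2 * n\<close> positive vectors mean \<open>n\<close>
    positive indices.\<close>
  from has_signature_unique(1)[OF this Bsig]
  have "card ({i. i < N \<and> B (z i) (z i) > 0} \<times> {..<2::nat}) = 2 * n"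
    by (rule trans[rotated]) (rule arg_cong[of _ _ card], auto simp: I_def)
  then have "card {i. i < CARD('m) \<and> B (z i) (z i) > 0} = n" by (simp add: Nm)
  then obtain e where e: "bij_betw e (UNIV :: 'm set) {..<CARD('m)}" "\<And>i. pos i < n \<longleftrightarrow> B (z (e i)) (z (e i)) > 0"
    using ex_enumeration[where 'm='m and Q="\<lambda>i. B (z i) (z i) > 0" and p=n] by blast
  have eN: "e i < N" for i using bij_betwE[OF e(1)] Nm by simp
  have ee: "e i = e j \<longleftrightarrow> i = j" for i j using e(1) by (auto simp: bij_betw_def inj_eq)
  \<comment> \<open>\<open>Op (c i)\<close> multiplies exactly the negative vectors by the imaginary
    unit, which changes their square under \<open>X\<close> from -1 to 1.\<close>
  define c where "c i = (if pos i < n then 0 else 1 :: nat)" for i :: 'm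
  define x where "x i = Op (c i) (z (e i))" for i
  have Sz: "S (z (e i)) = z (e i)" for i using z[OF eN] by (simp add: good_def)
  have Sx: "S (x i) = (if pos i < n then x i else - x i)" for i
    by (simp add: x_def c_def Op_def Sz std_pred_Js)
  have XB: "X u v = B u (S v)" for u v by (simp add: B_def std_pred_square lam1)
  have ci: "c i < 2" "c i = c j \<longleftrightarrow> (pos i < n \<longleftrightarrow> pos j < n)" for i j by (auto simp: c_def)
  have sgn: "B (z (e i)) (z (e i)) = (if pos i < n then 1 else - 1)" for i
    using z[OF eN[of i]] e(2)[of i] by (auto simp: good_def)
  have Bx: "B (x i) (x j) = (if i = j then (if pos i < n then 1 else - 1) else 0)" for i j
    using orth[of "e i" "e j" "c i" "c j", OF eN eN ci(1) ci(1)] sgn[of i] by (auto simp: x_def ee)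
  have JOp: "J (x i) = (if pos i < n then Op 1 (z (e i)) else - Op 0 (z (e i)))" for i
    by (simp add: x_def c_def Op_def Js_Js)
  have BJx: "B (J (x i)) (x j) = 0" for i j
    using orth[OF eN eN, of 1 0 i j] orth[OF eN eN, of 1 1 i j] orth[OF eN eN, of 0 0 i j] orth[OF eN eN, of 0 1 i j] ee[of i j]
    unfolding JOp by (auto simp: x_def c_def bilinear_lneg[OF bil])
  show ?thesis
  proof (rule orbit_map_of_frame[where x=x])
    show "T ** Js = - (Js ** T)" using T by (simp add: std_pred_def)
    show "X (x i) (x j) = (if i = j then 1 else 0)" for i j
      unfolding XB Sx by (auto simp: bilinear_rneg[OF bil] Bx)
    show "X (J (x i)) (x j) = 0" for i j
      unfolding XB Sx using BJx[of i j] by (simp add: bilinear_rneg[OF bil])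
    show "S (x i) = (\<Sum>j\<in>UNIV. eta n $ j $ i *\<^sub>R x j)" for i
    proof -
      have "(\<Sum>j\<in>UNIV. eta n $ j $ i *\<^sub>R x j) = (\<Sum>j\<in>UNIV. if j = i then (if pos i < n then 1 else - 1) *\<^sub>R x i else 0)"
        by (intro sum.cong) (auto simp: eta_def)
      then show ?thesis by (simp add: Sx)
    qed
  qed
qed

text \<open>Multiplying \<open>w\<close> by the complex number x + i y multiplies its complex square
  \<open>\<zeta>\<close> by (x + i y)^2, so a square root of 1 / \<open>\<zeta>\<close> normalizes
  it to 1. The quantity \<open>X (J (S w)) w\<close> is sesquilinear in \<open>w\<close>, as
  \<open>S\<close> is antilinear: it only acquires the real factor |x + i y|^2, and its vanishing is
  preserved.\<close>

lemma ex_rotated_vector: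
  assumes V: "subspace V" "\<And>v. v \<in> V \<Longrightarrow> J v \<in> V" and lam: "lam = - 1"
    and w: "w \<in> V" "X w w \<noteq> 0"
  obtains z c where "z \<in> V" "X z z = 1" "X (J z) z = 0" "X (J (S z)) z = c * X (J (S w)) w"
proof -
  define \<zeta> where "\<zeta> = Complex (X w w) (- X (J w) w)"
  define x where "x = Re (csqrt (1 / \<zeta>))"
  define y where "y = Im (csqrt (1 / \<zeta>))"
  have "\<zeta> \<noteq> 0" using w(2) by (auto simp: \<zeta>_def complex_eq_iff)
  then have "(csqrt (1 / \<zeta>))\<^sup>2 * \<zeta> = 1" by simp
  moreover have "csqrt (1 / \<zeta>) = Complex x y" by (simp only: x_def y_def complex.collapse)
  ultimately have c: "(Complex x y)\<^sup>2 * \<zeta> = 1" by simp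
  from c have c1: "(x * x - y * y) * X w w + 2 * (x * y) * X (J w) w = 1"
    by (simp add: complex_eq_iff \<zeta>_def power2_eq_square algebra_simps)
  from c have c2: "(x * x - y * y) * X (J w) w - 2 * (x * y) * X w w = 0"
    by (simp add: complex_eq_iff \<zeta>_def power2_eq_square algebra_simps)
  define z where "z = x *\<^sub>R w + y *\<^sub>R J w"
  note bl = bilinear_ladd[OF Bs_bilinear] bilinear_radd[OF Bs_bilinear] bilinear_lmul[OF Bs_bilinear]
    bilinear_rmul[OF Bs_bilinear] bilinear_lneg[OF Bs_bilinear] bilinear_rneg[OF Bs_bilinear]
  have XJw: "X w (J w) = X (J w) w" "X (J w) (J w) = - X w w"
    by (simp_all add: Bs_Js Js_Js bl)
  have XSw: "X (S w) w = 0" using std_pred_Bs[of w w] Bs_symmetric[of w "S w"] lam by simp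
  have XJS: "X (S w) (J w) = X (J (S w)) w" "X (J (S w)) (J w) = 0"
    using XSw by (simp_all add: Bs_Js Js_Js bl)
  have "z \<in> V" unfolding z_def using V w(1) by (simp add: subspace_add subspace_scale)
  moreover have "X z z = 1"
    unfolding z_def c1[symmetric] by (simp add: bl XJw algebra_simps)
  moreover have "X (J z) z = 0"
    unfolding z_def c2[symmetric] by (simp add: bl matrix_vector_linear Js_Js XJw algebra_simps)
  moreover have "X (J (S z)) z = (x * x + y * y) * X (J (S w)) w"
    unfolding z_def by (simp add: bl matrix_vector_linear Js_Js std_pred_Js XJS XSw algebra_simps)
  ultimately show ?thesis by (rule that)
qed

text \<open>If the complex square of \<open>z\<close> is 1, the vectors \<open>z\<close>,
  \<open>J z\<close>, \<open>S z\<close>, \<open>J (S z)\<close> are orthogonal except possibly for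
  the value \<open>X (J (S z)) z\<close>; this is the extra condition in \<open>good\<close>. Four
  real vectors per quaternionic line account for \<open>4 * N\<close>.\<close>

lemma quaternionic_frame:
  assumes lam: "lam = - 1"
  shows "\<exists>N z. 4 * N = 2 * CARD('m) \<and> (\<forall>i<N. \<forall>j<N.
    X (z i) (z j) = (if i = j then 1 else 0) \<and> X (J (z i)) (z j) = 0 \<and>
    X (z i) (S (z j)) = 0 \<and> X (J (z i)) (S (z j)) = 0)"
proof -
  note bl = bilinear_ladd[OF Bs_bilinear] bilinear_radd[OF Bs_bilinear] bilinear_lmul[OF Bs_bilinear]
    bilinear_rmul[OF Bs_bilinear] bilinear_lneg[OF Bs_bilinear] bilinear_rneg[OF Bs_bilinear]
  define good where "good z \<longleftrightarrow> X z z = 1 \<and> X (J z) z = 0 \<and> X (J (S z)) z = 0" for z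
  define Op where "Op a z = (if a = 0 then z else if a = 1 then J z else if a = 2 then S z else J (S z))"
    for a :: nat and z
  \<comment> \<open>\<open>J\<close> reverses the sign of squares under \<open>X\<close> and
    \<open>S\<close> preserves it, hence the signs alternate along \<open>z\<close>,
    \<open>J z\<close>, \<open>S z\<close>, \<open>J (S z)\<close>.\<close>
  define eps :: "nat \<Rightarrow> real" where "eps a = (if even a then 1 else - 1)" for a
  define Cl where "Cl = {(\<lambda>z. z), (\<lambda>z. J z), (\<lambda>z. S z), (\<lambda>z. J (S z))}"
  have Op_simps: "Op 0 z = z" "Op 1 z = J z" "Op (Suc 0) z = J z" "Op 2 z = S z" "Op 3 z = J (S z)" for z
    by (simp_all add: Op_def)
  have less4: "a < 4 \<longleftrightarrow> a = 0 \<or> a = 1 \<or> a = 2 \<or> a = 3" for a :: nat by auto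
  have XS': "X (S u) v = - X u (S v)" for u v using std_pred_Bs lam by simp
  have SS': "S (S u) = - u" for u using std_pred_square lam by simp
  have "\<exists>N z. 4 * N = DIM(real^('m + 'm)) \<and> (\<forall>i<N. good (z i)) \<and> (\<forall>i<N. \<forall>j<N. \<forall>a<4::nat. \<forall>b<4::nat.
      X (Op a (z i)) (Op b (z j)) = (if i = j \<and> a = b then eps a * 1 else 0))"
  proof (rule adapted_frame[where B=X and Op=Op and r=4 and Cl=Cl and eps=eps and good=good and s="\<lambda>_. 1",
        OF Bs_bilinear Bs_symmetric Bs_nondegenerate])
    show "Op a \<in> Cl" if "a < 4" for a
    proof -
      have "Op 0 = (\<lambda>z. z)" "Op 1 = (\<lambda>z. J z)" "Op 2 = (\<lambda>z. S z)" "Op 3 = (\<lambda>z. J (S z))"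
        by (simp_all add: fun_eq_iff Op_simps)
      then show ?thesis using that by (auto simp: less4 Cl_def)
    qed
    show "X (Op a z) (Op b z) = (if a = b then eps a * 1 else 0)" if z: "good z" "a < 4" "b < 4" for z a b
    proof -
      have zS: "X z (S z) = 0" using XS'[of z z] Bs_symmetric[of z "S z"] by simp
      have zJS: "X z (J (S z)) = 0" using z(1) Bs_symmetric[of z "J (S z)"] by (simp add: good_def)
      have zJ: "X z (J z) = 0" using z(1) by (simp add: good_def Bs_Js)
      have zz: "X z z = 1" using z(1) by (simp add: good_def)
      show ?thesis using z(2,3) unfolding less4
        by (elim disjE; simp add: Op_simps eps_def Bs_Js XS' Js_Js SS' std_pred_Js matrix_vector_linear bl zS zJS zJ zz)
    qed
    show "X (C v) (Op a z) = 0"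
      if C: "C \<in> Cl" and z: "good z" and v: "\<And>b. b < 4 \<Longrightarrow> X v (Op b z) = 0" and a: "a < 4" for C z v a
    proof -
      have v4: "X v z = 0" "X v (J z) = 0" "X v (S z) = 0" "X v (J (S z)) = 0"
        using v[of 0] v[of 1] v[of 2] v[of 3] by (simp_all add: Op_simps)
      show ?thesis using C a unfolding less4 Cl_def
        by (elim disjE insertE emptyE; simp add: Op_simps Bs_Js XS' Js_Js SS' std_pred_Js matrix_vector_linear bl v4)
    qed
    show "\<exists>z\<in>V. good z" if V: "subspace V" "V \<noteq> {0}"
      and ClV: "\<And>C v. C \<in> Cl \<Longrightarrow> v \<in> V \<Longrightarrow> C v \<in> V"
      and nd: "\<And>u. u \<in> V \<Longrightarrow> (\<And>v. v \<in> V \<Longrightarrow> X u v = 0) \<Longrightarrow> u = 0" for V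
    proof -
      have JV: "J v \<in> V" and SV: "S v \<in> V" if "v \<in> V" for v using ClV that unfolding Cl_def by blast+
      obtain u where u: "u \<in> V" "u \<noteq> 0" using V subspace_0 by blast
      obtain v where v: "v \<in> V" "X u v \<noteq> 0" using nd[OF u(1)] u(2) by blast
      obtain w where w: "w \<in> V" "X w w \<noteq> 0" using ex_nonisotropic[OF Bs_bilinear Bs_symmetric V(1) u(1) v] by blast
      obtain y c where y: "y \<in> V" "X y y = 1" "X (J y) y = 0"
        using ex_rotated_vector[OF V(1) JV lam w] by metis
      \<comment> \<open>In \<open>X (J (S t)) t\<close> the terms from \<open>X (J (S y)) y\<close>
        and \<open>X (J y) (S y)\<close> are equal and enter with opposite signs; the other two
        vanish because the complex square of \<open>y\<close> is real. As \<open>X t t = 2\<close>,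
        a second rotation normalizes \<open>t\<close> and keeps this zero.\<close>
      define t where "t = y + S y"
      have tV: "t \<in> V" unfolding t_def by (rule subspace_add[OF V(1) y(1) SV[OF y(1)]])
      have yS: "X y (S y) = 0" using XS'[of y y] Bs_symmetric[of y "S y"] by simp
      have yJ: "X y (J y) = 0" using y(3) by (simp add: Bs_Js)
      have tt: "X t t \<noteq> 0" using y(2) yS by (simp add: t_def bl XS' SS')
      have "J (S t) = J (S y) + - J y" by (simp add: t_def matrix_vector_linear SS')
      then have "X (J (S t)) t = X (J (S y)) y + X (J (S y)) (S y) + (- X (J y) y + - X (J y) (S y))"
        unfolding t_def by (simp only: bl)
      moreover have "X (J (S y)) y = X y (J (S y))" by (rule Bs_symmetric)
      moreover have "X (J (S y)) (S y) = 0" by (simp add: Bs_Js XS' std_pred_Js SS' yJ matrix_vector_linear bl)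
      moreover have "X (J y) (S y) = X y (J (S y))" by (rule Bs_Js)
      ultimately have "X (J (S t)) t = 0" using y(3) by simp
      then obtain z c where "z \<in> V" "X z z = 1" "X (J z) z = 0" "X (J (S z)) z = c * 0"
        using ex_rotated_vector[OF V(1) JV lam tV tt] by metis
      then show ?thesis by (intro bexI[of _ z]) (simp_all add: good_def)
    qed
  qed (simp_all add: eps_def)
  then obtain N z where N: "4 * N = DIM(real^('m + 'm))"
    and orth: "\<And>i j a b. i < N \<Longrightarrow> j < N \<Longrightarrow> a < 4 \<Longrightarrow> b < (4::nat) \<Longrightarrow>
      X (Op a (z i)) (Op b (z j)) = (if i = j \<and> a = b then eps a * 1 else 0)"
    by blast
  show ?thesis
  proof (intro exI[of _ N] exI[of _ z] conjI allI impI)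
    show "4 * N = 2 * CARD('m)" using N by simp
    fix i j assume ij: "i < N" "j < N"
    show "X (z i) (z j) = (if i = j then 1 else 0)" "X (J (z i)) (z j) = 0"
      "X (z i) (S (z j)) = 0" "X (J (z i)) (S (z j)) = 0"
      using orth[OF ij, of 0 0] orth[OF ij, of 1 0] orth[OF ij, of 0 2] orth[OF ij, of 1 2]
      by (simp_all add: Op_simps eps_def)
  qed
qed

end

section \<open>The subgroups as stabilizers\<close>

lemma stabilizer_iff:
  "a \<in> stabilizer Th \<longleftrightarrow> a \<in> carrier O_complex \<and> Rem a ** Th = Th ** Rem a \<and> Imm a ** Th = - (Th ** Imm a)"
  by (auto simp: stabilizer_def antilin_def C2R_def blk_mult matrix_mult_simps blk_eq_iff)

lemma eta_entry: "eta n $ i $ j = (if i = j then (if pos i < n then 1 else - 1) else 0)"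
  by (simp add: eta_def)

text \<open>The diagonal matrix D is unitary with D^2 = \<open>eta n\<close>, so conjugation by it
  turns the antilinear map Z \<mapsto> \<open>eta n\<close> (cnj Z) into plain conjugation.
  Commuting with that map thus means that D^-1 a D is real, and complex orthogonality of a becomes
  preservation of \<open>eta n\<close> by this real matrix.\<close>

lemma O_real_form_eq_stabilizer: "O_real_form n = stabilizer (eta n :: real^'m::finite^'m)"
proof (intro equalityI subsetI)
  define D :: "'m \<Rightarrow> complex" where "D i = (if pos i < n then 1 else \<i>)" for i
  define c :: "real^'m^'m \<Rightarrow> complex^'m^'m" where "c T = (\<chi> i j. D i * of_real (T $ i $ j) / D j)" for T
  have D: "D i \<noteq> 0" "D i * D i = of_real (eta n $ i $ i)" for i
    by (simp_all add: D_def eta_entry)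
  have form: "O_real_form n = c ` carrier (O_real n :: (real^'m^'m) monoid)"
    unfolding O_real_form_def Let_def c_def D_def ..
  have eta_left: "(eta n ** T) $ i $ j = eta n $ i $ i * T $ i $ j" for T :: "real^'m^'m" and i j
    by (simp add: matrix_matrix_mult_def eta_entry if_distrib[of "\<lambda>x. x * _"] cong: if_cong)
  have eta_right: "(T ** eta n) $ i $ j = T $ i $ j * eta n $ j $ j" for T :: "real^'m^'m" and i j
    by (simp add: matrix_matrix_mult_def eta_entry if_distrib[of "\<lambda>x. _ * x"] cong: if_cong)
  have eta_sq: "eta n $ i $ i * eta n $ i $ i = 1" for i :: 'm by (simp add: eta_entry)
  have orth: "c T \<in> carrier O_complex \<longleftrightarrow> T \<in> carrier (O_real n)" for T
  proof -
    have 1: "(transpose (c T) ** c T) $ i $ j = of_real ((transpose T ** eta n ** T) $ i $ j) / (D i * D j)" for i j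
    proof -
      have "(transpose (c T) ** c T) $ i $ j = (\<Sum>k\<in>UNIV. (D k * D k) * of_real (T $ k $ i * T $ k $ j) / (D i * D j))"
        by (simp add: matrix_matrix_mult_def transpose_def c_def mult_ac)
      also have "\<dots> = of_real (\<Sum>k\<in>UNIV. T $ k $ i * (eta n $ k $ k * T $ k $ j)) / (D i * D j)"
        unfolding D(2) by (simp add: sum_divide_distrib mult_ac)
      also have "(\<Sum>k\<in>UNIV. T $ k $ i * (eta n $ k $ k * T $ k $ j)) = (transpose T ** (eta n ** T)) $ i $ j"
        unfolding eta_left[symmetric] by (simp only: matrix_mult_entry[of "transpose T"]) (simp add: transpose_def)
      finally show ?thesis by (simp only: matrix_mul_assoc)
    qed
    have 2: "of_real x / (D i * D j) = mat 1 $ i $ j \<longleftrightarrow> x = eta n $ i $ j" for x :: real and i j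
      using D[of i] D[of j] by (auto simp: mat_def field_simps eta_entry)
    show ?thesis unfolding O_complex_iff O_real_iff vec_eq_iff 1 2 ..
  qed
  show "a \<in> stabilizer (eta n)" if aO: "a \<in> O_real_form n" for a :: "complex^'m^'m"
  proof -
    obtain T where T: "T \<in> carrier (O_real n)" "a = c T" using aO unfolding form by blast
    have "(Rem a ** eta n) $ i $ j = (eta n ** Rem a) $ i $ j \<and> (Imm a ** eta n) $ i $ j = (- (eta n ** Imm a)) $ i $ j" for i j
      unfolding eta_right vector_uminus_component eta_left
      by (simp add: T(2) c_def Rem_def Imm_def D_def eta_entry)
    then have "Rem a ** eta n = eta n ** Rem a" "Imm a ** eta n = - (eta n ** Imm a)"
      by (auto simp only: vec_eq_iff)
    then show ?thesis using T orth[of T] by (simp add: stabilizer_iff)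
  qed
  show "a \<in> O_real_form n" if "a \<in> stabilizer (eta n)" for a :: "complex^'m^'m"
  proof -
    have a: "a \<in> carrier O_complex" "Rem a ** eta n = eta n ** Rem a" "Imm a ** eta n = - (eta n ** Imm a)"
      using that by (simp_all add: stabilizer_iff)
    have r: "Re (a $ i $ j) * eta n $ j $ j = eta n $ i $ i * Re (a $ i $ j)" for i j
      using arg_cong[OF a(2), of "\<lambda>M. M $ i $ j"] unfolding eta_left eta_right by (simp add: Rem_def)
    have m: "Im (a $ i $ j) * eta n $ j $ j = - (eta n $ i $ i * Im (a $ i $ j))" for i j
      using arg_cong[OF a(3), of "\<lambda>M. M $ i $ j"] unfolding vector_uminus_component eta_left eta_right by (simp add: Imm_def)
    define T where "T = (\<chi> i j. Re (a $ i $ j * D j / D i))"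
    have "Im (a $ i $ j * D j / D i) = 0" for i j
      using r[of i j] m[of i j] by (simp add: D_def eta_entry split: if_splits)
    then have "of_real (T $ i $ j) = a $ i $ j * D j / D i" for i j
      by (simp add: T_def complex_eq_iff)
    then have "a = c T" using D(1) by (simp add: c_def vec_eq_iff)
    then show ?thesis using a(1) orth unfolding form by blast
  qed
qed

text \<open>In terms of the two halves of the coordinates this is the standard complex structure (z,
  w) \<mapsto> (- w, z). The antilinear map Z \<mapsto> Omega (cnj Z) is right multiplication by the
  quaternion j.\<close>

definition Omega :: "real^'m::finite^'m" where
  "Omega = (\<chi> i j. if pos i = pos j + CARD('m) div 2 then 1
    else if pos j = pos i + CARD('m) div 2 then - 1 else 0)"

lemma Omega_mult_vector:
  assumes m: "even CARD('m::finite)"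
  shows "(\<Sum>j\<in>UNIV. of_real (Omega $ i $ j) * Z $ j) =
    (if pos (i :: 'm) < CARD('m) div 2 then - Z $ idx (pos i + CARD('m) div 2)
     else (Z $ idx (pos i - CARD('m) div 2) :: 'f::{real_algebra_1, ring_1}))"
proof -
  let ?k = "CARD('m) div 2"
  have k: "CARD('m) = ?k + ?k" using m by (metis dvd_mult_div_cancel mult_2)
  have pos: "pos j < ?k + ?k" for j :: 'm using pos_less[of j] k by simp
  show ?thesis
  proof (cases "pos i < ?k")
    case True
    then have p: "pos (idx (pos i + ?k) :: 'm) = pos i + ?k" using k by (intro pos_idx) linarith
    have "of_real (Omega $ i $ j) * Z $ j = (if j = idx (pos i + ?k) then - Z $ j else 0)" for j
      using True p pos[of j] by (auto simp: Omega_def) (metis idx_pos)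
    then show ?thesis using True by simp
  next
    case False
    then have p: "pos (idx (pos i - ?k) :: 'm) = pos i - ?k" using k pos[of i] by (intro pos_idx) linarith
    have "of_real (Omega $ i $ j) * Z $ j = (if j = idx (pos i - ?k) then Z $ j else 0)" for j
      using False p pos[of j] by (auto simp: Omega_def) (metis diff_add_inverse2 idx_pos)
    then show ?thesis using False by simp
  qed
qed

lemma Omega_properties:
  assumes m: "even CARD('m::finite)"
  shows "Omega ** Omega = (mat (- 1) :: real^'m^'m)" "transpose Omega = (- 1) *\<^sub>R (Omega :: real^'m^'m)"
proof -
  let ?k = "CARD('m) div 2"
  have k: "CARD('m) = ?k + ?k" using m by (metis dvd_mult_div_cancel mult_2)
  \<comment> \<open>For \<open>?k = 0\<close> the two cases in the definition of
    \<open>Omega\<close> would coincide and skewness would fail.\<close>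
  have k0: "?k > 0" using k by (metis add.right_neutral neq0_conv zero_less_card_finite)
  have pos: "pos j < ?k + ?k" for j :: 'm using pos_less[of j] k by simp
  have v: "(Omega *v v) $ i = (if pos i < ?k then - v $ idx (pos i + ?k) else v $ idx (pos i - ?k))"
    for v :: "real^'m" and i
    using Omega_mult_vector[OF m, of i v] by (simp add: matrix_vector_mult_def)
  have "(Omega *v (Omega *v v)) $ i = - v $ i" for v :: "real^'m" and i
  proof (cases "pos i < ?k")
    case True
    then have "pos (idx (pos i + ?k) :: 'm) = pos i + ?k" using k by (intro pos_idx) linarith
    then show ?thesis using True by (simp add: v idx_pos)
  next
    case False
    then have "pos (idx (pos i - ?k) :: 'm) = pos i - ?k" using k pos[of i] by (intro pos_idx) linarith
    moreover have "pos i - ?k < ?k" using False pos[of i] by linarith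
    ultimately show ?thesis using False pos[of i] by (simp add: v idx_pos)
  qed
  then show "Omega ** Omega = (mat (- 1) :: real^'m^'m)"
    by (simp add: matrix_eq matrix_vector_mul_assoc[symmetric] vec_eq_iff mat_minus_one neg_matrix_vector
        matrix_vector_mul_lid)
  show "transpose Omega = (- 1) *\<^sub>R (Omega :: real^'m^'m)"
    using k0 by (auto simp: vec_eq_iff transpose_def Omega_def)
qed

section \<open>Right multiplication by quaternions in complex coordinates\<close>

definition cOmega :: "complex^'m::finite^'m" where "cOmega = (\<chi> i j. of_real (Omega $ i $ j))"
definition cnjv :: "complex^'m::finite \<Rightarrow> complex^'m" where "cnjv Z = (\<chi> i. cnj (Z $ i))"
definition cnjm :: "complex^'m::finite^'m \<Rightarrow> complex^'m^'m" where "cnjm a = (\<chi> i j. cnj (a $ i $ j))"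

lemma cnjv_mult: "cnjv (a *v Z) = cnjm a *v cnjv Z"
  by (simp add: vec_eq_iff cnjv_def cnjm_def matrix_vector_mult_def)

lemma cnjv_cnjv: "cnjv (cnjv Z) = Z"
  by (simp add: vec_eq_iff cnjv_def)

lemma qscale_eq:
  assumes m: "even CARD('m::finite)"
  shows "qscale Z t = fst t *s Z + snd t *s (cOmega *v cnjv (Z :: complex^'m))"
proof -
  let ?k = "CARD('m) div 2"
  have k: "CARD('m) = ?k + ?k" using m by (metis dvd_mult_div_cancel mult_2)
  have O: "(cOmega *v cnjv Z) $ i = (if pos i < ?k then - cnj (Z $ idx (pos i + ?k)) else cnj (Z $ idx (pos i - ?k)))" for i
    using Omega_mult_vector[OF m, of i "cnjv Z"] by (simp add: matrix_vector_mult_def cOmega_def cnjv_def)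
  have "qscale Z t $ i = (fst t *s Z + snd t *s (cOmega *v cnjv Z)) $ i" for i
    unfolding vector_add_component vector_smult_component O
    by (auto simp: qscale_def of_qvec_def to_qvec_def qmult_def idx_pos mult.commute)
  then show ?thesis by (simp add: vec_eq_iff)
qed

lemma sum_halves:
  fixes f :: "'m::finite \<Rightarrow> 'b::comm_monoid_add"
  assumes m: "even CARD('m)"
  shows "(\<Sum>i\<in>UNIV. f i) = (\<Sum>i<CARD('m) div 2. f (idx i) + f (idx (i + CARD('m) div 2)))"
proof -
  let ?k = "CARD('m) div 2"
  have k: "CARD('m) = ?k + ?k" using m by (metis dvd_mult_div_cancel mult_2)
  have split: "(\<Sum>i<c + d. h i) = (\<Sum>i<c. h i) + (\<Sum>i<d. h (i + c))" for h :: "nat \<Rightarrow> 'b" and c d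
    by (induction d) (simp_all add: add.assoc add.commute[of c])
  have "(\<Sum>i\<in>UNIV. f i) = (\<Sum>i\<in>(UNIV :: 'm set). f (idx (pos i)))" by (simp add: idx_pos)
  also have "\<dots> = (\<Sum>i\<in>{..<?k + ?k}. f (idx i))"
    using sum.reindex_bij_betw[OF bij_pos[where 'm='m], of "\<lambda>i. f (idx i)"] k by simp
  also have "\<dots> = (\<Sum>i<?k. f (idx i)) + (\<Sum>i<?k. f (idx (i + ?k)))"
    by (rule split)
  finally show ?thesis by (simp add: sum.distrib)
qed

lemma q_antiherm_eq:
  assumes m: "even CARD('m::finite)"
  shows "q_antiherm Z W = (- pairing (cOmega *v cnjv Z) W, pairing Z (W :: complex^'m))"
proof -
  let ?k = "CARD('m) div 2"
  have k: "CARD('m) = ?k + ?k" using m by (metis dvd_mult_div_cancel mult_2)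
  have O: "(cOmega *v cnjv Z) $ i = (if pos i < ?k then - cnj (Z $ idx (pos i + ?k)) else cnj (Z $ idx (pos i - ?k)))" for i
    using Omega_mult_vector[OF m, of i "cnjv Z"] by (simp add: matrix_vector_mult_def cOmega_def cnjv_def)
  have p: "pos (idx i :: 'm) = i" "pos (idx (i + ?k) :: 'm) = i + ?k" if "i < ?k" for i
    using that k by (auto intro!: pos_idx)
  have 1: "pairing Z W = (\<Sum>i<?k. Z $ idx i * W $ idx i + Z $ idx (i + ?k) * W $ idx (i + ?k))"
    unfolding pairing_def by (rule sum_halves[OF m])
  have 2: "pairing (cOmega *v cnjv Z) W
      = (\<Sum>i<?k. - cnj (Z $ idx (i + ?k)) * W $ idx i + cnj (Z $ idx i) * W $ idx (i + ?k))"
    unfolding pairing_def sum_halves[OF m] by (intro sum.cong) (simp_all add: O p)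
  have "q_antiherm Z W = (\<Sum>i<?k. (cnj (Z $ idx (i + ?k)) * W $ idx i - cnj (Z $ idx i) * W $ idx (i + ?k),
      Z $ idx i * W $ idx i + Z $ idx (i + ?k) * W $ idx (i + ?k)))"
    unfolding q_antiherm_def by (intro sum.cong) (simp_all add: qmult_def qcnj_def to_qvec_def)
  also have "\<dots> = (- pairing (cOmega *v cnjv Z) W, pairing Z W)"
    unfolding 1 2 by (simp add: prod_eq_iff fst_sum snd_sum sum_negf[symmetric])
  finally show ?thesis .
qed

text \<open>For complex linear maps, quaternionic linearity is commutation with right multiplication
  by j. The components of the anti-Hermitian form are - c(Z j, W) and c(Z, W) with the complex
  symmetric form c, so a map commuting with j preserves it exactly when it preserves c.\<close>

lemma SO_star_eq_stabilizer:
  assumes m: "even CARD('m::finite)"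
  shows "SO_star = stabilizer (Omega :: real^'m^'m)"
proof -
  have stab: "a \<in> stabilizer Omega \<longleftrightarrow> a \<in> carrier O_complex \<and> a ** cOmega = cOmega ** cnjm a" for a :: "complex^'m^'m"
  proof -
    have "Rem (a ** cOmega) = Rem a ** Omega" "Imm (a ** cOmega) = Imm a ** Omega"
      "Rem (cOmega ** cnjm a) = Omega ** Rem a" "Imm (cOmega ** cnjm a) = - (Omega ** Imm a)"
      by (simp_all add: vec_eq_iff Rem_def Imm_def cnjm_def cOmega_def matrix_matrix_mult_def sum_negf)
    then show ?thesis by (simp add: stabilizer_iff complex_mat_eq_iff)
  qed
  have comm: "a ** cOmega = cOmega ** cnjm a \<longleftrightarrow> (\<forall>Z. a *v (cOmega *v cnjv Z) = cOmega *v cnjv (a *v Z))"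
    for a :: "complex^'m^'m"
    unfolding matrix_eq cnjv_mult matrix_vector_mul_assoc by (metis cnjv_cnjv)
  show ?thesis
  proof (intro equalityI subsetI)
    fix a :: "complex^'m^'m" assume a: "a \<in> SO_star"
    have "pairing (a *v Z) (a *v W) = pairing Z W" for Z W
      using a unfolding SO_star_def q_antiherm_eq[OF m] by auto
    then have "a \<in> carrier O_complex" using a unfolding O_complex_def SO_star_def by simp
    moreover have "a *v (cOmega *v cnjv Z) = cOmega *v cnjv (a *v Z)" for Z
    proof -
      have "a *v qscale Z (0, 1) = qscale (a *v Z) (0, 1)" using a unfolding SO_star_def by blast
      then show ?thesis by (simp add: qscale_eq[OF m])
    qed
    ultimately show "a \<in> stabilizer Omega" unfolding stab comm by blast
  next
    fix a :: "complex^'m^'m" assume a: "a \<in> stabilizer Omega"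
    then have inv: "invertible a" and pres: "\<And>Z W. pairing (a *v Z) (a *v W) = pairing Z W"
      unfolding stab O_complex_def by auto
    have c: "a *v (cOmega *v cnjv Z) = cOmega *v cnjv (a *v Z)" for Z using a unfolding stab comm by blast
    have "a *v qscale Z t = qscale (a *v Z) t" for Z t
      unfolding qscale_eq[OF m] by (simp add: matrix_vector_right_distrib vector_scalar_commute c)
    moreover have "q_antiherm (a *v Z) (a *v W) = q_antiherm Z W" for Z W
      unfolding q_antiherm_eq[OF m] c[symmetric] pres ..
    ultimately show "a \<in> SO_star" using inv by (simp add: SO_star_def)
  qed
qed

text \<open>The count \<open>4 * N = 2 * CARD('m)\<close> of a quaternionic frame already gives
  evenness. The vectors \<open>z i\<close> together with their images under \<open>T\<close> form a
  frame that is orthonormal for the complex form.\<close>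

lemma complex_structure_transitivity:
  fixes T :: "real^('m::finite + 'm)^('m + 'm)"
  assumes T: "std_pred (- 1) T"
  shows "even CARD('m)" "\<exists>a\<in>carrier O_complex. orbit_map Omega a = T"
proof -
  obtain N z where N: "4 * N = 2 * CARD('m)" and z: "\<And>i j. i < N \<Longrightarrow> j < N \<Longrightarrow>
    z i \<bullet> (Bs *v z j) = (if i = j then 1 else 0) \<and> (Js *v z i) \<bullet> (Bs *v z j) = 0 \<and>
    z i \<bullet> (Bs *v (T *v z j)) = 0 \<and> (Js *v z i) \<bullet> (Bs *v (T *v z j)) = 0"
    using quaternionic_frame[OF T refl] by blast
  show m: "even CARD('m)" using N by presburger
  let ?k = "CARD('m) div 2"
  have k: "CARD('m) = ?k + ?k" using m by (metis dvd_mult_div_cancel mult_2)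
  have NK: "N = ?k" using N by presburger
  have pos: "pos i < ?k + ?k" for i :: 'm using pos_less[of i] k by simp
  \<comment> \<open>The frame vectors \<open>z\<close> fill the first half of the positions and
    their images under \<open>T\<close> the second; since T^2 = -1, the matrix of \<open>T\<close>
    in this order is \<open>Omega\<close>.\<close>
  define x where "x i = (if pos i < ?k then z (pos i) else T *v z (pos i - ?k))" for i :: 'm
  note std_pred_square = std_pred_square[OF T] and std_pred_Js = std_pred_Js[OF T] and std_pred_Bs = std_pred_Bs[OF T]
  have lt: "pos i - ?k < N" if "\<not> pos i < ?k" for i :: 'm using pos[of i] that NK by linarith
  have sub: "pos i - ?k = pos j - ?k \<longleftrightarrow> i = j" if "\<not> pos i < ?k" "\<not> pos j < ?k" for i j :: 'm
    using that pos_eq_iff[of i j] by (metis eq_diff_iff linorder_not_less)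
  show "\<exists>a\<in>carrier O_complex. orbit_map Omega a = T"
  proof (rule orbit_map_of_frame[where x=x])
    show "T ** Js = - (Js ** T)" using T by (simp add: std_pred_def)
    show "x i \<bullet> (Bs *v x j) = (if i = j then 1 else 0)" for i j
      using z[of "pos i" "pos j"] z[of "pos i" "pos j - ?k"] z[of "pos j" "pos i - ?k"] z[of "pos i - ?k" "pos j - ?k"]
        lt[of i] lt[of j] sub[of i j] NK Bs_symmetric[of "T *v z (pos i - ?k)" "z (pos j)"]
      by (auto simp: x_def std_pred_Bs std_pred_square pos_eq_iff matrix_vector_mult_0_right linear_neg[OF matrix_vector_mul_linear])
    show "(Js *v x i) \<bullet> (Bs *v x j) = 0" for i j
      using z[of "pos i" "pos j"] z[of "pos i" "pos j - ?k"] z[of "pos j" "pos i - ?k"] z[of "pos i - ?k" "pos j - ?k"]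
        lt[of i] lt[of j] NK Bs_symmetric[of "Js *v (T *v z (pos i - ?k))" "z (pos j)"]
      by (auto simp: x_def std_pred_Bs Bs_Js std_pred_square std_pred_Js linear_neg[OF matrix_vector_mul_linear])
    show "T *v x i = (\<Sum>j\<in>UNIV. Omega $ j $ i *\<^sub>R x j)" for i
    proof -
      have "Omega $ j $ i = - (Omega $ i $ j :: real)" for j
        using arg_cong[OF Omega_properties(2)[OF m], of "\<lambda>M. M $ i $ j"] by (simp add: transpose_def)
      then have "(\<Sum>j\<in>UNIV. Omega $ j $ i *\<^sub>R x j) $ s = - (\<Sum>j\<in>UNIV. of_real (Omega $ i $ j) * (\<chi> j. x j $ s) $ j)" for s
        by (simp add: sum_negf)
      then have "(\<Sum>j\<in>UNIV. Omega $ j $ i *\<^sub>R x j) $ s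
          = (if pos i < ?k then x (idx (pos i + ?k)) $ s else - x (idx (pos i - ?k)) $ s)" for s
        unfolding Omega_mult_vector[OF m] by simp
      moreover have "pos (idx (pos i + ?k) :: 'm) = pos i + ?k" if "pos i < ?k"
        using that k by (intro pos_idx) linarith
      moreover have "pos (idx (pos i - ?k) :: 'm) = pos i - ?k" "pos i - ?k < ?k" if "\<not> pos i < ?k"
        using that k pos[of i] by (auto intro!: pos_idx)
      ultimately show ?thesis by (auto simp: vec_eq_iff x_def std_pred_square)
    qed
  qed
qed

section \<open>The complex orthogonal frame of the model\<close>

text \<open>Conjugation by \<open>Q\<close> replaces \<open>Ik (- 1) (eta p)\<close> by
  \<open>Js\<close>. For \<open>lam = - 1\<close> the form \<open>b\<close> becomes
  \<open>Bs\<close> and skewness is the \<open>Bs\<close> condition; for \<open>lam = 1\<close> it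
  becomes \<open>Bs ** Js\<close>, and moving \<open>T\<close> past \<open>Js\<close> costs the sign
  that turns skewness into symmetry. The trace vanishes because conjugation by \<open>Js\<close>
  carries \<open>T\<close> to \<open>- T\<close>.\<close>

lemma fiber_pred_eq_std_pred:
  fixes Q :: "real^('m::finite + 'm)^('m + 'm)"
  assumes QQ': "Q' ** Q = mat 1"
    and J: "Q ** Js ** Q' = Ik (- 1) (eta p)"
    and B: "transpose Q ** Bm ** Q = (if lam = 1 then Bs ** Js else Bs)" and lam': "lam = 1 \<or> lam = - 1"
  shows "fiber_pred lam (- 1) (eta p) (Q ** T ** Q') \<longleftrightarrow> std_pred lam T"
proof -
  have Q'Q: "Q ** Q' = mat 1" by (rule matrix_mult_left_right[OF QQ'])
  have cancel: "Q ** X ** Q' = Q ** Y ** Q' \<longleftrightarrow> X = Y" for X Y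
  proof
    assume *: "Q ** X ** Q' = Q ** Y ** Q'"
    have "(Q' ** Q) ** X ** (Q' ** Q) = (Q' ** Q) ** Y ** (Q' ** Q)"
      using arg_cong[OF *, of "\<lambda>X. Q' ** X ** Q"] by (simp only: matrix_mul_assoc)
    then show "X = Y" by (simp add: QQ')
  qed simp
  have mat: "mat x = Q ** mat x ** Q'" for x
    by (simp add: mat_scaleR[of x] matrix_mult_simps Q'Q)
  have 1: "(Q ** T ** Q') ** (Q ** T ** Q') = mat lam \<longleftrightarrow> T ** T = mat lam"
    unfolding matrix_conj_mult[OF QQ'] by (subst mat) (rule cancel)
  have 2: "(Q ** T ** Q') ** Ik (- 1) (eta p) = - (Ik (- 1) (eta p) ** (Q ** T ** Q')) \<longleftrightarrow> T ** Js = - (Js ** T)"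
    unfolding J[symmetric] matrix_conj_mult[OF QQ']
    using cancel[of "T ** Js" "- (Js ** T)"] by (simp add: matrix_mult_simps)
  have 3: "trace (Q ** T ** Q') = 0" if "T ** Js = - (Js ** T)"
  proof -
    have "(- Js) ** Js = mat 1" by (simp add: Js_mult matrix_mult_simps)
    then have "trace (Js ** T ** (- Js)) = trace T" by (rule trace_conj)
    moreover have "Js ** T ** (- Js) = - T"
    proof -
      have "Js ** T ** (- Js) = T ** (Js ** Js)" using that by (simp add: matrix_mult_simps matrix_mul_assoc)
      then show ?thesis by (simp add: Js_mult matrix_mult_simps)
    qed
    ultimately have "trace T = 0" by (simp add: trace_minus)
    then show ?thesis by (simp add: trace_conj[OF QQ'])
  qed
  have 4: "transpose (Q ** T ** Q') ** Bm = - (Bm ** (Q ** T ** Q')) \<longleftrightarrow>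
      transpose T ** (transpose Q ** Bm ** Q) = - ((transpose Q ** Bm ** Q) ** T)"
  proof -
    have tr: "transpose Q' ** transpose Q = mat 1"
      by (simp add: matrix_transpose_mul[symmetric] Q'Q transpose_mat)
    have tr': "transpose Q ** transpose Q' = mat 1" by (rule matrix_mult_left_right[OF tr])
    have e1: "transpose Q ** (transpose (Q ** T ** Q') ** Bm) ** Q = (transpose Q ** transpose Q') ** transpose T ** (transpose Q ** Bm ** Q)"
      by (simp only: matrix_transpose_mul matrix_mul_assoc)
    have e2: "transpose Q ** (Bm ** (Q ** T ** Q')) ** Q = (transpose Q ** Bm ** Q) ** T ** (Q' ** Q)"
      by (simp only: matrix_mul_assoc)
    have "X = Y \<longleftrightarrow> transpose Q ** X ** Q = transpose Q ** Y ** Q" for X Y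
    proof
      assume *: "transpose Q ** X ** Q = transpose Q ** Y ** Q"
      have "(transpose Q' ** transpose Q) ** X ** (Q ** Q') = (transpose Q' ** transpose Q) ** Y ** (Q ** Q')"
        using arg_cong[OF *, of "\<lambda>X. transpose Q' ** X ** Q'"] by (simp only: matrix_mul_assoc)
      then show "X = Y" by (simp add: tr Q'Q)
    qed simp
    from this[of "transpose (Q ** T ** Q') ** Bm" "- (Bm ** (Q ** T ** Q'))"] show ?thesis
      using e1 e2 by (simp add: tr' QQ' matrix_mult_simps)
  qed
  have 5: "transpose T ** (transpose Q ** Bm ** Q) = - ((transpose Q ** Bm ** Q) ** T) \<longleftrightarrow>
      transpose T ** Bs = lam *\<^sub>R (Bs ** T)" if TJ: "T ** Js = - (Js ** T)"
  proof (cases "lam = 1")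
    case True
    have "- ((Bs ** Js) ** T) = Bs ** (T ** Js)" by (simp add: TJ matrix_mult_simps matrix_mul_assoc)
    then have r: "- ((Bs ** Js) ** T) = (Bs ** T) ** Js" by (simp add: matrix_mul_assoc)
    have l: "transpose T ** (Bs ** Js) = (transpose T ** Bs) ** Js" by (simp only: matrix_mul_assoc)
    have inj: "X = Y \<longleftrightarrow> X ** Js = Y ** (Js :: real^('m + 'm)^('m + 'm))" for X Y
    proof
      assume "X ** Js = Y ** Js"
      then have "X ** (Js ** Js) = Y ** (Js ** Js)" by (simp only: matrix_mul_assoc)
      then show "X = Y" by (simp add: Js_mult matrix_mult_simps)
    qed simp
    show ?thesis
      using True inj[of "transpose T ** Bs" "Bs ** T"] unfolding B if_P[OF True] l r by simp
  next
    case False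
    then have "lam = - 1" using lam' by blast
    then show ?thesis using False unfolding B by simp
  qed
  show ?thesis
    unfolding fiber_pred_def lin_structure_iff std_pred_def 1 2 4 using 3 5 by blast
qed

text \<open>The first block column consists of the vectors (e_i + e^i) / \<surd>2, built from the
  standard basis and its dual, and the second of their images under \<open>Ik (- 1) (eta p)\<close>.
  The former are orthonormal for the complex form with real part \<open>b\<close>, whatever
  \<open>p\<close> is; therefore the complex group depends on the dimension alone.\<close>

definition Qf :: "nat \<Rightarrow> real^('m::finite + 'm)^('m + 'm)" where
  "Qf p = (1 / sqrt 2) *\<^sub>R blk (mat 1) (- eta p) (mat 1) (eta p)"

lemma Qf_properties:
  shows "Qf p ** Js = Ik (- 1) (eta p) ** Qf p" "transpose (Qf p) ** Bm ** Qf p = Bs"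
proof -
  show "Qf p ** Js = Ik (- 1) (eta p) ** Qf p"
    by (simp add: Qf_def Js_def Ik_eta blk_mult matrix_mult_simps eta_mult_eta)
  have "transpose (Qf p) ** Bm ** Qf p = (1 / 2) *\<^sub>R
      (transpose (blk (mat 1) (- eta p) (mat 1) (eta p)) ** Bm ** blk (mat 1) (- eta p) (mat 1) (eta p))"
    by (simp add: Qf_def matrix_mult_simps transpose_simps)
  also have "\<dots> = Bs"
    by (simp add: Bm_def Bs_def transpose_blk blk_mult matrix_mult_simps transpose_simps transpose_eta eta_mult_eta
        blk_linear blk_eq_iff scaleR_mat flip: scaleR_2)
  finally show "transpose (Qf p) ** Bm ** Qf p = Bs" .
qed

text \<open>For \<open>\<lambda> = 1\<close> the form has to be multiplied by \<open>\<i>\<close>, that is, the frame by \<open>(1 + \<i>) / \<surd>2\<close>.\<close>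

lemma ex_model_frame:
  fixes lam :: real
  obtains Q :: "real^('m::finite + 'm)^('m + 'm)" and Q' where "Q' ** Q = mat 1" "Q ** Js ** Q' = Ik (- 1) (eta p)"
    "transpose Q ** Bm ** Q = (if lam = 1 then Bs ** Js else Bs)"
proof -
  define R :: "real^('m + 'm)^('m + 'm)" where
    "R = (if lam = 1 then (1 / sqrt 2) *\<^sub>R (mat 1 + Js) else mat 1)"
  define C :: "real^('m + 'm)^('m + 'm)" where "C = (if lam = 1 then Bs ** Js else Bs)"
  define Q where "Q = Qf p ** R"
  have RJ: "R ** Js = Js ** R" by (simp add: R_def matrix_mult_simps)
  have RB: "transpose R ** Bs ** R = C"
  proof (cases "lam = 1")
    case True
    have R: "R = (1 / sqrt 2) *\<^sub>R (mat 1 + Js)" "transpose R = (1 / sqrt 2) *\<^sub>R (mat 1 - Js)"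
      using True by (simp_all add: R_def transpose_simps Js_mult)
    have "transpose R ** Bs ** R = (1 / sqrt 2 * (1 / sqrt 2)) *\<^sub>R ((mat 1 - Js) ** Bs ** (mat 1 + Js))"
      unfolding R(2) unfolding R(1) by (simp only: bounded_bilinear.scaleR_left[OF bounded_bilinear_matrix_mult_real]
          bounded_bilinear.scaleR_right[OF bounded_bilinear_matrix_mult_real] scaleR_scaleR)
    also have "1 / sqrt 2 * (1 / sqrt 2) = (1 / 2 :: real)" by simp
    also have "(mat 1 - Js) ** Bs ** (mat 1 + Js) = 2 *\<^sub>R (Bs ** Js)"
      by (simp add: matrix_mult_simps Js_mult scaleR_2 matrix_mul_assoc[symmetric])
    finally show ?thesis using True by (simp add: C_def)
  qed (simp add: R_def C_def transpose_mat)
  have "transpose Q ** Bm ** Q = transpose R ** (transpose (Qf p) ** Bm ** Qf p) ** R"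
    by (simp only: Q_def matrix_transpose_mul matrix_mul_assoc)
  then have QB: "transpose Q ** Bm ** Q = C" by (simp only: Qf_properties(2) RB)
  have "(Bs ** Js) ** (Bs ** Js) = (mat 1 :: real^('m + 'm)^('m + 'm))"
  proof -
    have "(Bs ** Js) ** (Bs ** Js) = Bs ** (Js ** Bs) ** Js" by (simp only: matrix_mul_assoc)
    also have "\<dots> = - ((Bs ** Bs) ** (Js ** Js))" unfolding Js_mult(3) by (simp add: matrix_mult_simps matrix_mul_assoc)
    finally show ?thesis by (simp add: Bs_mult Js_mult)
  qed
  then have CC: "C ** C = mat 1" by (simp add: C_def Bs_mult)
  \<comment> \<open>As \<open>C\<close> is an involution, \<open>transpose Q ** Bm ** Q = C\<close>
    exhibits the inverse of \<open>Q\<close>.\<close>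
  define Q' where "Q' = C ** transpose Q ** Bm"
  have "Q' ** Q = C ** (transpose Q ** Bm ** Q)" by (simp only: Q'_def matrix_mul_assoc)
  then have Q'Q: "Q' ** Q = mat 1" by (simp only: QB CC)
  have "Q ** Js = Qf p ** Js ** R" by (simp only: Q_def matrix_mul_assoc[symmetric] RJ)
  also have "\<dots> = Ik (- 1) (eta p) ** Q" by (simp only: Qf_properties(1) Q_def matrix_mul_assoc)
  finally have "Q ** Js ** Q' = Ik (- 1) (eta p) ** (Q ** Q')" by (simp only: matrix_mul_assoc)
  then have "Q ** Js ** Q' = Ik (- 1) (eta p)" by (simp add: matrix_mult_left_right[OF Q'Q])
  then show ?thesis by (rule that[OF Q'Q _ QB[unfolded C_def]])
qed

text \<open>\<open>Bs\<close> cancels the sign in the second block of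
  \<open>antilin (eta n)\<close>, so the form consists of two copies of \<open>eta n\<close>. This
  determines the signature of the base point.\<close>

lemma has_signature_antilin_eta:
  assumes n: "n \<le> CARD('m::finite)"
  shows "has_signature (\<lambda>u v :: real^('m + 'm). u \<bullet> ((Bs ** antilin (eta n)) *v v)) (2 * n) (2 * CARD('m) - 2 * n)"
proof -
  let ?s = "\<lambda>r :: 'm + 'm. case r of Inl i \<Rightarrow> eta n $ i $ i | Inr i \<Rightarrow> (eta n $ i $ i :: real)"
  have blk: "Bs ** antilin (eta n) = (blk (eta n) 0 0 (eta n) :: real^('m + 'm)^('m + 'm))"
    by (simp add: Bs_def antilin_def blk_mult matrix_mult_simps)
  have comp: "axis r 1 \<bullet> ((Bs ** antilin (eta n)) *v axis s 1) = (if r = s then ?s r else 0)" for r s :: "'m + 'm"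
    unfolding blk
    by (cases r; cases s) (simp_all add: matrix_vector_mult_basis column_def inner_axis' eta_entry)
  have sym: "u \<bullet> ((Bs ** antilin (eta n)) *v v) = v \<bullet> ((Bs ** antilin (eta n)) *v u)" for u v :: "real^('m + 'm)"
  proof -
    have "transpose (Bs ** antilin (eta n)) = (Bs ** antilin (eta n) :: real^('m + 'm)^('m + 'm))"
      unfolding blk by (simp add: transpose_blk transpose_eta transpose_simps)
    then show ?thesis by (metis inner_commute inner_transpose)
  qed
  have "has_signature (\<lambda>u v :: real^('m + 'm). u \<bullet> ((Bs ** antilin (eta n)) *v v))
      (card {r \<in> UNIV. ?s r > 0}) (card {r \<in> UNIV. ?s r < 0})"
    by (rule has_signature_orthogonal_basis[where e="\<lambda>r. axis r 1", OF bilinear_matrix sym])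
      (simp_all add: comp eta_entry split: sum.split)
  moreover have "{r \<in> UNIV. ?s r > 0} = Inl ` {i. pos i < n} \<union> Inr ` {i. pos i < n}"
  proof -
    have "r \<in> {r \<in> UNIV. ?s r > 0} \<longleftrightarrow> r \<in> Inl ` {i. pos i < n} \<union> Inr ` {i. pos i < n}" for r
      by (cases r) (auto simp: eta_entry)
    then show ?thesis by blast
  qed
  moreover have "card (Inl ` {i :: 'm. pos i < n} \<union> Inr ` {i :: 'm. pos i < n} :: ('m + 'm) set) = 2 * n"
    by (subst card_Un_disjoint) (auto simp: card_image card_pos_less[OF n])
  ultimately have sig: "has_signature (\<lambda>u v :: real^('m + 'm). u \<bullet> ((Bs ** antilin (eta n)) *v v))
      (2 * n) (card {r \<in> UNIV. ?s r < 0})" by simp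
  have "card {r \<in> UNIV. ?s r < 0} = 2 * CARD('m) - 2 * n"
  proof -
    have "2 * n + card {r \<in> UNIV. ?s r < 0} = DIM(real^('m + 'm))"
      using sig unfolding has_signature_def by blast
    then show ?thesis by simp
  qed
  with sig show ?thesis by simp
qed

text \<open>By \<open>model\<close> the fiber \<open>P (eta p)\<close> is a single orbit, which
  \<open>P\<close> may select by a signature. The local section around a point of this orbit is
  valid for every nearby \<open>std_pred\<close> structure, in particular for those that satisfy
  \<open>P\<close>.\<close>

lemma complex_fiber_bundle:
  fixes A :: "('a::{t2_space, second_countable_topology}, 'm::finite) chart set" and Th :: "real^'m^'m"
  assumes A: "smooth_atlas A" "pseudo_riemannian A g p q"
    and natural: "\<And>h M N T. M ** N = mat 1 \<Longrightarrow> invertible h \<Longrightarrow>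
      P (transpose M ** h ** M) T \<longleftrightarrow> P h (GG M N ** T ** GG N M)"
    and Z: "\<And>x. Z x = {S \<in> gEnd A x. \<forall>c\<in>charts_at A x. P (g x c) (S c)}"
    and lam: "lam * lam = 1" and Th: "Th ** Th = mat lam" "transpose Th = lam *\<^sub>R Th"
    and Q: "Q' ** Q = mat 1"
    and model: "\<And>T. P (eta p) (Q ** T ** Q') \<longleftrightarrow> (\<exists>a\<in>carrier O_complex. orbit_map Th a = T)"
  shows "fiber_bundle A Z (O_complex :: (complex^'m^'m) monoid) (stabilizer Th)"
proof (rule fiber_bundle_homogeneous[where P=P and phi="\<lambda>a. Q ** orbit_map Th a ** Q'",
      OF A natural Z group_O_complex closed_O_complex subgroup_stabilizer closed_stabilizer])
  have QQ': "Q ** Q' = mat 1" by (rule matrix_mult_left_right[OF Q])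
  have conjQ: "Q' ** (Q ** T ** Q') ** Q = T" "Q ** (Q' ** T ** Q) ** Q' = T" for T
  proof -
    have "Q' ** (Q ** T ** Q') ** Q = (Q' ** Q) ** T ** (Q' ** Q)" by (simp only: matrix_mul_assoc)
    then show "Q' ** (Q ** T ** Q') ** Q = T" by (simp add: Q)
    have "Q ** (Q' ** T ** Q) ** Q' = (Q ** Q') ** T ** (Q ** Q')" by (simp only: matrix_mul_assoc)
    then show "Q ** (Q' ** T ** Q) ** Q' = T" by (simp add: QQ')
  qed
  show "smooth_on UNIV (\<lambda>a. Q ** orbit_map Th a ** Q')"
    by (intro smooth_on_matrix_mult smooth_on_const smooth_on_orbit_map open_UNIV)
  show "P (eta p) (Q ** orbit_map Th a ** Q')" if "a \<in> carrier O_complex" for a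
    using that unfolding model by blast
  show "Q ** orbit_map Th a ** Q' = Q ** orbit_map Th b ** Q' \<longleftrightarrow>
      inv\<^bsub>O_complex\<^esub> a \<otimes>\<^bsub>O_complex\<^esub> b \<in> stabilizer Th"
    if a: "a \<in> carrier O_complex" and b: "b \<in> carrier O_complex" for a b
  proof -
    have "Q ** orbit_map Th a ** Q' = Q ** orbit_map Th b ** Q' \<longleftrightarrow> orbit_map Th a = orbit_map Th b"
      by (metis conjQ(1))
    then show ?thesis
      using O_complex_closed_mult[OF O_complex_transpose[OF a] b]
      by (simp add: orbit_map_eq_iff[OF a b] inv_O_complex[OF a] O_complex_mult stabilizer_def)
  qed
  show "\<exists>W \<alpha>. open W \<and> T \<in> W \<and> smooth_on W \<alpha> \<and>
      (\<forall>T'\<in>W. P (eta p) T' \<longrightarrow> \<alpha> T' \<in> carrier O_complex \<and> Q ** orbit_map Th (\<alpha> T') ** Q' = T')"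
    if T: "P (eta p) T" for T
  proof -
    have orb: "\<exists>a\<in>carrier O_complex. orbit_map Th a = Q' ** T ** Q" if "P (eta p) T" for T
      using that model[of "Q' ** T ** Q"] unfolding conjQ by blast
    have std: "std_pred lam (Q' ** T ** Q)" if T: "P (eta p) T" for T
      using orb[OF T] std_pred_conj[OF _ std_pred_antilin[OF Th]] unfolding orbit_map_def by metis
    obtain a1 where a1: "a1 \<in> carrier O_complex" "orbit_map Th a1 = Q' ** T ** Q" using orb[OF T] by blast
    obtain W \<alpha> where W: "open W" "Q' ** T ** Q \<in> W" "smooth_on W \<alpha>"
      and \<alpha>: "\<And>T. T \<in> W \<Longrightarrow> std_pred lam T \<Longrightarrow> \<alpha> T \<in> carrier O_complex \<and> orbit_map Th (\<alpha> T) = T"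
      using orbit_map_local_section[OF lam Th a1(1)] unfolding a1(2) by blast
    have sm: "smooth_on UNIV (\<lambda>T. Q' ** T ** Q)"
      by (intro smooth_on_matrix_mult smooth_on_const open_UNIV smooth_on_bounded_linear[OF bounded_linear_ident])
    define W' where "W' = UNIV \<inter> (\<lambda>T. Q' ** T ** Q) -` W"
    have W': "open W'" unfolding W'_def
      by (rule continuous_open_preimage[OF smooth_on_continuous_on[OF sm] open_UNIV W(1)])
    show ?thesis
    proof (intro exI[of _ W'] exI[of _ "\<lambda>T. \<alpha> (Q' ** T ** Q)"] conjI ballI impI W')
      show "T \<in> W'" using W(2) by (simp add: W'_def)
      show "smooth_on W' (\<lambda>T. \<alpha> (Q' ** T ** Q))"
        by (rule smooth_on_compose[OF W' W(1,3) smooth_on_subset[OF sm]]) (auto simp: W'_def)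
      fix T' assume T': "T' \<in> W'" "P (eta p) T'"
      have "\<alpha> (Q' ** T' ** Q) \<in> carrier O_complex \<and> orbit_map Th (\<alpha> (Q' ** T' ** Q)) = Q' ** T' ** Q"
        using T'(1) by (intro \<alpha> std T'(2)) (simp add: W'_def)
      then show "\<alpha> (Q' ** T' ** Q) \<in> carrier O_complex" "Q ** orbit_map Th (\<alpha> (Q' ** T' ** Q)) ** Q' = T'"
        by (simp_all add: conjQ(2))
    qed
  qed
qed

text \<open>In the frame \<open>Q\<close> the form \<open>beta_form\<close> becomes
  \<open>Bs ** T\<close>. Its signature is the invariant that separates the orbits:
  \<open>real_transitivity\<close> gives one direction, and invariance of the signature under
  congruence gives the other.\<close>

lemma real_model:
  fixes Q :: "real^('m::finite + 'm)^('m + 'm)"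
  assumes n: "n \<le> CARD('m)" and QQ: "Q' ** Q = mat 1" and J: "Q ** Js ** Q' = Ik (- 1) (eta p)"
    and B: "transpose Q ** Bm ** Q = Bs ** Js"
  shows "fiber_pred_sig n (eta p) (Q ** T ** Q') \<longleftrightarrow> (\<exists>a\<in>carrier O_complex. orbit_map (eta n) a = T)"
proof -
  let ?C = "transpose ((Q ** T ** Q') ** Ik (- 1) (eta p)) ** Bm"
  have pred: "fiber_pred 1 (- 1) (eta p) (Q ** T ** Q') \<longleftrightarrow> std_pred 1 T"
    by (rule fiber_pred_eq_std_pred[OF QQ J]) (simp_all add: B)
  have QQ': "Q ** Q' = mat 1" by (rule matrix_mult_left_right[OF QQ])
  have tr: "transpose Q ** transpose Q' = mat 1"
    by (simp add: matrix_transpose_mul[symmetric] QQ transpose_mat)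
  have tr': "transpose Q' ** transpose Q = mat 1" by (rule matrix_mult_left_right[OF tr])
  \<comment> \<open>The factor \<open>Js\<close> from \<open>Ik (- 1)\<close> meets the factor
    \<open>Js\<close> in the rotated form; moving them together leaves the symmetric form
    \<open>Bs ** T\<close>.\<close>
  have C: "transpose Q ** ?C ** Q = Bs ** T" if T: "std_pred 1 T"
  proof -
    have TJ: "T ** Js = - (Js ** T)" and TB: "transpose T ** Bs = Bs ** T" using T by (simp_all add: std_pred_def)
    have "transpose Q ** ?C ** Q = (transpose Q ** transpose Q') ** transpose (T ** Js) ** (transpose Q ** Bm ** Q)"
      unfolding J[symmetric] matrix_conj_mult[OF QQ] by (simp only: matrix_transpose_mul matrix_mul_assoc)
    also have "\<dots> = transpose (T ** Js) ** (Bs ** Js)" by (simp only: tr B matrix_mul_lid)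
    also have "\<dots> = - (Js ** (transpose T ** Bs) ** Js)"
      by (simp add: matrix_transpose_mul Js_mult matrix_mult_simps matrix_mul_assoc)
    also have "\<dots> = - ((Js ** Bs) ** (T ** Js))" by (simp only: TB matrix_mul_assoc)
    also have "\<dots> = - (Bs ** (Js ** Js) ** T)" by (simp add: Js_mult(3) TJ matrix_mult_simps matrix_mul_assoc)
    also have "\<dots> = Bs ** T" by (simp add: Js_mult matrix_mult_simps)
    finally show ?thesis .
  qed
  have sig: "has_signature (beta_form (eta p) (Q ** T ** Q')) k l \<longleftrightarrow>
      has_signature (\<lambda>u v. u \<bullet> ((Bs ** T) *v v)) k l" if T: "std_pred 1 T" for k l
  proof
    assume "has_signature (beta_form (eta p) (Q ** T ** Q')) k l"
    then show "has_signature (\<lambda>u v. u \<bullet> ((Bs ** T) *v v)) k l"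
      using has_signature_congruence[OF QQ, of ?C k l] unfolding beta_form_eq C[OF T] by blast
  next
    have "transpose Q' ** (Bs ** T) ** Q' = (transpose Q' ** transpose Q) ** ?C ** (Q ** Q')"
      unfolding C[OF T, symmetric] by (simp only: matrix_mul_assoc)
    then have e: "transpose Q' ** (Bs ** T) ** Q' = ?C" by (simp add: tr' QQ')
    assume "has_signature (\<lambda>u v. u \<bullet> ((Bs ** T) *v v)) k l"
    from has_signature_congruence[OF QQ' this] show "has_signature (beta_form (eta p) (Q ** T ** Q')) k l"
      unfolding beta_form_eq e .
  qed
  show ?thesis
  proof
    assume "fiber_pred_sig n (eta p) (Q ** T ** Q')"
    then have T: "std_pred 1 T" and "has_signature (\<lambda>u v. u \<bullet> ((Bs ** T) *v v)) (2 * n) (2 * CARD('m) - 2 * n)"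
      unfolding fiber_pred_sig_def pred using sig by blast+
    then show "\<exists>a\<in>carrier O_complex. orbit_map (eta n) a = T"
      using real_transitivity[OF T refl _ n] by blast
  next
    assume "\<exists>a\<in>carrier O_complex. orbit_map (eta n) a = T"
    then obtain a where a: "a \<in> carrier O_complex" and aT: "orbit_map (eta n) a = T" by blast
    note C2 = C2R_orthogonal[OF a]
    have T: "std_pred 1 T" unfolding aT[symmetric] orbit_map_def
      by (intro std_pred_conj[OF a] std_pred_antilin) (simp_all add: eta_mult_eta transpose_eta)
    have iso: "transpose (C2R (transpose a)) ** Bs = Bs ** C2R a"
      using isometry_inverse(2)[OF C2(1,3)] by simp
    have "transpose (C2R (transpose a)) ** (Bs ** antilin (eta n)) ** C2R (transpose a)
        = (transpose (C2R (transpose a)) ** Bs) ** antilin (eta n) ** C2R (transpose a)"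
      by (simp only: matrix_mul_assoc)
    also have "\<dots> = Bs ** T" unfolding iso aT[symmetric] orbit_map_def by (simp only: matrix_mul_assoc)
    finally have e: "transpose (C2R (transpose a)) ** (Bs ** antilin (eta n)) ** C2R (transpose a) = Bs ** T" .
    have "has_signature (\<lambda>u v. u \<bullet> ((Bs ** T) *v v)) (2 * n) (2 * CARD('m) - 2 * n)"
      using has_signature_congruence[OF C2(2) has_signature_antilin_eta[OF n]] unfolding e .
    then show "fiber_pred_sig n (eta p) (Q ** T ** Q')"
      unfolding fiber_pred_sig_def pred using T sig by blast
  qed
qed

section \<open>Sections, forced dimensions and assembly of the four cases\<close>

lemma twistor_fiber_eq:
  "twistor_fiber A g lam ell x = {S \<in> gEnd A x. \<forall>c\<in>charts_at A x. fiber_pred lam (- lam * ell) (g x c) (S c)}"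
  by (simp add: twistor_fiber_def fiber_pred_def)

lemma twistor_fiber_sig_eq:
  "twistor_fiber_sig A g n x = {S \<in> gEnd A x. \<forall>c\<in>charts_at A x. fiber_pred_sig n (g x c) (S c)}"
  unfolding twistor_fiber_sig_def twistor_fiber_eq fiber_pred_sig_def by auto

lemma integrable_structure_section:
  "integrable_structure A g lam ell S \<Longrightarrow> smooth_section A (twistor_fiber A g lam ell) S"
  unfolding integrable_structure_def generalized_structure_def smooth_section_def twistor_fiber_def by blast

lemma integrable_structure_sig_section:
  assumes "integrable_structure_sig A g n S"
  shows "smooth_section A (twistor_fiber_sig A g n) S"
  using assms integrable_structure_section[of A g 1 1 S]
  unfolding integrable_structure_sig_def smooth_section_def twistor_fiber_sig_def by blast

lemma ex_chart:
  assumes A: "smooth_atlas A" and g: "pseudo_riemannian A g p q" and S: "integrable_structure A g lam ell S"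
  obtains x c where "has_signature (\<lambda>u v. u \<bullet> (g x c *v v)) p q" "fiber_pred lam (- lam * ell) (g x c) (S x c)"
proof -
  obtain x c where "c \<in> charts_at A x" using A unfolding smooth_atlas_def charts_at_def by blast
  then show ?thesis
    using that[of x c] g S
    unfolding pseudo_riemannian_def integrable_structure_def generalized_structure_def fiber_pred_def by blast
qed

text \<open>An orthonormal frame and then the model frame \<open>Q\<close> turn the structure into a
  quaternionic one on the complex coordinate space, and this forces even complex dimension.\<close>

lemma even_dimension:
  assumes h: "has_signature (\<lambda>u v. u \<bullet> (h *v v)) p q" and T: "fiber_pred (- 1) (- 1) (h :: real^'m::finite^'m) T"
  shows "even CARD('m)"
proof -
  obtain E :: "real^'m^'m" where E: "transpose E ** h ** E = eta p" by (rule orthonormal_frame[OF h])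
  have NE: "(eta p ** transpose E ** h) ** E = mat 1"
    using E by (simp add: matrix_mul_assoc[symmetric] eta_mult_eta)
  obtain T' :: "real^('m + 'm)^('m + 'm)" where T': "fiber_pred (- 1) (- 1) (eta p) T'"
    using fiber_pred_natural[OF matrix_mult_left_right[OF NE] has_signature_matrix(2)[OF h]]
      GG_conj_back[OF NE] T unfolding E by metis
  obtain Q Q' :: "real^('m + 'm)^('m + 'm)" where Q: "Q' ** Q = mat 1" "Q ** Js ** Q' = Ik (- 1) (eta p)"
    "transpose Q ** Bm ** Q = (if (- 1 :: real) = 1 then Bs ** Js else Bs)"
    by (rule ex_model_frame)
  have "Q ** (Q' ** T' ** Q) ** Q' = (Q ** Q') ** T' ** (Q ** Q')" by (simp only: matrix_mul_assoc)
  then have "Q ** (Q' ** T' ** Q) ** Q' = T'" by (simp add: matrix_mult_left_right[OF Q(1)])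
  then have "std_pred (- 1) (Q' ** T' ** Q)"
    using fiber_pred_eq_std_pred[OF Q, of "Q' ** T' ** Q"] T' by simp
  then show ?thesis by (rule complex_structure_transitivity(1))
qed

theorem theorem4p1:
  fixes A :: "('a::{t2_space, second_countable_topology}, 'm::finite) chart set"
    and g :: "'a \<Rightarrow> ('a, 'm) chart \<Rightarrow> real^'m^'m"
    and p q :: nat
  assumes "smooth_atlas A"
    and "pseudo_riemannian A g p q"
  shows
    "(\<forall>n\<le>CARD('m).
        (\<forall>S. integrable_structure_sig A g n S \<longrightarrow> smooth_section A (twistor_fiber_sig A g n) S) \<and>
        fiber_bundle A (twistor_fiber_sig A g n)
          (O_complex :: (complex^'m^'m) monoid) (O_real_form n))
   \<and> ((\<forall>S. integrable_structure A g 1 (-1) S \<longrightarrow> smooth_section A (twistor_fiber A g 1 (-1)) S) \<and>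
        fiber_bundle A (twistor_fiber A g 1 (-1))
          ((O_real p :: (real^'m^'m) monoid) \<times>\<times> (O_real p :: (real^'m^'m) monoid))
          ((\<lambda>T. (T, T)) ` carrier (O_real p)))
   \<and> ((\<exists>S. integrable_structure A g (-1) 1 S) \<longrightarrow> p = q)
   \<and> (p = q \<longrightarrow>
        (\<forall>S. integrable_structure A g (-1) 1 S \<longrightarrow> smooth_section A (twistor_fiber A g (-1) 1) S) \<and>
        fiber_bundle A (twistor_fiber A g (-1) 1)
          ((O_real p :: (real^'m^'m) monoid) \<times>\<times> (O_real p :: (real^'m^'m) monoid))
          ((\<lambda>T. (T, swap_mat ** T ** swap_mat)) ` carrier (O_real p)))
   \<and> ((\<exists>S. integrable_structure A g (-1) (-1) S) \<longrightarrow> even CARD('m))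
   \<and> (even CARD('m) \<longrightarrow>
        (\<forall>S. integrable_structure A g (-1) (-1) S \<longrightarrow>
           smooth_section A (twistor_fiber A g (-1) (-1)) S) \<and>
        fiber_bundle A (twistor_fiber A g (-1) (-1))
          (O_complex :: (complex^'m^'m) monoid) SO_star)"
proof -
  have sections: "\<forall>S. integrable_structure A g lam ell S \<longrightarrow> smooth_section A (twistor_fiber A g lam ell) S" for lam ell
    using integrable_structure_section by blast
  have 1: "fiber_bundle A (twistor_fiber_sig A g n) (O_complex :: (complex^'m^'m) monoid) (O_real_form n)"
    if n: "n \<le> CARD('m)" for n
  proof -
    obtain Q Q' :: "real^('m + 'm)^('m + 'm)" where Q: "Q' ** Q = mat 1" "Q ** Js ** Q' = Ik (- 1) (eta p)"
      "transpose Q ** Bm ** Q = (if (1 :: real) = 1 then Bs ** Js else Bs)"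
      by (rule ex_model_frame)
    show ?thesis
      unfolding O_real_form_eq_stabilizer
    proof (rule complex_fiber_bundle[where P="fiber_pred_sig n" and lam=1 and Q=Q and Q'=Q', OF assms])
      show "fiber_pred_sig n (transpose M ** h ** M) T \<longleftrightarrow> fiber_pred_sig n h (GG M N ** T ** GG N M)"
        if "M ** N = mat 1" "invertible h" for h M N :: "real^'m^'m" and T
        by (rule fiber_pred_sig_natural[OF that])
      show "twistor_fiber_sig A g n x = {S \<in> gEnd A x. \<forall>c\<in>charts_at A x. fiber_pred_sig n (g x c) (S c)}" for x
        by (rule twistor_fiber_sig_eq)
      show "Q' ** Q = mat 1" by (rule Q(1))
      show "fiber_pred_sig n (eta p) (Q ** T ** Q') \<longleftrightarrow> (\<exists>a\<in>carrier O_complex. orbit_map (eta n) a = T)" for T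
        by (rule real_model[OF n Q(1,2)]) (use Q(3) in simp)
    qed (simp_all add: eta_mult_eta transpose_eta)
  qed
  \<comment> \<open>With the identity as base point \<open>R0\<close> the subgroup becomes the
    diagonal.\<close>
  have 2: "fiber_bundle A (twistor_fiber A g 1 (-1))
          ((O_real p :: (real^'m^'m) monoid) \<times>\<times> (O_real p :: (real^'m^'m) monoid))
          ((\<lambda>T. (T, T)) ` carrier (O_real p))"
    using para_fiber_bundle[OF assms, of 1 "mat 1" "twistor_fiber A g 1 (-1)"]
    by (simp add: twistor_fiber_eq transpose_mat)
  have 3: "p = q" if "\<exists>S. integrable_structure A g (-1) 1 S"
  proof -
    obtain S where "integrable_structure A g (-1) 1 S" using \<open>\<exists>S. _ S\<close> by blast
    then obtain x c where "has_signature (\<lambda>u v. u \<bullet> (g x c *v v)) p q" "fiber_pred (- 1) (- (- 1) * 1) (g x c) (S x c)"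
      by (rule ex_chart[OF assms])
    then show ?thesis using neutral_signature[of "g x c" p q "S x c"] by simp
  qed
  have 4: "fiber_bundle A (twistor_fiber A g (-1) 1)
          ((O_real p :: (real^'m^'m) monoid) \<times>\<times> (O_real p :: (real^'m^'m) monoid))
          ((\<lambda>T. (T, swap_mat ** T ** swap_mat)) ` carrier (O_real p))" if "p = q"
  proof -
    \<comment> \<open>The metric at a single point gives \<open>CARD('m) = p + q = 2 * p\<close>, so
      that the swap exchanges halves of length \<open>p\<close>.\<close>
    obtain x c where "c \<in> charts_at A x" using assms(1) unfolding smooth_atlas_def charts_at_def by blast
    then have "has_signature (\<lambda>u v. u \<bullet> (g x c *v v)) p q"
      using assms(2) unfolding pseudo_riemannian_def by blast
    then have "CARD('m) = 2 * p" using \<open>p = q\<close> by (simp add: has_signature_def)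
    note swap = swap_mat_properties[OF this]
    show ?thesis
      by (rule para_fiber_bundle[OF assms _ _ swap]) (simp_all add: twistor_fiber_eq)
  qed
  have 5: "even CARD('m)" if "\<exists>S. integrable_structure A g (-1) (-1) S"
  proof -
    obtain S where "integrable_structure A g (-1) (-1) S" using \<open>\<exists>S. _ S\<close> by blast
    then obtain x c where "has_signature (\<lambda>u v. u \<bullet> (g x c *v v)) p q" "fiber_pred (- 1) (- (- 1) * (- 1)) (g x c) (S x c)"
      by (rule ex_chart[OF assms])
    then show ?thesis using even_dimension[of "g x c" p q "S x c"] by simp
  qed
  have 6: "fiber_bundle A (twistor_fiber A g (-1) (-1)) (O_complex :: (complex^'m^'m) monoid) SO_star"
    if m: "even CARD('m)"
  proof -
    obtain Q Q' :: "real^('m + 'm)^('m + 'm)" where Q: "Q' ** Q = mat 1" "Q ** Js ** Q' = Ik (- 1) (eta p)"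
      "transpose Q ** Bm ** Q = (if (- 1 :: real) = 1 then Bs ** Js else Bs)"
      by (rule ex_model_frame)
    have model: "fiber_pred (- 1) (- 1) (eta p) (Q ** T ** Q') \<longleftrightarrow> (\<exists>a\<in>carrier O_complex. orbit_map Omega a = T)" for T
    proof -
      have "fiber_pred (- 1) (- 1) (eta p) (Q ** T ** Q') \<longleftrightarrow> std_pred (- 1) T"
        by (rule fiber_pred_eq_std_pred[OF Q]) simp_all
      moreover have "std_pred (- 1) (orbit_map Omega a)" if "a \<in> carrier (O_complex :: (complex^'m^'m) monoid)" for a
        unfolding orbit_map_def by (intro std_pred_conj[OF that] std_pred_antilin Omega_properties[OF m])
      ultimately show ?thesis using complex_structure_transitivity(2)[of T] by blast
    qed
    show ?thesis
      unfolding SO_star_eq_stabilizer[OF m]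
      by (rule complex_fiber_bundle[where P="fiber_pred (- 1) (- 1)" and lam="- 1",
            OF assms fiber_pred_natural _ _ Omega_properties[OF m] Q(1) model])
        (simp_all add: twistor_fiber_eq)
  qed
  show ?thesis using 1 2 3 4 5 6 sections integrable_structure_sig_section by blast
qed

end
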